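(* Let $D$ be a v-alternating virtual link diagram. Then $$\operatorname{span}(D)=4\bigl(c(D)-g(D)+m-1\bigr)+2,$$ where $c(D)$ is the number of real crossings of $D$, $g(D)$ is the supporting genus of $D$, and $m$ is the number of connected components of $D$. In particular, if $D$ is a connected v-alternating virtual link diagram, then $$\operatorname{span}(D)=4\bigl(c(D)-g(D)\bigr)+2.$$
   Context: Virtual link diagrams. An (oriented) virtual link diagram is a (nonempty) closed oriented 1-manifold generically immersed in $\mathbf{R}^2$, each double point being labeled either a real crossing (with over/under information, as in classical knot theory) or a virtual crossing (no over/under information). A diagram is alternating if, travelling along each component, over- and under-passes at real crossings alternate (virtual crossings ignored). Bracket and span. At a real crossing, the two regions swept by the over-arc when rotated counterclockwise towards the under-arc are joined by the A-splice; the other smoothing is the B-splice. A state $S$ of $D$ is obtained by an A- or B-splice at each real crossing (virtual crossings are kept); $\natural(S)$ is the number of A-splices minus the number of B-splices, $\sharp(S)$ is the number of loops of $S$. Set $\langle D\rangle=\sum_S A^{\natural(S)}(-A^2-A^{-2})^{\sharp(S)-1}$ and $f_D(A)=(-A^3)^{-\omega(D)}\langle D\rangle\in\mathbf{Z}[A,A^{-1}]$, where $\omega(D)$ is the number of positive minus the number of negative real crossings. $\operatorname{span}(D)$ is the maximal degree minus the minimal degree of $f_D(A)$. Associated surface. An abstract link diagram (ALD) is a pair $(\Sigma,\mathcal D)$ of a compact oriented surface $\Sigma$ and a link diagram $\mathcal D$ in $\Sigma$ such that the underlying graph $|\mathcal D|$ (crossings replaced by 4-valent vertices; circle components allowed)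 is a deformation retract of $\Sigma$. The ALD $\phi(D)=(\Sigma,\mathcal D)$ associated with $D$ is obtained by thickening $D$ to a planar regular neighborhood at real crossings and along arcs, while at each virtual crossing the two bands pass one over the other without meeting; equivalently it is a regular neighborhood of a realization of $D$ as a link diagram in a closed oriented surface. The supporting genus $g(D)$ is the minimal genus of a closed oriented surface in which $D$ can be realized as a link diagram (equivalently, in which $\Sigma$ embeds); the genus of a disconnected surface is the sum of the genera of its components. A real crossing $p$ of $D$ is proper if the four boundary arcs of $\Sigma$ in the neighborhood of the corresponding crossing of $\mathcal D$ belong to four distinct connected components of $\partial\Sigma$; $D$ is proper if every real crossing is proper. Virtualizing. $D'$ is obtained from $D$ by virtualizing a real crossing $p$ if $D'$ is $D$ with $p$ replaced by a virtual crossing. A diagram is v-alternating if it is obtained from a proper alternating virtual link diagram by virtualizing one real crossing. Connected components. Let $C_1,\dots,C_\mu$ be the immersed circles of $D$. Take the equivalence relation generated by $C_i\sim C_j$ when $C_i\cap C_j$ contains at least one real crossing; the restriction of $D$ to the union of the circles in an equivalence class is a connected component of $D$. $D$ is connected if it has exactly one connected component. *)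

theory Defs
  imports "HOL-Analysis.Analysis" "HOL-Library.Poly_Mapping"
begin

section \<open>Virtual link diagrams\<close>

text \<open>
  The plane is \<^typ>\<open>complex\<close>.  A closed oriented 1-manifold is a disjoint union of
  \<open>ncomp D\<close> circles; the \<open>i\<close>-th circle is the real line modulo 1, so its immersion
  \<open>curve D i\<close> is a 1-periodic function, oriented by increasing parameter.  A point of the
  1-manifold is a pair \<open>(i, t)\<close> with \<open>i < ncomp D\<close> and \<open>0 \<le> t < 1\<close>.
  \<open>reals D\<close> is the set of double points labeled as real crossings (all other double
  points are virtual), and \<open>over D\<close> is the set of over-passages.
\<close>

type_synonym passage = "nat \<times> real"

record vdiagram =
  ncomp :: nat
  curve :: "nat \<Rightarrow> real \<Rightarrow> complex"
  reals :: "complex set"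
  over :: "passage set"

definition source :: "vdiagram \<Rightarrow> passage set" where
  "source D = {..<ncomp D} \<times> {0..<1}"

definition pt :: "vdiagram \<Rightarrow> passage \<Rightarrow> complex" where
  "pt D x = curve D (fst x) (snd x)"

definition tangent :: "vdiagram \<Rightarrow> passage \<Rightarrow> complex" where
  "tangent D x = vector_derivative (curve D (fst x)) (at (snd x))"

text \<open>Determinant of a pair of plane vectors: positive iff the direction of \<open>v\<close> is obtained from
  that of \<open>u\<close> by a counterclockwise rotation through an angle in \<open>(0, \<pi>)\<close>.\<close>

definition det2 :: "complex \<Rightarrow> complex \<Rightarrow> real" where
  "det2 u v = Re u * Im v - Im u * Re v"

definition double_points :: "vdiagram \<Rightarrow> complex set" where
  "double_points D = {p. \<exists>x\<in>source D. \<exists>y\<in>source D. x \<noteq> y \<and> pt D x = p \<and> pt D y = p}"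

definition generic_immersion :: "vdiagram \<Rightarrow> bool" where
  "generic_immersion D \<longleftrightarrow>
     (\<forall>i<ncomp D. (\<forall>t. curve D i (t + 1) = curve D i t) \<and>
        curve D i C1_differentiable_on UNIV \<and>
        (\<forall>t. vector_derivative (curve D i) (at t) \<noteq> 0)) \<and>
     finite (double_points D) \<and>
     (\<forall>x\<in>source D. \<forall>y\<in>source D. x \<noteq> y \<and> pt D x = pt D y \<longrightarrow>
        det2 (tangent D x) (tangent D y) \<noteq> 0) \<and>
     (\<forall>x\<in>source D. \<forall>y\<in>source D. \<forall>z\<in>source D.
        pt D x = pt D y \<and> pt D y = pt D z \<longrightarrow> x = y \<or> y = z \<or> x = z)"

definition passages :: "vdiagram \<Rightarrow> passage set" where
  "passages D = {x \<in> source D. pt D x \<in> reals D}"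

definition virtual_link_diagram :: "vdiagram \<Rightarrow> bool" where
  "virtual_link_diagram D \<longleftrightarrow>
     ncomp D \<ge> 1 \<and> generic_immersion D \<and>
     reals D \<subseteq> double_points D \<and>
     over D \<subseteq> passages D \<and>
     (\<forall>p\<in>reals D. \<exists>!x. x \<in> over D \<and> pt D x = p)"

definition crossing_number :: "vdiagram \<Rightarrow> nat" where
  "crossing_number D = card (reals D)"


section \<open>The 4-valent graph of a diagram with its cyclic orders\<close>

text \<open>
  The vertices of the underlying graph are the real crossings.  So that a circle component
  (a component without real crossings) is also covered, it is subdivided by one bivalent vertex
  placed at its base point \<open>(i, 0)\<close>.  Virtual crossings are not vertices.
\<close>

definition sites :: "vdiagram \<Rightarrow> passage set" where
  "sites D = passages D \<union>
     {(i, 0) | i. i < ncomp D \<and> (\<forall>t. (i, t) \<notin> passages D)}"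

text \<open>The next site met when travelling along the component in the direction of its orientation.\<close>

definition nxt :: "vdiagram \<Rightarrow> passage \<Rightarrow> passage" where
  "nxt D x = (fst x, frac (LEAST s. snd x < s \<and> (fst x, frac s) \<in> sites D))"

definition alternating :: "vdiagram \<Rightarrow> bool" where
  "alternating D \<longleftrightarrow> (\<forall>x\<in>passages D. nxt D x \<in> over D \<longleftrightarrow> x \<notin> over D)"

text \<open>\<open>Out x\<close> and \<open>In x\<close> are the two half-edges leaving the vertex along the strand of \<open>x\<close>,
  following the strand forwards and backwards, respectively.\<close>

datatype half_edge = Out (site: passage) | In (site: passage)

definition half_edges :: "vdiagram \<Rightarrow> half_edge set" where
  "half_edges D = Out ` sites D \<union> In ` sites D"

fun direction :: "vdiagram \<Rightarrow> half_edge \<Rightarrow> complex" where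
  "direction D (Out x) = tangent D x"
| "direction D (In x) = - tangent D x"

fun other_end :: "vdiagram \<Rightarrow> half_edge \<Rightarrow> half_edge" where
  "other_end D (Out x) = In (nxt D x)"
| "other_end D (In x) = Out (inv_into (sites D) (nxt D) x)"

text \<open>
  The half-edge following \<open>h\<close> in counterclockwise order at its vertex.  Of the two half-edges of
  the other strand at a real crossing it is the one at an angle in \<open>(0, \<pi>)\<close> from \<open>h\<close>.
\<close>

definition ccw :: "vdiagram \<Rightarrow> half_edge \<Rightarrow> half_edge" where
  "ccw D h =
     (if site h \<in> passages D then
        (THE h'. h' \<in> half_edges D \<and> pt D (site h') = pt D (site h) \<and>
                 0 < det2 (direction D h) (direction D h'))
      else (case h of Out x \<Rightarrow> In x | In x \<Rightarrow> Out x))"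


section \<open>Bracket polynomial and span\<close>

text \<open>Number of classes, meeting \<open>V\<close>, of the equivalence relation generated by \<open>R\<close>.\<close>

definition num_classes :: "'a set \<Rightarrow> ('a \<times> 'a) set \<Rightarrow> nat" where
  "num_classes V R = card ((\<lambda>v. (R \<union> converse R)\<^sup>* `` {v}) ` V)"

definition graph_of :: "('a \<Rightarrow> 'a) \<Rightarrow> 'a set \<Rightarrow> ('a \<times> 'a) set" where
  "graph_of f V = {(d, f d) | d. d \<in> V}"

text \<open>Elements of \<open>\<int>[A, A\<^sup>-\<^sup>1]\<close> are finitely supported functions from exponents to coefficients.\<close>

type_synonym laurent = "int \<Rightarrow>\<^sub>0 int"

abbreviation A_power :: "int \<Rightarrow> laurent" where
  "A_power k \<equiv> Poly_Mapping.single k 1"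

text \<open>
  A state is given by the set \<open>S \<subseteq> reals D\<close> of crossings where the A-splice is taken.
  Rotating the over-arc counterclockwise towards the under-arc sweeps the two corners between
  an over half-edge \<open>h\<close> and \<open>ccw D h\<close>.  The A-splice merges these two corners, so its two arcs
  cut off the other two: they join each under half-edge \<open>h\<close> to \<open>ccw D h\<close>.  The B-splice joins
  each over half-edge \<open>h\<close> to \<open>ccw D h\<close>.  At a bivalent vertex nothing is changed.
\<close>

definition splice_arcs :: "vdiagram \<Rightarrow> complex set \<Rightarrow> (half_edge \<times> half_edge) set" where
  "splice_arcs D S =
     {(h, ccw D h) | h. h \<in> half_edges D \<and>
        (site h \<in> passages D \<longrightarrow> (site h \<notin> over D \<longleftrightarrow> pt D (site h) \<in> S))}"

definition loops :: "vdiagram \<Rightarrow> complex set \<Rightarrow> nat" where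
  "loops D S = num_classes (half_edges D)
     (graph_of (other_end D) (half_edges D) \<union> splice_arcs D S)"

definition bracket :: "vdiagram \<Rightarrow> laurent" where
  "bracket D = (\<Sum>S\<in>Pow (reals D).
     A_power (int (card S) - int (card (reals D - S))) *
     (- A_power 2 - A_power (- 2)) ^ (loops D S - 1))"

text \<open>Real crossings of sign \<open>s\<close>; a crossing is positive iff the directed over-strand is turned
  to the directed under-strand by a counterclockwise rotation through less than \<open>\<pi>\<close>.\<close>

definition crossings_of_sign :: "vdiagram \<Rightarrow> real \<Rightarrow> complex set" where
  "crossings_of_sign D s = {p \<in> reals D.
     \<exists>x\<in>passages D. \<exists>y\<in>passages D. pt D x = p \<and> pt D y = p \<and> x \<in> over D \<and> y \<notin> over D \<and>
       sgn (det2 (tangent D x) (tangent D y)) = s}"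

definition writhe :: "vdiagram \<Rightarrow> int" where
  "writhe D = int (card (crossings_of_sign D 1)) - int (card (crossings_of_sign D (- 1)))"

text \<open>The power \<open>(- A\<^sup>3)\<^sup>k\<close> for an integer \<open>k\<close>.\<close>

definition minus_A_cubed_power :: "int \<Rightarrow> laurent" where
  "minus_A_cubed_power k =
     (if k \<ge> 0 then (- A_power 3) ^ nat k else (- A_power (- 3)) ^ nat (- k))"

definition f_poly :: "vdiagram \<Rightarrow> laurent" where
  "f_poly D = minus_A_cubed_power (- writhe D) * bracket D"

definition diagram_span :: "vdiagram \<Rightarrow> int" where
  "diagram_span D = Max (Poly_Mapping.keys (f_poly D)) - Min (Poly_Mapping.keys (f_poly D))"


section \<open>Associated surface and supporting genus\<close>

text \<open>
  Oriented ribbon graphs, given by their half-edges (darts), the involution \<open>edge\<close> exchanging the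
  two ends of each edge and the counterclockwise rotation \<open>rot\<close> around the vertices.  The ribbon
  surface has as boundary components the orbits of \<open>edge \<circ> rot\<close>: the corner between a dart \<open>h\<close>
  and \<open>rot h\<close> is represented by \<open>h\<close>, and following the side of the band of \<open>rot h\<close> that bounds
  this corner one arrives in the corner of \<open>edge (rot h)\<close>.
\<close>

record 'a ribbon =
  darts :: "'a set"
  edge :: "'a \<Rightarrow> 'a"
  rot :: "'a \<Rightarrow> 'a"

definition ribbon_graph :: "'a ribbon \<Rightarrow> bool" where
  "ribbon_graph M \<longleftrightarrow> finite (darts M) \<and>
     (\<forall>d\<in>darts M. edge M d \<in> darts M \<and> edge M d \<noteq> d \<and> edge M (edge M d) = d) \<and>
     bij_betw (rot M) (darts M) (darts M)"

definition same_boundary :: "'a ribbon \<Rightarrow> 'a \<Rightarrow> 'a \<Rightarrow> bool" where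
  "same_boundary M d e \<longleftrightarrow>
     (d, e) \<in> (graph_of (edge M \<circ> rot M) (darts M) \<union>
               converse (graph_of (edge M \<circ> rot M) (darts M)))\<^sup>*"

text \<open>The surface of the abstract link diagram associated with \<open>D\<close>.\<close>

definition ald :: "vdiagram \<Rightarrow> half_edge ribbon" where
  "ald D = \<lparr> darts = half_edges D, edge = other_end D, rot = ccw D \<rparr>"

definition proper_crossing :: "vdiagram \<Rightarrow> complex \<Rightarrow> bool" where
  "proper_crossing D p \<longleftrightarrow>
     (\<forall>h\<in>half_edges D. \<forall>h'\<in>half_edges D.
        site h \<in> passages D \<and> site h' \<in> passages D \<and>
        pt D (site h) = p \<and> pt D (site h') = p \<and> h \<noteq> h' \<longrightarrow> \<not> same_boundary (ald D) h h')"

definition proper :: "vdiagram \<Rightarrow> bool" where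
  "proper D \<longleftrightarrow> (\<forall>p\<in>reals D. proper_crossing D p)"

text \<open>
  Gluing a disc to every boundary component of a ribbon graph gives a closed oriented surface with
  a cell decomposition, and every closed oriented surface (possibly disconnected) arises so, up to
  spheres decomposed with a single vertex and no edge.  Its genus, the sum of the genera of
  its components, is determined by \<open>V - E + F = 2 k - 2 g\<close> with \<open>k\<close> the number of components.
\<close>

definition euler_char :: "'a ribbon \<Rightarrow> int" where
  "euler_char M =
     int (num_classes (darts M) (graph_of (rot M) (darts M)))
     - int (num_classes (darts M) (graph_of (edge M) (darts M)))
     + int (num_classes (darts M) (graph_of (edge M \<circ> rot M) (darts M)))"

definition surface_components :: "'a ribbon \<Rightarrow> nat" where
  "surface_components M =
     num_classes (darts M) (graph_of (rot M) (darts M) \<union> graph_of (edge M) (darts M))"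

definition has_genus :: "'a ribbon \<Rightarrow> nat \<Rightarrow> bool" where
  "has_genus M g \<longleftrightarrow> euler_char M = 2 * int (surface_components M) - 2 * int g"

text \<open>
  \<open>D\<close> is realized as a link diagram in the closed surface of \<open>M\<close> when its graph is embedded, with
  edges going to edges and with its counterclockwise order at each vertex, as a subgraph of the
  1-skeleton: at a vertex of \<open>M\<close>, the rotation skips the darts outside \<open>D\<close>.  This is no
  restriction, since any graph in a closed surface, meeting each component and having no isolated
  vertices, becomes the 1-skeleton of a cell decomposition after adding edges between its vertices;
  components not meeting the graph cannot lower the genus.
\<close>

definition realized_by :: "vdiagram \<Rightarrow> 'a ribbon \<Rightarrow> (half_edge \<Rightarrow> 'a) \<Rightarrow> bool" where
  "realized_by D M e \<longleftrightarrow>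
     inj_on e (half_edges D) \<and> e ` half_edges D \<subseteq> darts M \<and>
     (\<forall>h\<in>half_edges D. edge M (e h) = e (other_end D h)) \<and>
     (\<forall>h\<in>half_edges D. \<exists>k>0. (rot M ^^ k) (e h) = e (ccw D h) \<and>
        (\<forall>j. 0 < j \<and> j < k \<longrightarrow> (rot M ^^ j) (e h) \<notin> e ` half_edges D))"

definition supporting_genus :: "vdiagram \<Rightarrow> nat" where
  "supporting_genus D =
     (LEAST g. \<exists>(M :: nat ribbon) e. ribbon_graph M \<and> realized_by D M e \<and> has_genus M g)"


section \<open>Connected components and v-alternating diagrams\<close>

definition meets :: "vdiagram \<Rightarrow> (nat \<times> nat) set" where
  "meets D = {(i, j). i < ncomp D \<and> j < ncomp D \<and>
     range (curve D i) \<inter> range (curve D j) \<inter> reals D \<noteq> {}}"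

definition num_components :: "vdiagram \<Rightarrow> nat" where
  "num_components D = num_classes {..<ncomp D} (meets D)"

definition connected_diagram :: "vdiagram \<Rightarrow> bool" where
  "connected_diagram D \<longleftrightarrow> num_components D = 1"

definition virtualize :: "vdiagram \<Rightarrow> complex \<Rightarrow> vdiagram" where
  "virtualize D p = D\<lparr> reals := reals D - {p}, over := {x \<in> over D. pt D x \<noteq> p} \<rparr>"

definition v_alternating :: "vdiagram \<Rightarrow> bool" where
  "v_alternating D \<longleftrightarrow>
     (\<exists>D' p. virtual_link_diagram D' \<and> proper D' \<and> alternating D' \<and>
        p \<in> reals D' \<and> D = virtualize D' p)"

end

(*
  Write D' for the proper alternating diagram and p for the virtualized crossing.  In an alternating
  diagram all corners of a face of the associated surface are of the same type, so the loops of the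
  all-A and of the all-B state of D' together are exactly the faces.  By properness the four faces at
  p are distinct.  Virtualizing p merges two loops of either extreme state, and merges the four faces
  at p into one; hence the extreme states of D have (number of faces of D) + 1 loops together.

  Splicing differently at one crossing q of the all-A state of D never increases the number of loops:
  this could only go wrong if the two arcs at q were on one loop and coherently oriented there, but
  that loop runs through the two faces it merges in opposite directions.  Orientations are avoided:
  each class of half-edges, after cutting the diagram at p and q, contains as many under as over
  half-edges at the cuts.  Every further change of a splice adds at most one loop, so only the extreme
  states contribute to the extreme exponents of the bracket, and the span is obtained from the Euler
  characteristic V - E + F with V - E = - c(D).

  That the surface of the diagram itself realizes the supporting genus follows from the monotonicity
  of 2k - V + E - F under removing a dart, i.e. under composition with transpositions.
*)
theory Submission
  imports Defs "HOL-Combinatorics.Transposition"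
begin

section \<open>Classes of generated equivalences\<close>

text \<open>Surfaces, faces and loops never occur as spaces: each is a set of classes of half-edges,
  so every comparison counts classes after inserting a pair, deleting darts, or composing a
  permutation with a transposition. One argument serves both extreme states, because replacing the
  colour \<open>under_darts\<close> by its complement exchanges A-splices and B-splices. The states
  of \<open>D\<close> are read on the half-edges of \<open>D'\<close>, with the strands at
  \<open>p\<close> left crossed; this puts the loops of \<open>D\<close> and the faces of
  \<open>D'\<close>, where properness and alternation hold, on the same set. Only afterwards are the
  four darts at \<open>p\<close> deleted. The summand 2 of the formula measures the extra loop. If
  the extreme states have L_A and L_B loops, the bracket has width 2c + 2(L_A + L_B) - 4, and the
  number of faces is F = c + 2m - 2g. An equality L_A + L_B = F would give 4(c - g + m - 1); with F
  + 1 instead, 2 is added.\<close>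

definition conn :: "('a \<times> 'a) set \<Rightarrow> ('a \<times> 'a) set" where
  "conn R = (R \<union> converse R)\<^sup>*"

lemma num_classes_conn: "num_classes V R = card ((\<lambda>v. conn R `` {v}) ` V)"
  by (simp add: num_classes_def conn_def)

lemma conn_refl [simp]: "(x, x) \<in> conn R"
  by (simp add: conn_def)

lemma conn_sym: "(x, y) \<in> conn R \<Longrightarrow> (y, x) \<in> conn R"
  unfolding conn_def using sym_rtrancl[OF sym_Un_converse] by (rule symD)

lemma conn_trans: "(x, y) \<in> conn R \<Longrightarrow> (y, z) \<in> conn R \<Longrightarrow> (x, z) \<in> conn R"
  unfolding conn_def by (rule rtrancl_trans)

lemma conn_base: "(x, y) \<in> R \<Longrightarrow> (x, y) \<in> conn R"
  unfolding conn_def by blast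

lemma conn_superset: "R \<subseteq> conn R"
  by (auto intro: conn_base)

lemma conn_induct [consumes 1, case_names refl step]:
  assumes "(x, y) \<in> conn R" "P x"
    and "\<And>y z. (x, y) \<in> conn R \<Longrightarrow> (y, z) \<in> R \<or> (z, y) \<in> R \<Longrightarrow> P y \<Longrightarrow> P z"
  shows "P y"
  using assms(1) unfolding conn_def
  by (induction rule: rtrancl_induct) (use assms(2,3) in \<open>auto simp: conn_def\<close>)

lemma conn_class_eq: "conn R `` {x} = conn R `` {y} \<longleftrightarrow> (x, y) \<in> conn R"
proof
  assume "conn R `` {x} = conn R `` {y}"
  then have "y \<in> conn R `` {x}" by simp
  then show "(x, y) \<in> conn R" by simp
next
  assume xy: "(x, y) \<in> conn R"
  show "conn R `` {x} = conn R `` {y}"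
    using conn_trans[OF xy] conn_trans[OF conn_sym[OF xy]] by blast
qed

lemma conn_closed:
  assumes "(x, y) \<in> conn R" "x \<in> C" "\<And>u v. (u, v) \<in> R \<Longrightarrow> u \<in> C \<longleftrightarrow> v \<in> C"
  shows "y \<in> C"
  using assms(1,2) by (induction rule: conn_induct) (use assms(3) in blast)+

lemma conn_map:
  assumes "(x, y) \<in> conn R" "\<And>u v. (u, v) \<in> R \<Longrightarrow> (f u, f v) \<in> conn S"
  shows "(f x, f y) \<in> conn S"
  using assms(1)
proof (induction rule: conn_induct)
  case (step y z)
  then have "(f y, f z) \<in> conn S" using assms(2)[of y z] conn_sym[OF assms(2)[of z y]] by metis
  with step.IH show ?case by (rule conn_trans)
qed simp

lemma conn_least: assumes "R \<subseteq> conn S" shows "conn R \<subseteq> conn S"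
proof (rule subrelI)
  fix x y assume "(x, y) \<in> conn R"
  then show "(x, y) \<in> conn S" using conn_map[of x y R "\<lambda>x. x" S] assms by auto
qed

lemma conn_mono: "R \<subseteq> S \<Longrightarrow> conn R \<subseteq> conn S"
  by (rule conn_least) (auto intro: conn_base)

lemma conn_eqI: "R \<subseteq> conn S \<Longrightarrow> S \<subseteq> conn R \<Longrightarrow> conn R = conn S"
  using conn_least by blast

text \<open>The map \<open>f\<close> induces a bijection on classes, whose inverse need not be
  given. This is how darts, vertices and components, which are objects of different types, are
  counted against each other.\<close>

lemma num_classes_transfer:
  assumes "\<And>w. w \<in> W \<Longrightarrow> f w \<in> V"
    and "\<And>w w'. w \<in> W \<Longrightarrow> w' \<in> W \<Longrightarrow> (w, w') \<in> conn Q \<longleftrightarrow> (f w, f w') \<in> conn R"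
    and "\<And>v. v \<in> V \<Longrightarrow> \<exists>w\<in>W. (f w, v) \<in> conn R"
  shows "num_classes W Q = num_classes V R"
proof -
  let ?c = "\<lambda>w. conn Q `` {w}" and ?d = "\<lambda>v. conn R `` {v}"
  have im: "?d ` V = (?d \<circ> f) ` W"
  proof (intro equalityI subsetI)
    fix z assume "z \<in> ?d ` V"
    then obtain v where v: "v \<in> V" "z = ?d v" by blast
    then obtain w where "w \<in> W" "(f w, v) \<in> conn R" using assms(3) by blast
    then have "?d (f w) = ?d v" using conn_class_eq by metis
    then show "z \<in> (?d \<circ> f) ` W" using v \<open>w \<in> W\<close> by force
  qed (use assms(1) in auto)
  have eq: "?c w = ?c w' \<longleftrightarrow> ?d (f w) = ?d (f w')" if "w \<in> W" "w' \<in> W" for w w'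
    using assms(2)[OF that] conn_class_eq by metis
  \<comment> \<open>The induced map on classes; by \<open>eq\<close> any representative in
    \<open>W\<close> will do.\<close>
  define g where "g = (\<lambda>z. ?d (f (SOME w. w \<in> W \<and> ?c w = z)))"
  have g: "g (?c w) = ?d (f w)" if "w \<in> W" for w
  proof -
    have "\<exists>w'. w' \<in> W \<and> ?c w' = ?c w" using that by blast
    then show ?thesis unfolding g_def using eq that by (metis (mono_tags, lifting) someI_ex)
  qed
  have "bij_betw g (?c ` W) ((?d \<circ> f) ` W)"
    unfolding bij_betw_def inj_on_def using g eq by (auto simp: image_image)
  then show ?thesis unfolding num_classes_conn im using bij_betw_same_card by blast
qed

lemma num_classes_cong: "conn Q = conn R \<Longrightarrow> num_classes V Q = num_classes V R"
  by (simp add: num_classes_conn)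

text \<open>A retraction \<open>r\<close> that moves points along \<open>Q\<close> allows the points
  outside \<open>V\<close> to be dropped. It serves to delete the four darts at the virtualized
  crossing, once for loops and once for faces.\<close>

lemma num_classes_retract:
  assumes "V \<subseteq> W" "\<And>w. w \<in> W \<Longrightarrow> r w \<in> V" "\<And>w. w \<in> W \<Longrightarrow> (w, r w) \<in> conn Q"
    and "\<And>v. v \<in> V \<Longrightarrow> (v, r v) \<in> conn R"
    and "\<And>u v. (u, v) \<in> Q \<Longrightarrow> (r u, r v) \<in> conn R"
    and "\<And>u v. (u, v) \<in> R \<Longrightarrow> (u, v) \<in> conn Q"
  shows "num_classes V R = num_classes W Q"
proof (rule num_classes_transfer[where f = id])
  fix v v' assume v: "v \<in> V" "v' \<in> V"
  show "(v, v') \<in> conn R \<longleftrightarrow> (id v, id v') \<in> conn Q"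
  proof
    assume "(v, v') \<in> conn R"
    then show "(id v, id v') \<in> conn Q" using conn_map[of v v' R "\<lambda>x. x" Q] assms(6) by simp
  next
    assume "(id v, id v') \<in> conn Q"
    then have "(r v, r v') \<in> conn R" using conn_map[of v v' Q r R] assms(5) by simp
    then show "(v, v') \<in> conn R" using assms(4) v conn_sym conn_trans by metis
  qed
next
  fix w assume "w \<in> W"
  then show "\<exists>v\<in>V. (id v, w) \<in> conn Q" using assms(2,3) conn_sym by (metis id_apply)
qed (use assms(1) in auto)

lemma num_classes_empty [simp]: "num_classes V {} = card V"
proof -
  have "(\<lambda>v. conn {} `` {v}) ` V = (\<lambda>v. {v}) ` V" by (auto simp: conn_def)
  then show ?thesis by (simp add: num_classes_conn card_image)
qed

lemma conn_insert_in: "(a, b) \<in> conn R \<Longrightarrow> conn (insert (a, b) R) = conn R"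
  by (rule conn_eqI) (auto intro: conn_base)

text \<open>A path using the new pair several times can be shortened to one that uses it at most
  once.\<close>

lemma conn_insert_iff:
  "(x, y) \<in> conn (insert (a, b) R) \<longleftrightarrow>
     (x, y) \<in> conn R \<or> (x, a) \<in> conn R \<and> (b, y) \<in> conn R \<or> (x, b) \<in> conn R \<and> (a, y) \<in> conn R"
  (is "?L \<longleftrightarrow> ?R y")
proof
  assume ?L
  then show "?R y"
  proof (induction rule: conn_induct)
    case (step y z)
    from step.hyps(2) consider "(y, z) \<in> conn R" | "y = a" "z = b" | "y = b" "z = a"
      using conn_base conn_sym by fastforce
    then show ?case
    proof cases
      case 1 then show ?thesis using step.IH conn_trans by meson
    next
      case 2 then show ?thesis using step.IH conn_trans conn_sym by (metis conn_refl)
    next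
      case 3 then show ?thesis using step.IH conn_trans conn_sym by (metis conn_refl)
    qed
  qed simp
next
  have m: "conn R \<subseteq> conn (insert (a, b) R)" by (rule conn_mono) blast
  have ab: "(a, b) \<in> conn (insert (a, b) R)" by (rule conn_base) simp
  assume "?R y"
  then show ?L using m ab conn_sym[OF ab] conn_trans by (meson subsetD)
qed

lemma num_classes_insert:
  assumes "finite V" "a \<in> V" "b \<in> V"
  shows "num_classes V R = num_classes V (insert (a, b) R) + (if (a, b) \<in> conn R then 0 else 1)"
proof (cases "(a, b) \<in> conn R")
  case True
  then show ?thesis by (simp add: num_classes_conn conn_insert_in)
next
  case False
  let ?S = "insert (a, b) R"
  let ?c = "\<lambda>w. conn R `` {w}" and ?d = "\<lambda>v. conn ?S `` {v}"
  let ?Q = "?c ` V - {?c a, ?c b}"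
  have ab: "?c a \<noteq> ?c b" using False conn_class_eq by metis
  have da: "?d v = ?c a \<union> ?c b" if "(v, a) \<in> conn R \<or> (v, b) \<in> conn R" for v
  proof -
    have "(v, y) \<in> conn ?S \<longleftrightarrow> (a, y) \<in> conn R \<or> (b, y) \<in> conn R" for y
      unfolding conn_insert_iff using that conn_sym conn_trans by metis
    then show ?thesis by auto
  qed
  have dn: "?d v = ?c v" if "\<not> ((v, a) \<in> conn R \<or> (v, b) \<in> conn R)" for v
    using that conn_insert_iff[of _ _ a b R] by auto
  have "?d ` V = insert (?c a \<union> ?c b) ?Q"
  proof (intro equalityI subsetI)
    fix z assume "z \<in> ?d ` V"
    then obtain v where v: "v \<in> V" "z = ?d v" by blast
    show "z \<in> insert (?c a \<union> ?c b) ?Q"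
    proof (cases "(v, a) \<in> conn R \<or> (v, b) \<in> conn R")
      case True then show ?thesis using v da by blast
    next
      case f: False
      then have "?c v \<noteq> ?c a" "?c v \<noteq> ?c b" using conn_class_eq by metis+
      then show ?thesis using v dn[OF f] by blast
    qed
  next
    fix z assume "z \<in> insert (?c a \<union> ?c b) ?Q"
    then consider "z = ?d a" | v where "v \<in> V" "z = ?c v" "?c v \<noteq> ?c a" "?c v \<noteq> ?c b"
      using da by auto
    then show "z \<in> ?d ` V"
    proof cases
      case 2 then have "?d v = ?c v" using dn conn_class_eq by metis
      then show ?thesis using 2 by blast
    qed (use assms in blast)
  qed
  moreover have "?c a \<union> ?c b \<notin> ?Q"
  proof
    assume "?c a \<union> ?c b \<in> ?Q"
    then obtain v where v: "?c a \<union> ?c b = ?c v" "?c v \<noteq> ?c a" by blast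
    then have "(v, a) \<in> conn R" by (metis Image_singleton_iff Un_iff conn_refl)
    then show False using v conn_class_eq by metis
  qed
  moreover have "finite (?c ` V)" using assms by simp
  moreover have "card (?c ` V) = card ?Q + 2"
  proof -
    have "{?c a, ?c b} \<subseteq> ?c ` V" using assms by blast
    then have "card ?Q = card (?c ` V) - card {?c a, ?c b}" "card {?c a, ?c b} \<le> card (?c ` V)"
      using \<open>finite (?c ` V)\<close> by (simp_all only: card_Diff_subset card_mono finite.intros)
    then show ?thesis using ab by simp
  qed
  ultimately show ?thesis using False by (simp add: num_classes_conn)
qed

lemma num_classes_pos: "finite V \<Longrightarrow> V \<noteq> {} \<Longrightarrow> num_classes V R > 0"
  by (simp add: num_classes_conn card_gt_0_iff)

text \<open>The pair \<open>(d, d)\<close> is what a fixed point contributes to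
  \<open>graph_of\<close>, so this splits off a cycle of length one.\<close>

lemma num_classes_insert_isolated:
  assumes "finite Y" "d \<notin> Y" "R \<subseteq> Y \<times> Y"
  shows "num_classes (insert d Y) (insert (d, d) R) = num_classes Y R + 1"
proof -
  let ?c = "\<lambda>w. conn R `` {w}"
  have 1: "conn (insert (d, d) R) = conn R" by (rule conn_insert_in) simp
  have "(d, y) \<in> conn R \<Longrightarrow> y \<in> {d}" for y
    by (erule conn_closed) (use assms in auto)
  then have "?c d \<notin> ?c ` Y" using conn_class_eq[of R d] assms(2) by blast
  then show ?thesis using assms(1) by (simp add: num_classes_conn 1)
qed

section \<open>Cycles of a permutation under composition with a transposition\<close>

lemma conn_graph_of_step: "x \<in> X \<Longrightarrow> (x, f x) \<in> conn (graph_of f X)"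
  by (rule conn_base) (auto simp: graph_of_def)

text \<open>By finiteness \<open>f\<close> maps \<open>C\<close> onto itself, so a forward closed
  set is a union of cycles. Thus the symmetric relation \<open>conn\<close> can be controlled by
  forward steps alone.\<close>

lemma bij_closed_iff:
  assumes "bij_betw f X X" "finite C" "C \<subseteq> X" "f ` C \<subseteq> C" "x \<in> X"
  shows "f x \<in> C \<longleftrightarrow> x \<in> C"
proof -
  have inj: "inj_on f X" using assms by (simp add: bij_betw_def)
  then have "f ` C = C" using assms by (meson endo_inj_surj inj_on_subset)
  then show ?thesis using inj_on_image_mem_iff[OF inj assms(5,3)] by simp
qed

lemma bij_betw_transpose: "bij_betw f X X \<Longrightarrow> a \<in> X \<Longrightarrow> b \<in> X \<Longrightarrow> bij_betw (f \<circ> Transposition.transpose a b) X X"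
  by (rule bij_betw_trans[of _ X X]) (auto intro!: bij_betwI[of _ _ _ "Transposition.transpose a b"] simp: Transposition.transpose_def)

text \<open>The new permutation sends \<open>a\<close> to \<open>f b\<close> and \<open>b\<close> to
  \<open>f a\<close>, so it runs through the two cycles one after the other.\<close>

lemma conn_transpose_merge:
  assumes f: "bij_betw f X X" and X: "finite X" and a: "a \<in> X" and b: "b \<in> X"
    and ab: "(a, b) \<notin> conn (graph_of f X)"
  shows "conn (graph_of (f \<circ> Transposition.transpose a b) X) = conn (insert (a, b) (graph_of f X))"
proof -
  let ?g = "f \<circ> Transposition.transpose a b"
  let ?E = "conn (graph_of f X)" and ?E' = "conn (graph_of ?g X)"
  have g: "bij_betw ?g X X" using f a b by (rule bij_betw_transpose)
  have inj: "inj_on f X" using f by (simp add: bij_betw_def)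
  have "a \<noteq> b" using ab by auto
  have ab': "(a, b) \<in> ?E'"
  proof (rule ccontr)
    assume nab: "(a, b) \<notin> ?E'"
    \<comment> \<open>\<open>B\<close> is the part of the old cycle of \<open>b\<close> that the new
      permutation reaches from \<open>a\<close>. If it missed \<open>b\<close>, then
      \<open>f\<close> would map \<open>insert b B\<close> injectively into \<open>B\<close>, which
      is impossible for a finite set.\<close>
    define B where "B = {x \<in> X. (a, x) \<in> ?E' \<and> (b, x) \<in> ?E}"
    have "a \<notin> B" "b \<notin> B" using ab nab conn_sym[of b a] by (auto simp: B_def)
    have fB: "f x \<in> B" if "x \<in> insert b B" for x
    proof -
      have x: "x \<in> X" "(b, x) \<in> ?E" using that b by (auto simp: B_def)
      then have 1: "(b, f x) \<in> ?E" using conn_graph_of_step conn_trans by metis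
      have "(a, f x) \<in> ?E'"
      proof (cases "x = b")
        case True
        then show ?thesis using conn_graph_of_step[of a X ?g] a by simp
      next
        case False
        then have "x \<in> B" using that by simp
        then have "?g x = f x" "(a, x) \<in> ?E'" using \<open>a \<notin> B\<close> False by (auto simp: Transposition.transpose_def B_def)
        then show ?thesis using conn_graph_of_step[of x X ?g] x conn_trans by metis
      qed
      then show ?thesis using 1 x f by (auto simp: B_def bij_betw_def)
    qed
    have "inj_on f (insert b B)" using inj by (rule inj_on_subset) (auto simp: B_def b)
    moreover have fin: "finite B" using X by (simp add: B_def)
    ultimately have "card (insert b B) \<le> card B" using fB by (intro card_inj_on_le[of f]) auto
    then show False using fin \<open>b \<notin> B\<close> by simp
  qed
  show ?thesis
  proof (rule conn_eqI)
    let ?I = "conn (insert (a, b) (graph_of f X))"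
    have m: "?E \<subseteq> ?I" by (rule conn_mono) blast
    have abI: "(a, b) \<in> ?I" by (rule conn_base) simp
    show "graph_of ?g X \<subseteq> ?I"
    proof (clarsimp simp: graph_of_def[of "?g"])
      fix x assume x: "x \<in> X"
      have "(Transposition.transpose a b x, f (Transposition.transpose a b x)) \<in> ?E"
        by (rule conn_graph_of_step) (use x a b in \<open>auto simp: Transposition.transpose_def\<close>)
      moreover have "(x, Transposition.transpose a b x) \<in> ?I" using abI conn_sym[OF abI] by (auto simp: Transposition.transpose_def)
      ultimately show "(x, f (Transposition.transpose a b x)) \<in> ?I" using m conn_trans by (meson subsetD)
    qed
    show "insert (a, b) (graph_of f X) \<subseteq> ?E'"
    proof (clarsimp simp: graph_of_def[of f] ab')
      fix x assume x: "x \<in> X"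
      have "(Transposition.transpose a b x, ?g (Transposition.transpose a b x)) \<in> ?E'"
        by (rule conn_graph_of_step) (use x a b in \<open>auto simp: Transposition.transpose_def\<close>)
      moreover have "(x, Transposition.transpose a b x) \<in> ?E'" using ab' conn_sym[OF ab'] by (auto simp: Transposition.transpose_def)
      ultimately show "(x, f x) \<in> ?E'" using conn_trans by fastforce
    qed
  qed
qed

lemma conn_forward_orbit:
  assumes f: "bij_betw f X X" and X: "finite X" and ab: "(a, b) \<in> conn (graph_of f X)" and a: "a \<in> X"
  shows "\<exists>n. (f ^^ n) a = b"
proof -
  let ?O = "range (\<lambda>n. (f ^^ n) a)"
  have "(f ^^ n) a \<in> X" for n by (induction n) (use a f in \<open>auto simp: bij_betw_def\<close>)
  then have sub: "?O \<subseteq> X" by blast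
  have cl: "f ` ?O \<subseteq> ?O"
  proof clarsimp
    fix n show "f ((f ^^ n) a) \<in> ?O" by (rule range_eqI[of _ _ "Suc n"]) simp
  qed
  have "b \<in> ?O"
  proof (rule conn_closed[OF ab])
    show "a \<in> ?O" by (rule range_eqI[of _ _ 0]) simp
    fix u v assume "(u, v) \<in> graph_of f X"
    then show "u \<in> ?O \<longleftrightarrow> v \<in> ?O"
      using bij_closed_iff[OF f finite_subset[OF sub X] sub cl, of u] by (auto simp: graph_of_def)
  qed
  then show ?thesis by blast
qed

text \<open>The arc of the cycle from \<open>f a\<close> to \<open>b\<close> closes up under the new
  permutation, which sends \<open>b\<close> back to \<open>f a\<close>, and this arc does not
  contain \<open>a\<close>.\<close>

lemma conn_transpose_split:
  assumes f: "bij_betw f X X" and X: "finite X" and a: "a \<in> X" and b: "b \<in> X"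
    and neq: "a \<noteq> b" and ab: "(a, b) \<in> conn (graph_of f X)"
  shows "(a, b) \<notin> conn (graph_of (f \<circ> Transposition.transpose a b) X)"
proof
  let ?g = "f \<circ> Transposition.transpose a b"
  assume ab': "(a, b) \<in> conn (graph_of ?g X)"
  define m where "m = (LEAST n. (f ^^ n) a = b)"
  have m: "(f ^^ m) a = b" unfolding m_def using conn_forward_orbit[OF f X ab a] by (rule LeastI_ex)
  have least: "(f ^^ n) a \<noteq> b" if "n < m" for n using that not_less_Least unfolding m_def by blast
  have "m > 0" using m neq by (cases m) auto
  define C where "C = (\<lambda>i. (f ^^ i) a) ` {1..m}"
  have iter: "(f ^^ n) a \<in> X" for n by (induction n) (use a f in \<open>auto simp: bij_betw_def\<close>)
  have nota: "(f ^^ i) a \<noteq> a" if "1 \<le> i" "i \<le> m" for i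
  \<comment> \<open>A return to \<open>a\<close> by time \<open>m\<close> would let the orbit reach
    \<open>b\<close> before time \<open>m\<close>.\<close>
  proof
    assume "(f ^^ i) a = a"
    then have "(f ^^ (m - i)) a = b" using m that funpow_add[of "m - i" i f] by simp
    then show False using least[of "m - i"] that by simp
  qed
  have bC: "b \<in> C" using m \<open>m > 0\<close> by (auto simp: C_def intro!: image_eqI[of _ _ m])
  have "?g ` C \<subseteq> C"
  proof clarify
    fix x assume "x \<in> C"
    then obtain i where i: "x = (f ^^ i) a" "1 \<le> i" "i \<le> m" by (auto simp: C_def)
    show "?g x \<in> C"
    proof (cases "i = m")
      case True
      then have "?g x = (f ^^ 1) a" using i m by simp
      then show ?thesis unfolding C_def using \<open>m > 0\<close> by (intro image_eqI[of _ _ 1]) auto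
    next
      case False
      then have "?g x = (f ^^ Suc i) a" using i least[of i] nota[of i] by (simp add: Transposition.transpose_def)
      then show ?thesis unfolding C_def using False i by (intro image_eqI[of _ _ "Suc i"]) auto
    qed
  qed
  moreover have "C \<subseteq> X" using iter by (auto simp: C_def)
  moreover have "finite C" by (simp add: C_def)
  ultimately have cl: "u \<in> C \<longleftrightarrow> v \<in> C" if "(u, v) \<in> graph_of ?g X" for u v
    using bij_closed_iff[OF bij_betw_transpose[OF f a b], of C u] that by (auto simp: graph_of_def)
  have "a \<in> C" by (rule conn_closed[OF conn_sym[OF ab'] bC cl])
  then obtain i where "i \<in> {1..m}" "a = (f ^^ i) a" unfolding C_def by (rule imageE)
  then show False using nota[of i] by simp
qed

abbreviation cycles :: "('a \<Rightarrow> 'a) \<Rightarrow> 'a set \<Rightarrow> nat" where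
  "cycles f X \<equiv> num_classes X (graph_of f X)"

lemma comp_transpose_twice: "f \<circ> Transposition.transpose a b \<circ> Transposition.transpose a b = f"
  by (simp add: comp_assoc)

lemma conn_transpose_general:
  assumes f: "bij_betw f X X" and X: "finite X" and a: "a \<in> X" and b: "b \<in> X"
    and neq: "a \<noteq> b" and ab: "(a, b) \<in> conn (graph_of f X)"
  shows "conn (graph_of f X) = conn (insert (a, b) (graph_of (f \<circ> Transposition.transpose a b) X))"
  using conn_transpose_merge[OF bij_betw_transpose[OF f a b] X a b conn_transpose_split[OF assms]]
  by (simp only: comp_transpose_twice)

lemma cycles_transpose:
  assumes f: "bij_betw f X X" and X: "finite X" and a: "a \<in> X" and b: "b \<in> X" and neq: "a \<noteq> b"
  shows "(a, b) \<notin> conn (graph_of f X) \<Longrightarrow> cycles f X = cycles (f \<circ> Transposition.transpose a b) X + 1"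
    and "(a, b) \<in> conn (graph_of f X) \<Longrightarrow> cycles (f \<circ> Transposition.transpose a b) X = cycles f X + 1"
proof -
  show 1: "cycles f X = cycles (f \<circ> Transposition.transpose a b) X + 1"
    if "(a, b) \<notin> conn (graph_of f X)"
    using num_classes_insert[OF X a b, of "graph_of f X"]
      num_classes_cong[OF conn_transpose_merge[OF f X a b that], of X] that by simp
  show "cycles (f \<circ> Transposition.transpose a b) X = cycles f X + 1" if "(a, b) \<in> conn (graph_of f X)"
    using num_classes_insert[OF X a b, of "graph_of (f \<circ> Transposition.transpose a b) X"]
      num_classes_cong[OF conn_transpose_general[OF assms that], of X]
      conn_transpose_split[OF assms that] by simp
qed

section \<open>Genus of a pair of permutations\<close>

lemma cycles_comp_commute:
  assumes f: "bij_betw f X X" and g: "bij_betw g X X"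
  shows "cycles (f \<circ> g) X = cycles (g \<circ> f) X"
proof (rule num_classes_transfer[where f = g])
  have fX: "f x \<in> X" "g x \<in> X" if "x \<in> X" for x using that f g by (auto simp: bij_betw_def)
  have step: "(k x, k y) \<in> conn (graph_of (k \<circ> h) X)"
    if "(x, y) \<in> conn (graph_of (h \<circ> k) X)" "\<And>x. x \<in> X \<Longrightarrow> k x \<in> X" for h k x y
    by (rule conn_map[OF that(1)]) (use that(2) in \<open>auto simp: graph_of_def intro!: conn_base\<close>)
  fix w w' assume w: "w \<in> X" "w' \<in> X"
  show "(w, w') \<in> conn (graph_of (f \<circ> g) X) \<longleftrightarrow> (g w, g w') \<in> conn (graph_of (g \<circ> f) X)"
  proof
    assume "(g w, g w') \<in> conn (graph_of (g \<circ> f) X)"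
    then have "(f (g w), f (g w')) \<in> conn (graph_of (f \<circ> g) X)" using step fX by blast
    moreover have "(x, f (g x)) \<in> conn (graph_of (f \<circ> g) X)" if "x \<in> X" for x
      using conn_graph_of_step[OF that, of "f \<circ> g"] by simp
    ultimately show "(w, w') \<in> conn (graph_of (f \<circ> g) X)"
      using w conn_trans conn_sym by metis
  qed (use step fX in blast)
next
  fix v assume "v \<in> X"
  then have "v \<in> g ` X" using g by (simp add: bij_betw_def)
  then obtain w where "w \<in> X" "g w = v" by blast
  then show "\<exists>w\<in>X. (g w, v) \<in> conn (graph_of (g \<circ> f) X)" by (intro bexI[of _ w]) simp_all
qed (use g in \<open>auto simp: bij_betw_def\<close>)

text \<open>For the edge involution and the rotation of a ribbon graph, \<open>card X\<close> is
  twice the number of edges, and the value is 2k - V + E - F, twice the genus. Admitting arbitrary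
  permutations, as for hypermaps, allows darts to be removed singly although this destroys their
  pairing into edges.\<close>

definition defect :: "'a set \<Rightarrow> ('a \<Rightarrow> 'a) \<Rightarrow> ('a \<Rightarrow> 'a) \<Rightarrow> int" where
  "defect X f g = int (card X) + 2 * int (num_classes X (graph_of f X \<union> graph_of g X))
     - int (cycles f X) - int (cycles g X) - int (cycles (f \<circ> g) X)"

lemma defect_commute:
  assumes "bij_betw f X X" "bij_betw g X X"
  shows "defect X f g = defect X g f"
  using cycles_comp_commute[OF assms] by (simp add: defect_def Un_commute)

lemma conn_graph_of_comp:
  assumes "\<And>x. x \<in> X \<Longrightarrow> g x \<in> X"
  shows "conn (graph_of (f \<circ> g) X) \<subseteq> conn (graph_of f X \<union> graph_of g X)"
proof (rule conn_least, rule subrelI)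
  fix x y assume "(x, y) \<in> graph_of (f \<circ> g) X"
  then have "x \<in> X" "y = f (g x)" by (auto simp: graph_of_def)
  then have "(x, g x) \<in> graph_of f X \<union> graph_of g X" "(g x, y) \<in> graph_of f X \<union> graph_of g X"
    using assms by (auto simp: graph_of_def)
  then show "(x, y) \<in> conn (graph_of f X \<union> graph_of g X)" using conn_base conn_trans by metis
qed

lemma conn_Un_insert: "conn A = conn (insert z B) \<Longrightarrow> conn (C \<union> A) = conn (insert z (C \<union> B))"
proof (rule conn_eqI)
  assume eq: "conn A = conn (insert z B)"
  have "A \<subseteq> conn A" "insert z B \<subseteq> conn (insert z B)" by (rule conn_superset)+
  then have "A \<subseteq> conn (insert z B)" "insert z B \<subseteq> conn A" using eq by simp_all
  moreover have "conn (insert z B) \<subseteq> conn (insert z (C \<union> B))" "conn A \<subseteq> conn (C \<union> A)"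
    by (auto intro: conn_mono[THEN subsetD])
  moreover have "C \<subseteq> conn (insert z (C \<union> B))" "C \<subseteq> conn (C \<union> A)" by (auto intro: conn_base)
  ultimately show "C \<union> A \<subseteq> conn (insert z (C \<union> B))" "insert z (C \<union> B) \<subseteq> conn (C \<union> A)" by blast+
qed

text \<open>Splitting a cycle of \<open>g\<close> changes the value by -1. The number of cycles of
  the product moves by one: if it falls, \<open>a\<close> and \<open>b\<close> stay joined and the
  component count is unchanged; if it rises, the component count may rise by one too. The total
  change is 0 or -2.\<close>

lemma defect_transpose:
  assumes f: "bij_betw f X X" and g: "bij_betw g X X" and X: "finite X"
    and a: "a \<in> X" and b: "b \<in> X" and neq: "a \<noteq> b" and ab: "(a, b) \<in> conn (graph_of g X)"
  defines g'_def: "g' \<equiv> g \<circ> Transposition.transpose a b"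
  shows "defect X f g' \<le> defect X f g \<and> even (defect X f g - defect X f g')"
proof -
  let ?k = "num_classes X (graph_of f X \<union> graph_of g X)"
  let ?k' = "num_classes X (graph_of f X \<union> graph_of g' X)"
  let ?joined = "(a, b) \<in> conn (graph_of f X \<union> graph_of g' X)"
  have g': "bij_betw g' X X" unfolding g'_def using g a b by (rule bij_betw_transpose)
  have g'X: "g' x \<in> X" if "x \<in> X" for x using g' that by (auto simp: bij_betw_def)
  have fg': "bij_betw (f \<circ> g') X X" using g' f by (rule bij_betw_trans)
  have undo: "f \<circ> g' \<circ> Transposition.transpose a b = f \<circ> g"
    unfolding g'_def comp_assoc by simp
  have cg: "cycles g' X = cycles g X + 1"
    unfolding g'_def by (rule cycles_transpose(2)[OF g X a b neq ab])
  have k: "?k' = ?k + (if ?joined then 0 else 1)"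
    using num_classes_insert[OF X a b, of "graph_of f X \<union> graph_of g' X"]
      num_classes_cong[OF conn_Un_insert[OF conn_transpose_general[OF g X a b neq ab]], of X "graph_of f X"]
    unfolding g'_def[symmetric] by simp
  show ?thesis
  proof (cases "(a, b) \<in> conn (graph_of (f \<circ> g') X)")
    case True
    then have "?joined" using conn_graph_of_comp[of X g' f, OF g'X] by blast
    moreover have "cycles (f \<circ> g) X = cycles (f \<circ> g') X + 1"
      using cycles_transpose(2)[OF fg' X a b neq True] unfolding undo .
    ultimately show ?thesis using cg k by (simp add: defect_def)
  next
    case False
    have "cycles (f \<circ> g') X = cycles (f \<circ> g) X + 1"
      using cycles_transpose(1)[OF fg' X a b neq False] unfolding undo .
    then show ?thesis using cg k by (simp add: defect_def)
  qed
qed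

text \<open>The first-return map of a permutation to the complement of \<open>d\<close>: the orbit
  jumps over \<open>d\<close>.\<close>

definition splice :: "'a \<Rightarrow> ('a \<Rightarrow> 'a) \<Rightarrow> 'a \<Rightarrow> 'a" where
  "splice d f x = (if f x = d then f d else f x)"

lemma bij_betw_splice:
  assumes f: "bij_betw f X X" and d: "d \<in> X" and X: "finite X"
  shows "bij_betw (splice d f) (X - {d}) (X - {d})"
proof -
  have inj: "inj_on f X" and im: "f ` X = X" using f by (auto simp: bij_betw_def)
  have "inj_on (splice d f) (X - {d})"
    using inj d by (auto simp: inj_on_def splice_def)
  moreover have "splice d f ` (X - {d}) \<subseteq> X - {d}"
    using im d inj by (auto simp: splice_def inj_on_def)
  ultimately show ?thesis using X by (simp add: bij_betw_def endo_inj_surj)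
qed

text \<open>A common fixed point adds 1 to the size and to each of the four class counts, and 1 + 2
  - 1 - 1 - 1 = 0.\<close>

lemma defect_isolated:
  assumes X: "finite X" and d: "d \<in> X" and f: "bij_betw f X X" and g: "bij_betw g X X"
    and fd: "f d = d" and gd: "g d = d"
  shows "defect X f g = defect (X - {d}) f g"
proof -
  have gr: "graph_of h X = insert (d, d) (graph_of h (X - {d}))" if "h d = d" for h :: "'a \<Rightarrow> 'a"
    using that d by (auto simp: graph_of_def)
  have sub: "graph_of h (X - {d}) \<subseteq> (X - {d}) \<times> (X - {d})" if "bij_betw h X X" "h d = d" for h
    using that d by (auto simp: graph_of_def bij_betw_def inj_on_def)
  have fg: "bij_betw (f \<circ> g) X X" "(f \<circ> g) d = d" using bij_betw_trans[OF g f] fd gd by auto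
  have cyc: "num_classes X (insert (d, d) R) = num_classes (X - {d}) R + 1"
    if "R \<subseteq> (X - {d}) \<times> (X - {d})" for R
    using num_classes_insert_isolated[of "X - {d}" d R] that X d by (simp add: insert_absorb)
  have "cycles h X = cycles h (X - {d}) + 1" if "bij_betw h X X" "h d = d" for h
    using cyc[OF sub[OF that]] gr[of h] that by simp
  then have "cycles f X = cycles f (X - {d}) + 1" "cycles g X = cycles g (X - {d}) + 1"
    "cycles (f \<circ> g) X = cycles (f \<circ> g) (X - {d}) + 1" using f g fd gd fg by blast+
  moreover have "num_classes X (graph_of f X \<union> graph_of g X)
      = num_classes (X - {d}) (graph_of f (X - {d}) \<union> graph_of g (X - {d})) + 1"
    using cyc[of "graph_of f (X - {d}) \<union> graph_of g (X - {d})"] sub[OF f fd] sub[OF g gd]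
      gr[of f, OF fd] gr[of g, OF gd] by simp
  moreover have "card X = card (X - {d}) + 1" using X d by (metis Suc_eq_plus1 card_Suc_Diff1)
  ultimately show ?thesis by (simp add: defect_def)
qed

lemma graph_of_cong: "(\<And>x. x \<in> X \<Longrightarrow> f x = g x) \<Longrightarrow> graph_of f X = graph_of g X"
  by (auto simp: graph_of_def)

lemma defect_cong:
  assumes "\<And>x. x \<in> X \<Longrightarrow> f x = f' x" "\<And>x. x \<in> X \<Longrightarrow> g x = g' x" "\<And>x. x \<in> X \<Longrightarrow> g x \<in> X"
  shows "defect X f g = defect X f' g'"
proof -
  have "graph_of f X = graph_of f' X" "graph_of g X = graph_of g' X"
    "graph_of (f \<circ> g) X = graph_of (f' \<circ> g') X"
    using assms by (auto intro!: graph_of_cong)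
  then show ?thesis by (simp add: defect_def)
qed

text \<open>Turning \<open>d\<close> into a fixed point of \<open>g\<close> is composing \<open>g\<close> with a transposition of two points of
  one cycle.\<close>

lemma defect_splice_right:
  assumes f: "bij_betw f X X" and g: "bij_betw g X X" and X: "finite X" and d: "d \<in> X"
  shows "\<exists>g'. bij_betw g' X X \<and> g' d = d \<and> (\<forall>x\<in>X - {d}. g' x = splice d g x) \<and>
    defect X f g' \<le> defect X f g \<and> even (defect X f g - defect X f g')"
proof (cases "g d = d")
  case True
  then have "splice d g = g" by (auto simp: splice_def)
  then show ?thesis using g True by (intro exI[of _ g]) auto
next
  case False
  have inj: "inj_on g X" and im: "g ` X = X" using g by (auto simp: bij_betw_def)
  obtain b where b: "b \<in> X" "g b = d" using im d by (metis imageE)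
  have "b \<noteq> d" using b False by auto
  have "(b, d) \<in> conn (graph_of g X)" using conn_graph_of_step[OF b(1), of g] b(2) by simp
  from defect_transpose[OF f g X b(1) d \<open>b \<noteq> d\<close> this]
  have "defect X f (g \<circ> Transposition.transpose b d) \<le> defect X f g \<and>
    even (defect X f g - defect X f (g \<circ> Transposition.transpose b d))" .
  moreover have "(g \<circ> Transposition.transpose b d) d = d" using b by simp
  moreover have "(g \<circ> Transposition.transpose b d) x = splice d g x" if "x \<in> X - {d}" for x
  proof (cases "x = b")
    case False
    then have "g x \<noteq> d" using that b inj by (auto simp: inj_on_def)
    then show ?thesis using False that by (simp add: splice_def Transposition.transpose_def)
  qed (use b in \<open>simp add: splice_def\<close>)
  ultimately show ?thesis using bij_betw_transpose[OF g b(1) d] by blast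
qed

text \<open>The point is made a fixed point of \<open>g\<close>, then of \<open>f\<close> after
  exchanging the roles by \<open>defect_commute\<close>, and is finally dropped as isolated.\<close>

lemma defect_splice:
  assumes f: "bij_betw f X X" and g: "bij_betw g X X" and X: "finite X" and d: "d \<in> X"
  shows "defect (X - {d}) (splice d f) (splice d g) \<le> defect X f g \<and>
    even (defect X f g - defect (X - {d}) (splice d f) (splice d g))"
proof -
  obtain g' where g': "bij_betw g' X X" "g' d = d" "\<forall>x\<in>X - {d}. g' x = splice d g x"
    "defect X f g' \<le> defect X f g" "even (defect X f g - defect X f g')"
    using defect_splice_right[OF f g X d] by blast
  obtain f' where f': "bij_betw f' X X" "f' d = d" "\<forall>x\<in>X - {d}. f' x = splice d f x"
    "defect X g' f' \<le> defect X g' f" "even (defect X g' f - defect X g' f')"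
    using defect_splice_right[OF g'(1) f X d] by blast
  have "defect X f' g' = defect (X - {d}) f' g'"
    by (rule defect_isolated[OF X d f'(1) g'(1) f'(2) g'(2)])
  also have "\<dots> = defect (X - {d}) (splice d f) (splice d g)"
    by (rule defect_cong) (use f' g' bij_betw_splice[OF g d X] in \<open>auto simp: bij_betw_def\<close>)
  finally show ?thesis
    using g'(4,5) f'(4,5) defect_commute[OF f'(1) g'(1)] defect_commute[OF f g'(1)] by auto
qed

text \<open>\<open>y\<close> is the first point of \<open>W\<close> on the forward orbit of
  \<open>x\<close>, the start itself not counted. The inductive form allows a point outside
  \<open>W\<close> to be removed by induction on the derivation.\<close>

inductive first_return :: "'a set \<Rightarrow> ('a \<Rightarrow> 'a) \<Rightarrow> 'a \<Rightarrow> 'a \<Rightarrow> bool" for W f where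
  now: "f x = y \<Longrightarrow> y \<in> W \<Longrightarrow> first_return W f x y"
| later: "f x \<notin> W \<Longrightarrow> first_return W f (f x) y \<Longrightarrow> first_return W f x y"

lemma first_return_imp_eq: "first_return W f x y \<Longrightarrow> f x \<in> W \<Longrightarrow> f x = y"
  by (erule first_return.cases) auto

text \<open>When the orbit reaches \<open>d\<close>, what is known about \<open>d\<close> must be
  handed to the point \<open>z\<close> mapped to \<open>d\<close>; hence the second
  conjunct.\<close>

lemma first_return_splice_aux:
  assumes "first_return W f x y" "d \<notin> W"
  shows "(x \<noteq> d \<longrightarrow> first_return W (splice d f) x y) \<and>
    (x = d \<longrightarrow> (\<forall>z. f z = d \<and> z \<noteq> d \<longrightarrow> first_return W (splice d f) z y))"
  using assms(1)
proof induction
  case (now x y)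
  then show ?case using assms(2) by (auto simp: splice_def intro!: first_return.now)
next
  case (later x y)
  show ?case
  proof (intro conjI impI allI)
    assume "x \<noteq> d"
    show "first_return W (splice d f) x y"
    proof (cases "f x = d")
      case True
      then show ?thesis using later.IH \<open>x \<noteq> d\<close> by blast
    next
      case False
      then have "splice d f x = f x" by (simp add: splice_def)
      then show ?thesis using later False first_return.later[of "splice d f" x W y] by auto
    qed
  next
    fix z assume z: "x = d" "f z = d \<and> z \<noteq> d"
    show "first_return W (splice d f) z y"
    proof (cases "f d = d")
      case True
      then show ?thesis using later.IH z by auto
    next
      case False
      then have "splice d f z = f d" using z by (simp add: splice_def)
      then show ?thesis using later False z first_return.later[of "splice d f" z W y] by auto
    qed
  qed
qed

lemma first_return_splice:
  "first_return W f x y \<Longrightarrow> d \<notin> W \<Longrightarrow> x \<noteq> d \<Longrightarrow> first_return W (splice d f) x y"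
  using first_return_splice_aux by metis

text \<open>The points outside \<open>W\<close> are removed one at a time by
  \<open>defect_splice\<close>, and first returns to \<open>W\<close> survive each removal. For
  ribbon graphs this is the monotonicity of the genus under passing to a subgraph.\<close>

lemma defect_first_return:
  assumes "finite X" "W \<subseteq> X" "bij_betw f X X" "bij_betw g X X"
    and "\<And>x. x \<in> W \<Longrightarrow> first_return W f x (f0 x)" "\<And>x. x \<in> W \<Longrightarrow> first_return W g x (g0 x)"
  shows "defect W f0 g0 \<le> defect X f g \<and> even (defect X f g - defect W f0 g0)"
proof -
  have "finite (X - W)" using assms by simp
  then show ?thesis using assms
  proof (induction "X - W" arbitrary: X f g rule: finite_induct)
    case empty
    then have "X = W" by blast
    have eq: "f x = f0 x" "g x = g0 x" "g x \<in> X" if "x \<in> X" for x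
    proof -
      have "x \<in> W" "f x \<in> W" "g x \<in> W"
        using that empty.prems(3,4) unfolding \<open>X = W\<close> by (auto simp: bij_betw_def)
      then show "f x = f0 x" "g x = g0 x" "g x \<in> X"
        using empty.prems(5,6) first_return_imp_eq \<open>X = W\<close> by metis+
    qed
    have "defect X f g = defect X f0 g0" by (rule defect_cong) (use eq in auto)
    then show ?case using \<open>X = W\<close> by simp
  next
    case (insert d F)
    have d: "d \<in> X" "d \<notin> W" using insert.hyps by auto
    have "defect W f0 g0 \<le> defect (X - {d}) (splice d f) (splice d g) \<and>
      even (defect (X - {d}) (splice d f) (splice d g) - defect W f0 g0)"
    proof (rule insert.hyps(3))
      show "F = X - {d} - W" using insert.hyps by auto
    qed (use insert.prems d in \<open>auto intro!: bij_betw_splice first_return_splice\<close>)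
    moreover note defect_splice[OF insert.prems(3,4,1) d(1)]
    ultimately show ?case by auto
  qed
qed

text \<open>Removing all points leaves the empty set, whose defect is 0.\<close>

lemma defect_nonneg_even:
  assumes "finite X" "bij_betw f X X" "bij_betw g X X"
  shows "defect X f g \<ge> 0 \<and> even (defect X f g)"
  using defect_first_return[OF assms(1) empty_subsetI assms(2,3), of id id]
  by (simp add: defect_def num_classes_def)

lemma first_return_funpow:
  assumes "k > 0" "(f ^^ k) x = y" "y \<in> W" "\<And>j. 0 < j \<Longrightarrow> j < k \<Longrightarrow> (f ^^ j) x \<notin> W"
  shows "first_return W f x y"
  using assms
proof (induction k arbitrary: x)
  case (Suc k)
  show ?case
  proof (cases k)
    case 0
    then show ?thesis using Suc.prems by (auto intro: first_return.now)
  next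
    case (Suc n)
    have "first_return W f (f x) y"
    proof (rule Suc.IH)
      show "(f ^^ k) (f x) = y" using Suc.prems(2) by (simp add: funpow_swap1)
      show "(f ^^ j) (f x) \<notin> W" if "0 < j" "j < k" for j
        using Suc.prems(4)[of "Suc j"] that by (simp add: funpow_swap1)
    qed (use Suc Suc.prems in auto)
    moreover have "f x \<notin> W" using Suc.prems(4)[of 1] Suc by simp
    ultimately show ?thesis by (rule first_return.later[rotated])
  qed
qed simp

lemma defect_image:
  assumes inj: "inj_on h X" and f: "\<And>x. x \<in> X \<Longrightarrow> f' (h x) = h (f x)" "\<And>x. x \<in> X \<Longrightarrow> f x \<in> X"
    and g: "\<And>x. x \<in> X \<Longrightarrow> g' (h x) = h (g x)" "\<And>x. x \<in> X \<Longrightarrow> g x \<in> X"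
  shows "defect (h ` X) f' g' = defect X f g"
proof -
  have tr: "num_classes X R = num_classes (h ` X) (map_prod h h ` R)" if R: "R \<subseteq> X \<times> X" for R
  proof (rule num_classes_transfer[where f = h])
    fix w w' assume w: "w \<in> X" "w' \<in> X"
    show "(w, w') \<in> conn R \<longleftrightarrow> (h w, h w') \<in> conn (map_prod h h ` R)"
    proof
      assume "(w, w') \<in> conn R"
      then show "(h w, h w') \<in> conn (map_prod h h ` R)"
        by (rule conn_map) (auto intro!: conn_base)
    next
      assume "(h w, h w') \<in> conn (map_prod h h ` R)"
      then have "(inv_into X h (h w), inv_into X h (h w')) \<in> conn R"
      proof (rule conn_map)
        fix u v assume "(u, v) \<in> map_prod h h ` R"
        then obtain a b where ab: "(a, b) \<in> R" "u = h a" "v = h b" by auto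
        then have "a \<in> X" "b \<in> X" using R by blast+
        then have "inv_into X h u = a" "inv_into X h v = b" using ab inj by simp_all
        then show "(inv_into X h u, inv_into X h v) \<in> conn R" using ab(1) by (simp add: conn_base)
      qed
      then show "(w, w') \<in> conn R" using inv_into_f_f[OF inj w(1)] inv_into_f_f[OF inj w(2)] by (simp only:)
    qed
  next
    show "\<exists>w\<in>X. (h w, v) \<in> conn (map_prod h h ` R)" if "v \<in> h ` X" for v
    proof -
      from that obtain w where "w \<in> X" "v = h w" by (rule imageE)
      then show ?thesis by (intro bexI[of _ w]) simp_all
    qed
  qed auto
  have gr: "map_prod h h ` graph_of k X = graph_of k' (h ` X)"
    if "\<And>x. x \<in> X \<Longrightarrow> k' (h x) = h (k x)" for k k'
    using that by (force simp: graph_of_def image_iff)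
  have sub: "graph_of k X \<subseteq> X \<times> X" if "\<And>x. x \<in> X \<Longrightarrow> k x \<in> X" for k
    using that by (auto simp: graph_of_def)
  have "cycles f X = cycles f' (h ` X)" "cycles g X = cycles g' (h ` X)"
    "cycles (f \<circ> g) X = cycles (f' \<circ> g') (h ` X)"
    using tr[OF sub[of f]] tr[OF sub[of g]] tr[OF sub[of "f \<circ> g"]]
      gr[of f' f] gr[of g' g] gr[of "f' \<circ> g'" "f \<circ> g"] f g by simp_all
  moreover have "num_classes X (graph_of f X \<union> graph_of g X)
      = num_classes (h ` X) (graph_of f' (h ` X) \<union> graph_of g' (h ` X))"
    using tr[of "graph_of f X \<union> graph_of g X"] sub[of f] sub[of g] gr[of f' f] gr[of g' g] f g
    by (simp add: image_Un)
  ultimately show ?thesis using inj by (simp add: defect_def card_image)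
qed

lemma cycles_involution:
  assumes X: "finite X" and f: "\<And>x. x \<in> X \<Longrightarrow> f x \<in> X \<and> f x \<noteq> x \<and> f (f x) = x"
  shows "card X = 2 * cycles f X"
proof -
  let ?c = "\<lambda>x. conn (graph_of f X) `` {x}"
  have c: "?c x = {x, f x}" if "x \<in> X" for x
  proof
    show "?c x \<subseteq> {x, f x}"
    proof
      fix y assume "y \<in> ?c x"
      then have "(x, y) \<in> conn (graph_of f X)" by simp
      then show "y \<in> {x, f x}"
      proof (rule conn_closed)
        fix u v assume "(u, v) \<in> graph_of f X"
        then have "u \<in> X" "v = f u" by (auto simp: graph_of_def)
        moreover have "f u = x \<longleftrightarrow> u = f x" "f u = f x \<longleftrightarrow> u = x"
          using f[OF \<open>u \<in> X\<close>] f[OF that] by metis+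
        ultimately show "u \<in> {x, f x} \<longleftrightarrow> v \<in> {x, f x}" by (simp add: disj_commute)
      qed simp
    qed
  qed (use conn_graph_of_step[OF that] in auto)
  have un: "\<Union> (?c ` X) = X"
  proof
    show "\<Union> (?c ` X) \<subseteq> X"
    proof (rule UN_least)
      fix x assume x: "x \<in> X"
      show "?c x \<subseteq> X" using x f[OF x] by (subst c) simp_all
    qed
  qed auto
  have "2 * card (?c ` X) = card (\<Union> (?c ` X))"
  proof (rule card_partition)
    show "finite (?c ` X)" using X by simp
    show "finite (\<Union> (?c ` X))" unfolding un by (rule X)
    fix A assume "A \<in> ?c ` X"
    then obtain x where x: "x \<in> X" "A = ?c x" by blast
    then have "A = {x, f x}" using c by simp
    then show "card A = 2" using f[OF x(1)] by (simp add: eq_commute)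
  next
    fix A B assume "A \<in> ?c ` X" "B \<in> ?c ` X" "A \<noteq> B"
    then obtain x y where xy: "A = ?c x" "B = ?c y" by blast
    then have n: "(x, y) \<notin> conn (graph_of f X)" using \<open>A \<noteq> B\<close> conn_class_eq by metis
    show "A \<inter> B = {}"
    proof (rule equals0I)
      fix z assume "z \<in> A \<inter> B"
      then have "(x, z) \<in> conn (graph_of f X)" "(y, z) \<in> conn (graph_of f X)" using xy by auto
      then show False using n conn_sym conn_trans by metis
    qed
  qed
  moreover note un
  ultimately show ?thesis by (simp add: num_classes_conn)
qed

section \<open>States of alternating darts\<close>

lemma conn_Un_mono: "A \<subseteq> conn R \<Longrightarrow> conn (R \<union> A) = conn R"
  by (rule conn_eqI) (use conn_superset conn_mono[of R "R \<union> A"] in auto)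

lemma num_classes_disjoint_Un:
  assumes "finite Y" "finite Z" "Y \<inter> Z = {}" "Q \<subseteq> Y \<times> Y" "R \<subseteq> Z \<times> Z"
  shows "num_classes (Y \<union> Z) (Q \<union> R) = num_classes Y Q + num_classes Z R"
proof -
  have cl: "conn (A \<union> B) `` {y} = conn A `` {y}" "conn (A \<union> B) `` {y} \<subseteq> S"
    if "y \<in> S" "A \<subseteq> S \<times> S" "B \<subseteq> T \<times> T" "S \<inter> T = {}" for A B S T y
  proof -
    have *: "z \<in> S \<and> (y, z) \<in> conn A" if "(y, z) \<in> conn (A \<union> B)" for z
      using that
    proof (induction rule: conn_induct)
      case (step z w)
      then have zw: "(z, w) \<in> A \<or> (w, z) \<in> A"
        using \<open>B \<subseteq> T \<times> T\<close> \<open>S \<inter> T = {}\<close> by auto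
      then have "w \<in> S" using \<open>A \<subseteq> S \<times> S\<close> by auto
      moreover from zw have "(z, w) \<in> conn A" using conn_base[of z w A] conn_sym[OF conn_base, of w z A] by blast
      ultimately show ?case using step(3) conn_trans[of y z A w] by simp
    qed (use \<open>y \<in> S\<close> in simp)
    moreover have "conn A \<subseteq> conn (A \<union> B)" by (rule conn_mono) simp
    ultimately show "conn (A \<union> B) `` {y} = conn A `` {y}" "conn (A \<union> B) `` {y} \<subseteq> S" by blast+
  qed
  let ?c = "\<lambda>R x. conn R `` {x}"
  have Y: "?c (Q \<union> R) y = ?c Q y" "?c (Q \<union> R) y \<subseteq> Y" if "y \<in> Y" for y
    using cl[OF that assms(4,5,3)] .
  have Z: "?c (Q \<union> R) z = ?c R z" "?c (Q \<union> R) z \<subseteq> Z" if "z \<in> Z" for z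
    using cl[OF that assms(5,4)] assms(3) by (simp_all add: Un_commute Int_commute)
  have "?c Q ` Y \<inter> ?c R ` Z = {}"
  proof (rule equals0I)
    fix A assume "A \<in> ?c Q ` Y \<inter> ?c R ` Z"
    then obtain y z where "y \<in> Y" "z \<in> Z" "A = ?c Q y" "A = ?c R z" by blast
    then have "y \<in> A" by simp
    have "A \<subseteq> Z" using Z[OF \<open>z \<in> Z\<close>] \<open>A = ?c R z\<close> by metis
    with \<open>y \<in> A\<close> show False using \<open>y \<in> Y\<close> assms(3) by blast
  qed
  moreover have "?c (Q \<union> R) ` (Y \<union> Z) = ?c Q ` Y \<union> ?c R ` Z"
    unfolding image_Un using Y(1) Z(1) by (simp cong: image_cong)
  ultimately show ?thesis
    unfolding num_classes_conn using assms(1,2) by (simp add: card_Un_disjoint)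
qed

text \<open>The four ends form one block or two blocks of two. This is how the ends at a cut
  crossing are connected through the rest of a state.\<close>

definition paired :: "('a \<times> 'a) set \<Rightarrow> 'a \<Rightarrow> 'a \<Rightarrow> 'a \<Rightarrow> 'a \<Rightarrow> bool" where
  "paired R a b c d \<longleftrightarrow>
     ((a, b) \<in> conn R \<longleftrightarrow> (c, d) \<in> conn R) \<and> ((a, c) \<in> conn R \<longleftrightarrow> (b, d) \<in> conn R) \<and>
     ((a, d) \<in> conn R \<longleftrightarrow> (b, c) \<in> conn R) \<and>
     ((a, b) \<in> conn R \<or> (a, c) \<in> conn R \<or> (a, d) \<in> conn R)"

text \<open>If \<open>a\<close> and \<open>b\<close> are not yet joined, inserting
  \<open>(c, d)\<close> joins them as well, so the two arcs together lower the count by one and not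
  by two.\<close>

lemma num_classes_paired:
  assumes "finite V" "a \<in> V" "b \<in> V" "c \<in> V" "d \<in> V" "paired R a b c d"
  shows "num_classes V R = num_classes V (insert (a, b) (insert (c, d) R)) + (if (a, b) \<in> conn R then 0 else 1)"
proof (cases "(a, b) \<in> conn R")
  case True
  then have "(c, d) \<in> conn R" using assms(6) by (simp add: paired_def)
  then have "conn (insert (a, b) (insert (c, d) R)) = conn R"
    using True by (simp add: conn_insert_in)
  from num_classes_cong[OF this, of V] show ?thesis using True by simp
next
  case False
  then have "(c, d) \<notin> conn R" "(a, c) \<in> conn R \<and> (b, d) \<in> conn R \<or> (a, d) \<in> conn R \<and> (b, c) \<in> conn R"
    using assms(6) by (auto simp: paired_def)
  moreover from this have "(a, b) \<in> conn (insert (c, d) R)"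
    unfolding conn_insert_iff using conn_sym by metis
  ultimately show ?thesis
    using False num_classes_insert[OF assms(1,4,5), of R]
      num_classes_insert[OF assms(1-3), of "insert (c, d) R"] by simp
qed

lemma paired_even:
  assumes dist: "distinct [a, b, c, d]"
    and ev: "\<And>x. x \<in> {a, b, c, d} \<Longrightarrow> even (card (conn R `` {x} \<inter> {a, b, c, d}))"
  shows "paired R a b c d"
proof -
  have cnt: "card (conn R `` {x} \<inter> {a, b, c, d}) = of_bool ((x, a) \<in> conn R) + of_bool ((x, b) \<in> conn R)
    + of_bool ((x, c) \<in> conn R) + of_bool ((x, d) \<in> conn R)" for x
  proof -
    have "card (conn R `` {x} \<inter> {a, b, c, d}) = (\<Sum>y\<in>{a, b, c, d}. of_bool (y \<in> conn R `` {x}))"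
      by (simp add: sum_of_bool_eq Int_commute Image_singleton)
    then show ?thesis using dist by simp
  qed
  have s: "(x, y) \<in> conn R \<longleftrightarrow> (y, x) \<in> conn R" for x y using conn_sym by metis
  show ?thesis
    using ev[of a] ev[of b] ev[of c] ev[of d] s[of b a] s[of c a] s[of d a] s[of c b] s[of d b] s[of d c]
      conn_trans[of a d R b] conn_trans[of b a R c] conn_trans[of a c R b] conn_trans[of a b R d]
    unfolding paired_def cnt by (auto split: if_splits simp: of_bool_def)
qed

text \<open>\<open>Crossed\<close> lets both strands run straight on, as at a virtual crossing.
  \<open>Cut\<close> leaves four loose ends; the other choices are compared with each other through
  it.\<close>

datatype smoothing = A_arc | B_arc | Crossed | Cut

text \<open>\<open>X\<close> is the set of darts at the real crossings, and \<open>v\<close> maps such a dart to its crossing.  The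
  colour classes \<open>U\<close> and \<open>- U\<close> may be exchanged, which exchanges the roles of A and B.\<close>

locale alternating_darts =
  fixes V :: "'a set" and e rot :: "'a \<Rightarrow> 'a" and X U :: "'a set" and v :: "'a \<Rightarrow> 'c"
  assumes finite_V: "finite V"
    and e_V: "\<And>x. x \<in> V \<Longrightarrow> e x \<in> V" and e_e: "\<And>x. x \<in> V \<Longrightarrow> e (e x) = x"
    and X_V: "X \<subseteq> V"
    and rot_X: "\<And>x. x \<in> X \<Longrightarrow> rot x \<in> X" and rot4: "\<And>x. x \<in> X \<Longrightarrow> rot (rot (rot (rot x))) = x"
    and v_rot: "\<And>x. x \<in> X \<Longrightarrow> v (rot x) = v x"
    and rot2_neq: "\<And>x. x \<in> X \<Longrightarrow> rot (rot x) \<noteq> x"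
    and fibre: "\<And>x y. x \<in> X \<Longrightarrow> y \<in> X \<Longrightarrow> v x = v y \<Longrightarrow> y \<in> {x, rot x, rot (rot x), rot (rot (rot x))}"
    and rot_VX: "\<And>x. x \<in> V - X \<Longrightarrow> rot x \<in> V - X" and rot2_VX: "\<And>x. x \<in> V - X \<Longrightarrow> rot (rot x) = x"
    and rot_U: "\<And>x. x \<in> V \<Longrightarrow> rot x \<in> U \<longleftrightarrow> x \<notin> U" and e_U: "\<And>x. x \<in> V \<Longrightarrow> e x \<in> U \<longleftrightarrow> x \<notin> U"
    and proper: "\<And>x y. x \<in> X \<Longrightarrow> y \<in> X \<Longrightarrow> v x = v y \<Longrightarrow> x \<noteq> y \<Longrightarrow> (x, y) \<notin> conn (graph_of (e \<circ> rot) V)"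
begin

definition smoothed :: "('c \<Rightarrow> smoothing) \<Rightarrow> ('a \<times> 'a) set" where
  "smoothed s = graph_of e V \<union> {(h, rot h) | h. h \<in> V - X}
     \<union> {(h, rot h) | h. h \<in> X \<and> (s (v h) = A_arc \<and> h \<in> U \<or> s (v h) = B_arc \<and> h \<notin> U)}
     \<union> {(h, rot (rot h)) | h. h \<in> X \<and> s (v h) = Crossed}"

text \<open>The dart to which the smoothing joins \<open>h\<close>. If \<open>smoothed\<close> lists
  the arc from the other end, it is reached by the inverse of \<open>rot\<close>, which is
  \<open>rot\<close> applied three times. The value at cut darts is meaningless.\<close>

definition mate :: "('c \<Rightarrow> smoothing) \<Rightarrow> 'a \<Rightarrow> 'a" where
  "mate s h = (if h \<notin> X then rot h else if s (v h) = Crossed then rot (rot h)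
     else if (s (v h) = A_arc) = (h \<in> U) then rot h else rot (rot (rot h)))"

definition cut_darts :: "('c \<Rightarrow> smoothing) \<Rightarrow> 'a set" where
  "cut_darts s = {h \<in> X. s (v h) = Cut}"

lemma rot_V: "x \<in> V \<Longrightarrow> rot x \<in> V"
  using rot_X rot_VX X_V by blast

lemma smoothed_V: "smoothed s \<subseteq> V \<times> V"
  using e_V rot_V X_V unfolding smoothed_def graph_of_def by blast

lemma XV: "x \<in> X \<Longrightarrow> x \<in> V"
  using X_V by blast

text \<open>A and B arcs join neighbours and switch the colour, while crossed strands join opposite
  darts of equal colour; hence the extra hypothesis of the last claim.\<close>

lemma mate:
  assumes "h \<in> V - cut_darts s"
  shows "mate s h \<in> V - cut_darts s" "mate s (mate s h) = h" "mate s h \<noteq> h"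
    "(h, mate s h) \<in> smoothed s \<or> (mate s h, h) \<in> smoothed s"
    "\<forall>q. s q \<noteq> Crossed \<Longrightarrow> mate s h \<in> U \<longleftrightarrow> h \<notin> U"
proof -
  have "mate s h \<in> V - cut_darts s \<and> mate s (mate s h) = h \<and> mate s h \<noteq> h \<and>
    ((h, mate s h) \<in> smoothed s \<or> (mate s h, h) \<in> smoothed s) \<and>
    ((\<forall>q. s q \<noteq> Crossed) \<longrightarrow> (mate s h \<in> U \<longleftrightarrow> h \<notin> U))"
  proof (cases "h \<in> X")
    case False
    then have h: "h \<in> V - X" using assms by blast
    show ?thesis using False h rot_VX[OF h] rot2_VX[OF h] rot_U[of h]
      unfolding mate_def cut_darts_def smoothed_def by auto
  next
    case True
    have s: "s (v h) \<noteq> Cut" using assms True by (simp add: cut_darts_def)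
    let ?h1 = "rot h" and ?h2 = "rot (rot h)" and ?h3 = "rot (rot (rot h))"
    have hX: "?h1 \<in> X" "?h2 \<in> X" "?h3 \<in> X" using rot_X True by simp_all
    have hv: "v ?h1 = v h" "v ?h2 = v h" "v ?h3 = v h" using v_rot True hX by simp_all
    have hU: "?h1 \<in> U \<longleftrightarrow> h \<notin> U" "?h2 \<in> U \<longleftrightarrow> h \<in> U" "?h3 \<in> U \<longleftrightarrow> h \<notin> U"
      using rot_U XV True hX by simp_all
    have ne: "?h1 \<noteq> h" "?h2 \<noteq> h" "?h3 \<noteq> h" using hU rot2_neq[OF True] by metis+
    have r4: "rot ?h3 = h" by (rule rot4[OF True])
    note F = True hX hv hU ne r4 XV[OF hX(1)] XV[OF hX(2)] XV[OF hX(3)] XV[OF True]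
    show ?thesis
    proof (cases "s (v h)")
      case A_arc
      then show ?thesis using F unfolding mate_def cut_darts_def smoothed_def by (cases "h \<in> U") force+
    next
      case B_arc
      then show ?thesis using F unfolding mate_def cut_darts_def smoothed_def by (cases "h \<in> U") force+
    next
      case Crossed
      then show ?thesis using F unfolding mate_def cut_darts_def smoothed_def by force
    next
      case Cut
      then show ?thesis using s by simp
    qed
  qed
  then show "mate s h \<in> V - cut_darts s" "mate s (mate s h) = h" "mate s h \<noteq> h"
    "(h, mate s h) \<in> smoothed s \<or> (mate s h, h) \<in> smoothed s"
    "\<forall>q. s q \<noteq> Crossed \<Longrightarrow> mate s h \<in> U \<longleftrightarrow> h \<notin> U" by blast+
qed

definition cls :: "('c \<Rightarrow> smoothing) \<Rightarrow> 'a \<Rightarrow> 'a set" where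
  "cls s x = conn (smoothed s) `` {x}"

lemma cls_V: "x \<in> V \<Longrightarrow> cls s x \<subseteq> V"
proof
  fix y assume "x \<in> V" "y \<in> cls s x"
  then have "(x, y) \<in> conn (smoothed s)" "x \<in> V" by (auto simp: cls_def)
  then show "y \<in> V" by (rule conn_closed) (use smoothed_V in auto)
qed

lemma cls_e: "x \<in> V \<Longrightarrow> y \<in> cls s x \<Longrightarrow> e y \<in> cls s x"
proof -
  assume "x \<in> V" "y \<in> cls s x"
  then have "y \<in> V" "(x, y) \<in> conn (smoothed s)" using cls_V by (auto simp: cls_def)
  then have "(y, e y) \<in> conn (smoothed s)"
    by (intro conn_base) (auto simp: smoothed_def graph_of_def)
  then show ?thesis using \<open>(x, y) \<in> _\<close> conn_trans by (auto simp: cls_def)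
qed

lemma cls_mate: "x \<in> V \<Longrightarrow> y \<in> cls s x - cut_darts s \<Longrightarrow> mate s y \<in> cls s x - cut_darts s"
proof -
  assume a: "x \<in> V" "y \<in> cls s x - cut_darts s"
  then have y: "y \<in> V - cut_darts s" "(x, y) \<in> conn (smoothed s)" using cls_V by (auto simp: cls_def)
  then have "(y, mate s y) \<in> conn (smoothed s)"
    using mate(4)[OF y(1)] conn_base conn_sym by metis
  then show ?thesis using y mate(1)[OF y(1)] conn_trans by (auto simp: cls_def)
qed

text \<open>A path has two ends: \<open>e\<close> is a fixed-point free involution of the class, and
  \<open>mate\<close> is one of the class without its loose ends, so both cardinalities are
  even.\<close>

lemma cls_cut_even:
  assumes "x \<in> V"
  shows "even (card (cls s x \<inter> cut_darts s))"
proof -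
  let ?C = "cls s x"
  have fin: "finite ?C" using cls_V[OF assms] finite_V by (rule finite_subset)
  have "card ?C = 2 * cycles e ?C"
  proof (rule cycles_involution[OF fin])
    fix y assume y: "y \<in> ?C"
    then have "y \<in> V" using cls_V[OF assms] by blast
    then show "e y \<in> ?C \<and> e y \<noteq> y \<and> e (e y) = y"
      using cls_e[OF assms y] e_e[of y] e_U[of y] by (metis (full_types))
  qed
  moreover have "card (?C - cut_darts s) = 2 * cycles (mate s) (?C - cut_darts s)"
  proof (rule cycles_involution)
    fix y assume y: "y \<in> ?C - cut_darts s"
    then have "y \<in> V - cut_darts s" using cls_V[OF assms] by blast
    then show "mate s y \<in> ?C - cut_darts s \<and> mate s y \<noteq> y \<and> mate s (mate s y) = y"
      using cls_mate[OF assms y] mate(2,3)[of y s] by blast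
  qed (use fin in simp)
  moreover have "card ?C = card (?C - cut_darts s) + card (?C \<inter> cut_darts s)"
    using fin by (metis add.commute card_Int_Diff)
  ultimately have "card (?C \<inter> cut_darts s) = 2 * (cycles e ?C - cycles (mate s) (?C - cut_darts s))"
    by simp
  then show ?thesis by simp
qed

lemma card_colour_swap:
  assumes "finite C" "C \<subseteq> V" and f: "\<And>y. y \<in> C \<Longrightarrow> f y \<in> C \<and> f (f y) = y \<and> (f y \<in> U \<longleftrightarrow> y \<notin> U)"
  shows "card (C \<inter> U) = card (C - U)"
proof -
  have "bij_betw f (C \<inter> U) (C - U)"
    by (rule bij_betwI[of _ _ _ f]) (use f in auto)
  then show ?thesis by (rule bij_betw_same_card)
qed

text \<open>Without crossed strands both involutions also exchange the colours. This replaces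
  orientations: every path runs from a loose end in \<open>U\<close> to one outside
  \<open>U\<close>.\<close>

lemma cls_cut_balanced:
  assumes x: "x \<in> V" and s: "\<And>q. s q \<noteq> Crossed"
  shows "card (cls s x \<inter> cut_darts s \<inter> U) = card (cls s x \<inter> cut_darts s - U)"
proof -
  let ?C = "cls s x" and ?Q = "cut_darts s"
  have fin: "finite ?C" using cls_V[OF x] finite_V by (rule finite_subset)
  have 1: "card (?C \<inter> U) = card (?C - U)"
    by (rule card_colour_swap[OF fin cls_V[OF x], of e]) (use cls_e[OF x] e_e e_U cls_V[OF x] in blast)
  have 2: "card ((?C - ?Q) \<inter> U) = card ((?C - ?Q) - U)"
  proof (rule card_colour_swap[of _ "mate s"])
    fix y assume y: "y \<in> ?C - ?Q"
    then have "y \<in> V - ?Q" using cls_V[OF x] by blast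
    then show "mate s y \<in> ?C - ?Q \<and> mate s (mate s y) = y \<and> (mate s y \<in> U \<longleftrightarrow> y \<notin> U)"
      using cls_mate[OF x y] mate(2,5)[of y s] s by blast
  qed (use fin cls_V[OF x] in auto)
  have "card (?C \<inter> U) = card ((?C - ?Q) \<inter> U) + card (?C \<inter> ?Q \<inter> U)"
    using fin by (subst card_Un_disjoint[symmetric]) (auto intro!: arg_cong[of _ _ card])
  moreover have "card (?C - U) = card ((?C - ?Q) - U) + card (?C \<inter> ?Q - U)"
    using fin by (subst card_Un_disjoint[symmetric]) (auto intro!: arg_cong[of _ _ card])
  ultimately show ?thesis using 1 2 by simp
qed

lemma crossing_darts:
  assumes "q \<in> v ` X"
  obtains a where "a \<in> X" "a \<in> U" "v a = q" "rot a \<in> X" "rot (rot a) \<in> X" "rot (rot (rot a)) \<in> X"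
    "distinct [a, rot a, rot (rot a), rot (rot (rot a))]"
    "{h \<in> X. v h = q} = {a, rot a, rot (rot a), rot (rot (rot a))}"
    "rot a \<notin> U" "rot (rot a) \<in> U" "rot (rot (rot a)) \<notin> U"
proof -
  obtain b where b: "b \<in> X" "v b = q" using assms by blast
  \<comment> \<open>Colours alternate around a crossing, so one of two neighbouring darts lies in
    \<open>U\<close>.\<close>
  define a where "a = (if b \<in> U then b else rot b)"
  have a: "a \<in> X" "a \<in> U" "v a = q"
    using b rot_X[of b] v_rot[of b] rot_U[of b] XV[of b] by (auto simp: a_def)
  have r: "rot a \<in> X" "rot (rot a) \<in> X" "rot (rot (rot a)) \<in> X" using rot_X a by simp_all
  have c: "rot a \<notin> U" "rot (rot a) \<in> U" "rot (rot (rot a)) \<notin> U"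
    using rot_U a r XV by simp_all
  have "distinct [a, rot a, rot (rot a), rot (rot (rot a))]"
    using c a(2) rot2_neq[OF a(1)] rot2_neq[OF r(1)] by auto
  moreover have "{h \<in> X. v h = q} = {a, rot a, rot (rot a), rot (rot (rot a))}"
    (is "?L = ?R")
  proof (rule equalityI)
    show "?L \<subseteq> ?R"
    proof
      fix h assume "h \<in> ?L"
      then show "h \<in> ?R" using fibre[OF a(1), of h] a(3) by simp
    qed
    show "?R \<subseteq> ?L" using a r v_rot by simp
  qed
  ultimately show ?thesis using that a r c by blast
qed

text \<open>Only \<open>conn\<close> is compared, since crossed strands are listed from both
  ends.\<close>

lemma smoothed_cut_upd:
  assumes "a \<in> X" "a \<in> U" "v a = q" "{h \<in> X. v h = q} = {a, b, c, d}"
    "b = rot a" "c = rot b" "d = rot c"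
  shows "conn (smoothed (s(q := A_arc))) = conn (insert (a, b) (insert (c, d) (smoothed (s(q := Cut)))))"
    and "conn (smoothed (s(q := B_arc))) = conn (insert (b, c) (insert (d, a) (smoothed (s(q := Cut)))))"
    and "conn (smoothed (s(q := Crossed))) = conn (insert (a, c) (insert (b, d) (smoothed (s(q := Cut)))))"
proof -
  let ?K = "smoothed (s(q := Cut))"
  have X: "a \<in> X" "b \<in> X" "c \<in> X" "d \<in> X" using assms rot_X by simp_all
  have U: "a \<in> U" "b \<notin> U" "c \<in> U" "d \<notin> U" using X assms rot_U XV by simp_all
  have r: "rot a = b" "rot b = c" "rot c = d" "rot d = a" using assms rot4 by simp_all
  have vq: "h \<in> X \<and> v h = q \<longleftrightarrow> h = a \<or> h = b \<or> h = c \<or> h = d" for h using assms(4) by blast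
  have common: "smoothed (s(q := t)) = ?K
      \<union> {(h, rot h) | h. h \<in> X \<and> v h = q \<and> (t = A_arc \<and> h \<in> U \<or> t = B_arc \<and> h \<notin> U)}
      \<union> {(h, rot (rot h)) | h. h \<in> X \<and> v h = q \<and> t = Crossed}" for t
    unfolding smoothed_def by (auto split: if_splits)
  have img: "{(h, f h) | h. P h} = (\<lambda>h. (h, f h)) ` {h. P h}" for f :: "'a \<Rightarrow> 'a" and P
    by blast
  have sub: "{h. h \<in> X \<and> v h = q \<and> h \<in> U} = {a, c}" "{h. h \<in> X \<and> v h = q \<and> h \<notin> U} = {b, d}"
  proof -
    have "{h. h \<in> X \<and> v h = q \<and> h \<in> U} = {h \<in> X. v h = q} \<inter> U"
      "{h. h \<in> X \<and> v h = q \<and> h \<notin> U} = {h \<in> X. v h = q} - U" by blast+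
    then show "{h. h \<in> X \<and> v h = q \<and> h \<in> U} = {a, c}" "{h. h \<in> X \<and> v h = q \<and> h \<notin> U} = {b, d}"
      unfolding assms(4) using U by auto
  qed
  have 1: "{(h, rot h) | h. h \<in> X \<and> v h = q \<and> h \<in> U} = {(a, b), (c, d)}"
    unfolding img sub using r by simp
  have 2: "{(h, rot h) | h. h \<in> X \<and> v h = q \<and> h \<notin> U} = {(b, c), (d, a)}"
    unfolding img sub using r by simp
  have 3: "{(h, rot (rot h)) | h. h \<in> X \<and> v h = q} = {(a, c), (b, d), (c, a), (d, b)}"
    unfolding img assms(4) using r by simp
  show "conn (smoothed (s(q := A_arc))) = conn (insert (a, b) (insert (c, d) ?K))"
    unfolding common[of A_arc] using 1 by (simp add: insert_commute)
  show "conn (smoothed (s(q := B_arc))) = conn (insert (b, c) (insert (d, a) ?K))"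
    unfolding common[of B_arc] using 2 by (simp add: insert_commute)
  show "conn (smoothed (s(q := Crossed))) = conn (insert (a, c) (insert (b, d) ?K))"
  proof -
    have "smoothed (s(q := Crossed)) = insert (a, c) (insert (b, d) ?K) \<union> {(c, a), (d, b)}"
      unfolding common[of Crossed] using 3 by auto
    moreover have "{(c, a), (d, b)} \<subseteq> conn (insert (a, c) (insert (b, d) ?K))"
      by (auto intro!: conn_sym[OF conn_base])
    ultimately show ?thesis by (simp only: conn_Un_mono)
  qed
qed

abbreviation num_loops :: "('c \<Rightarrow> smoothing) \<Rightarrow> nat" where
  "num_loops s \<equiv> num_classes V (smoothed s)"

text \<open>As no other crossing is cut, the four darts at \<open>q\<close> are all the loose ends,
  and \<open>cls_cut_even\<close> makes them paired. Each of the three reconnections then lowers the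
  count of the cut state by at most one.\<close>

lemma num_loops_upd:
  assumes a: "a \<in> X" "a \<in> U" "v a = q" "{h \<in> X. v h = q} = {a, b, c, d}"
    "b = rot a" "c = rot b" "d = rot c"
    and s: "\<forall>q'. q' \<noteq> q \<longrightarrow> s q' \<noteq> Cut"
  defines "K \<equiv> smoothed (s(q := Cut))"
  shows "paired K a b c d"
    and "num_classes V K = num_loops (s(q := A_arc)) + (if (a, b) \<in> conn K then 0 else 1)"
    and "num_classes V K = num_loops (s(q := B_arc)) + (if (b, c) \<in> conn K then 0 else 1)"
    and "num_classes V K = num_loops (s(q := Crossed)) + (if (a, c) \<in> conn K then 0 else 1)"
proof -
  have X: "a \<in> X" "b \<in> X" "c \<in> X" "d \<in> X" using a rot_X by simp_all
  note V = X[THEN XV]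
  have cut: "cut_darts (s(q := Cut)) = {a, b, c, d}"
    using a(4) s by (auto simp: cut_darts_def)
  have U: "a \<in> U" "b \<notin> U" "c \<in> U" "d \<notin> U" using a V rot_U by simp_all
  have "c \<noteq> a" "d \<noteq> b" using rot2_neq X a by simp_all
  then have "distinct [a, b, c, d]" using U by auto
  then show P: "paired K a b c d"
  proof (rule paired_even)
    fix x assume "x \<in> {a, b, c, d}"
    then have "x \<in> V" using V by auto
    then show "even (card (conn K `` {x} \<inter> {a, b, c, d}))"
      using cls_cut_even[of x "s(q := Cut)"] cut by (simp add: cls_def K_def)
  qed
  have P2: "paired K b c d a" "paired K a c b d" using P conn_sym unfolding paired_def by metis+
  note u = smoothed_cut_upd[OF a, of s, folded K_def, THEN num_classes_cong, of V]
  show "num_classes V K = num_loops (s(q := A_arc)) + (if (a, b) \<in> conn K then 0 else 1)"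
    using num_classes_paired[OF finite_V V P] u(1) by simp
  show "num_classes V K = num_loops (s(q := B_arc)) + (if (b, c) \<in> conn K then 0 else 1)"
    using num_classes_paired[OF finite_V V(2,3,4,1) P2(1)] u(2) by simp
  show "num_classes V K = num_loops (s(q := Crossed)) + (if (a, c) \<in> conn K then 0 else 1)"
    using num_classes_paired[OF finite_V V(1,3,2,4) P2(2)] u(3) by simp
qed

lemma num_loops_switch:
  assumes "q \<in> v ` X" "\<And>q'. s q' \<noteq> Cut"
  shows "num_loops (s(q := B_arc)) \<le> num_loops (s(q := A_arc)) + 1"
proof -
  obtain a where "a \<in> X" "a \<in> U" "v a = q" "{h \<in> X. v h = q} = {a, rot a, rot (rot a), rot (rot (rot a))}"
    by (rule crossing_darts[OF assms(1)]) blast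
  then show ?thesis
    using num_loops_upd(2)[of a q "rot a" "rot (rot a)" "rot (rot (rot a))" s]
      num_loops_upd(3)[of a q "rot a" "rot (rot a)" "rot (rot (rot a))" s] assms(2)
    by (simp split: if_splits)
qed

text \<open>Every dart outside \<open>U\<close> is moved along its edge into \<open>U\<close>. The
  arc from \<open>h\<close> in \<open>U\<close> to \<open>rot h\<close> thereby becomes one step of
  the face permutation \<open>e \<circ> rot\<close>.\<close>

lemma conn_smoothed_A_colour:
  assumes "(x, y) \<in> conn (smoothed (\<lambda>_. A_arc))" "x \<in> U \<inter> V" "y \<in> U \<inter> V"
  shows "(x, y) \<in> conn (graph_of (e \<circ> rot) V)"
proof -
  let ?r = "\<lambda>h. if h \<in> U then h else e h" and ?F = "graph_of (e \<circ> rot) V"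
  have "(?r x, ?r y) \<in> conn ?F"
  proof (rule conn_map[OF assms(1)])
    fix g h assume gh: "(g, h) \<in> smoothed (\<lambda>_. A_arc)"
    then have gV: "g \<in> V" using smoothed_V by blast
    from gh consider "h = e g" | "h = rot g" "h \<noteq> e g"
      by (auto simp: smoothed_def graph_of_def)
    then show "(?r g, ?r h) \<in> conn ?F"
    proof cases
      assume "h = e g"
      then show ?thesis using gV e_U[OF gV] e_e[OF gV] by auto
    next
      assume h: "h = rot g" and "h \<noteq> e g"
      show ?thesis
      proof (cases "g \<in> U")
        case True
        then have "?r g = g" "?r h = (e \<circ> rot) g" using h gV rot_U by simp_all
        then show ?thesis using conn_graph_of_step[OF gV, of "e \<circ> rot"] by simp
      next
        case False
        \<comment> \<open>In the all-A state only a bivalent vertex has an arc that starts outside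
          \<open>U\<close>; it is read backwards, since \<open>rot\<close> is an involution
          there.\<close>
        then have "g \<in> V - X" using gh h gV \<open>h \<noteq> e g\<close> by (auto simp: smoothed_def graph_of_def)
        then have "rot h = g" "h \<in> V" using rot2_VX h rot_V by auto
        then have "?r g = (e \<circ> rot) h" "?r h = h" using False h gV rot_U by simp_all
        then show ?thesis
          using conn_sym[OF conn_graph_of_step[OF \<open>h \<in> V\<close>, of "e \<circ> rot"]] by simp
      qed
    qed
  qed
  then show ?thesis using assms by simp
qed

text \<open>This carries properness from faces over to loops: the two corners of colour
  \<open>U\<close> at a crossing are on different all-A loops.\<close>

lemma smoothed_A_proper:
  assumes "x \<in> X" "v x = v y" "y \<in> X" "x \<noteq> y" "x \<in> U" "y \<in> U"
  shows "(x, y) \<notin> conn (smoothed (\<lambda>_. A_arc))"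
  using conn_smoothed_A_colour[of x y] proper[of x y] assms XV by blast

lemma face_U: "x \<in> V \<Longrightarrow> (e \<circ> rot) x \<in> U \<longleftrightarrow> x \<in> U"
  using rot_U e_U rot_V by simp

lemma face_V: "x \<in> V \<Longrightarrow> (e \<circ> rot) x \<in> V"
  using e_V rot_V by simp

text \<open>Every all-A loop follows the boundary of one face of colour \<open>U\<close>. Applied to
  the complementary colour, the same statement counts the remaining faces by the all-B
  state.\<close>

lemma num_loops_A: "num_loops (\<lambda>_. A_arc) = cycles (e \<circ> rot) (V \<inter> U)"
proof -
  let ?r = "\<lambda>h. if h \<in> U then h else e h"
  have "cycles (e \<circ> rot) (V \<inter> U) = num_loops (\<lambda>_. A_arc)"
  proof (rule num_classes_transfer[where f = "\<lambda>x. x"])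
    fix w w' assume w: "w \<in> V \<inter> U" "w' \<in> V \<inter> U"
    have sub: "conn (graph_of (e \<circ> rot) (V \<inter> U)) \<subseteq> conn (smoothed (\<lambda>_. A_arc))"
    proof (rule conn_least, rule subrelI)
      fix x y assume "(x, y) \<in> graph_of (e \<circ> rot) (V \<inter> U)"
      then have x: "x \<in> V" "x \<in> U" "y = e (rot x)" by (auto simp: graph_of_def)
      then have "(x, rot x) \<in> smoothed (\<lambda>_. A_arc)" "(rot x, y) \<in> smoothed (\<lambda>_. A_arc)"
        using rot_V by (auto simp: smoothed_def graph_of_def)
      then show "(x, y) \<in> conn (smoothed (\<lambda>_. A_arc))" using conn_base conn_trans by metis
    qed
    have "(w, w') \<in> conn (graph_of (e \<circ> rot) (V \<inter> U))"
      if "(w, w') \<in> conn (graph_of (e \<circ> rot) V)"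
    proof -
      have "w' \<in> V \<inter> U \<and> (w, w') \<in> conn (graph_of (e \<circ> rot) (V \<inter> U))"
        using that
      proof (induction rule: conn_induct)
        case (step y z)
        then have *: "y \<in> V" "z \<in> V" "y \<in> U" "z = (e \<circ> rot) y \<or> y = (e \<circ> rot) z"
          using face_V by (auto simp: graph_of_def)
        then have "z \<in> U" using face_U by auto
        have "(y, z) \<in> conn (graph_of (e \<circ> rot) (V \<inter> U))"
          using *(4)
        proof
          assume "z = (e \<circ> rot) y"
          then show ?thesis using conn_graph_of_step[of y "V \<inter> U" "e \<circ> rot"] * by simp
        next
          assume "y = (e \<circ> rot) z"
          then show ?thesis
            using conn_sym[OF conn_graph_of_step[of z "V \<inter> U" "e \<circ> rot"]] * \<open>z \<in> U\<close> by simp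
        qed
        then show ?case using conn_trans[OF conjunct2[OF step(3)]] * \<open>z \<in> U\<close> by blast
      qed (use w in simp)
      then show ?thesis ..
    qed
    then show "(w, w') \<in> conn (graph_of (e \<circ> rot) (V \<inter> U)) \<longleftrightarrow> (w, w') \<in> conn (smoothed (\<lambda>_. A_arc))"
      using sub conn_smoothed_A_colour[of w w'] w by blast
  next
    fix x assume x: "x \<in> V"
    show "\<exists>w\<in>V \<inter> U. (w, x) \<in> conn (smoothed (\<lambda>_. A_arc))"
    proof (cases "x \<in> U")
      case False
      have "(x, e x) \<in> smoothed (\<lambda>_. A_arc)" using x by (auto simp: smoothed_def graph_of_def)
      then have "(e x, x) \<in> conn (smoothed (\<lambda>_. A_arc))" by (rule conn_sym[OF conn_base])
      then show ?thesis using False x e_V e_U by (intro bexI[of _ "e x"]) auto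
    qed (use x in \<open>auto intro!: bexI[of _ x]\<close>)
  qed auto
  then show ?thesis by simp
qed

lemma cycles_face_split: "cycles (e \<circ> rot) V = cycles (e \<circ> rot) (V \<inter> U) + cycles (e \<circ> rot) (V - U)"
proof -
  have "V \<inter> U \<union> (V - U) = V" by blast
  moreover have "graph_of (e \<circ> rot) (V \<inter> U) \<union> graph_of (e \<circ> rot) (V - U) = graph_of (e \<circ> rot) V"
    by (auto simp: graph_of_def)
  moreover have "graph_of (e \<circ> rot) (V \<inter> U) \<subseteq> (V \<inter> U) \<times> (V \<inter> U)"
    "graph_of (e \<circ> rot) (V - U) \<subseteq> (V - U) \<times> (V - U)"
    using face_U face_V by (auto simp: graph_of_def)
  ultimately show ?thesis
    using num_classes_disjoint_Un[of "V \<inter> U" "V - U" "graph_of (e \<circ> rot) (V \<inter> U)"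
        "graph_of (e \<circ> rot) (V - U)"] finite_V by auto
qed

lemma conn_cut_sub: "conn (smoothed (s(q := Cut))) \<subseteq> conn (smoothed s)"
  by (rule conn_mono) (auto simp: smoothed_def split: if_splits)

text \<open>Properness separates \<open>a\<close> from \<open>c\<close> and \<open>d\<close> already
  in the cut state, so parity leaves only paths from \<open>a\<close> to \<open>b\<close> and from
  \<open>c\<close> to \<open>d\<close>. The A arcs close these paths separately, whereas the crossed
  strands join them into one loop.\<close>

lemma num_loops_cross:
  assumes "p \<in> v ` X"
  shows "num_loops ((\<lambda>_. A_arc)(p := Crossed)) + 1 = cycles (e \<circ> rot) (V \<inter> U)"
proof -
  obtain a b c d where a: "a \<in> X" "a \<in> U" "v a = p" "{h \<in> X. v h = p} = {a, b, c, d}"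
    "b = rot a" "c = rot b" "d = rot c"
    by (rule crossing_darts[OF assms]) blast
  let ?A = "\<lambda>_. A_arc"
  let ?K = "smoothed (?A(p := Cut))"
  note u = num_loops_upd[OF a, of ?A, simplified]
  have cX: "c \<in> X" "v c = v a" "c \<in> U" "c \<noteq> a"
    using a rot_X v_rot rot_U XV rot2_neq by simp_all
  have F: "(a, c) \<notin> conn (smoothed ?A)" using smoothed_A_proper[of a c] a cX by simp
  then have ac: "(a, c) \<notin> conn ?K" using conn_cut_sub[of ?A p] by blast
  have "(a, d) \<notin> conn ?K"
  proof
    assume "(a, d) \<in> conn ?K"
    then have "(a, d) \<in> conn (smoothed ?A)" using conn_cut_sub[of ?A p] by blast
    moreover have "(c, d) \<in> smoothed ?A" using a cX by (auto simp: smoothed_def)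
    ultimately show False using F conn_base conn_sym conn_trans by metis
  qed
  then have "(a, b) \<in> conn ?K" using u(1) ac by (auto simp: paired_def)
  then have "num_loops (?A(p := A_arc)) = num_loops (?A(p := Crossed)) + 1"
    using u(2,4) ac by simp
  moreover have "?A(p := A_arc) = ?A" by auto
  ultimately show ?thesis using num_loops_A by simp
qed

end

section \<open>Changing splices while the strands at one crossing are crossed\<close>

context alternating_darts
begin

text \<open>The case analysis of \<open>num_loops_first_switch\<close>: \<open>H\<close> is the state with both crossings cut,
  \<open>F\<close> the all-A state, and \<open>K\<close> the state with the second crossing crossed and the first one cut.\<close>

lemma first_switch_aux:
  fixes H F K :: "('a \<times> 'a) set"
  assumes count: "\<And>x. x \<in> {a1, b1, c1, d1, a2, b2, c2, d2} \<Longrightarrow>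
      of_bool ((x, a1) \<in> conn H) + of_bool ((x, c1) \<in> conn H) + of_bool ((x, a2) \<in> conn H) + of_bool ((x, c2) \<in> conn H)
    = of_bool ((x, b1) \<in> conn H) + of_bool ((x, d1) \<in> conn H) + of_bool ((x, b2) \<in> conn H) + (of_bool ((x, d2) \<in> conn H) :: nat)"
    and HF: "conn H \<subseteq> conn F" and HK: "conn H \<subseteq> conn K"
    and F: "(a1, b1) \<in> conn F" "(c1, d1) \<in> conn F" "(a2, b2) \<in> conn F" "(c2, d2) \<in> conn F"
    and nF: "(a1, c1) \<notin> conn F" "(a2, c2) \<notin> conn F"
    and K: "(a2, c2) \<in> conn K" "(b2, d2) \<in> conn K"
    and bad: "(a1, d1) \<in> conn K" "(b1, c1) \<in> conn K" "(a1, b1) \<notin> conn K"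
    and start: "(a1, b2) \<in> conn H"
  shows False
proof -
  have s: "(y, x) \<in> conn R" if "(x, y) \<in> conn R" for x y and R :: "('a \<times> 'a) set"
    using that by (rule conn_sym)
  have t: "(x, z) \<in> conn R" if "(x, y) \<in> conn R" "(y, z) \<in> conn R" for x y z and R :: "('a \<times> 'a) set"
    using that by (rule conn_trans)
  have hf: "(x, y) \<in> conn F" and hk: "(x, y) \<in> conn K" if "(x, y) \<in> conn H" for x y
    using that HF HK by blast+
  have Fs: "(a1, d1) \<notin> conn F" "(b1, c1) \<notin> conn F" "(b1, d1) \<notin> conn F"
    "(a2, d2) \<notin> conn F" "(b2, c2) \<notin> conn F" "(b2, d2) \<notin> conn F"
    using F nF s t by metis+
  have a1: "(a1, c1) \<notin> conn H" "(a1, d1) \<notin> conn H" "(a1, b1) \<notin> conn H" "(a1, d2) \<notin> conn H"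
    using nF Fs hf hk bad(3) start s t by metis+
  \<comment> \<open>In \<open>H\<close> the end \<open>b2\<close> is the only one outside
    \<open>U\<close> connected to \<open>a1\<close>, so by the balance no second end in
    \<open>U\<close> is.\<close>
  with count[of a1] start have a1a2: "(a1, a2) \<notin> conn H" by (auto simp: of_bool_def split: if_splits)
  have a2: "(a2, a1) \<notin> conn H" "(a2, b2) \<notin> conn H" "(a2, c2) \<notin> conn H" "(a2, d2) \<notin> conn H"
    using a1a2 start nF Fs hf s t by metis+
  have "(a2, d1) \<notin> conn H"
  proof
    assume "(a2, d1) \<in> conn H"
    then have "(a1, d1) \<in> conn F" using hf[OF start] hf[of a2 d1] F(3) s t by metis
    then show False using Fs by blast
  qed
  \<comment> \<open>The balance demands an end outside \<open>U\<close> connected to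
    \<open>a2\<close>, and only \<open>b1\<close> is left.\<close>
  with count[of a2] a2 have a2b1: "(a2, b1) \<in> conn H"
    by (auto simp: of_bool_def split: if_splits)
  have d1: "(d1, a1) \<notin> conn H" "(d1, b1) \<notin> conn H" "(d1, b2) \<notin> conn H" "(d1, a2) \<notin> conn H"
    using a1 start Fs hf s t \<open>(a2, d1) \<notin> conn H\<close> by metis+
  with count[of d1] have "(d1, c1) \<in> conn H \<or> (d1, c2) \<in> conn H"
    by (auto simp: of_bool_def split: if_splits)
  \<comment> \<open>Either \<open>bad\<close> or the strand from \<open>a2\<close> to
    \<open>c2\<close> leads on to \<open>b1\<close>. Then all four ends at the first crossing are
    joined in \<open>K\<close>, against \<open>bad\<close>.\<close>
  then have "(b1, d1) \<in> conn K"
  proof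
    assume "(d1, c1) \<in> conn H"
    then show ?thesis using hk bad(2) s t by metis
  next
    assume "(d1, c2) \<in> conn H"
    then show ?thesis using hk a2b1 K(1) s t by metis
  qed
  then show False using bad s t by metis
qed

text \<open>An increase requires that the A arcs at \<open>q\<close> join two classes of the cut
  state \<open>K\<close> while the B arcs stay within classes. To exclude this, the crossed strands
  at \<open>p\<close> are cut too, since the balance of loose ends is available only without crossed
  strands.\<close>

lemma num_loops_first_switch:
  assumes p: "p \<in> v ` X" and q: "q \<in> v ` X" and "q \<noteq> p"
  shows "num_loops ((\<lambda>_. A_arc)(p := Crossed, q := B_arc)) \<le> num_loops ((\<lambda>_. A_arc)(p := Crossed))"
proof -
  obtain a1 b1 c1 d1 where q': "a1 \<in> X" "a1 \<in> U" "v a1 = q" "{h \<in> X. v h = q} = {a1, b1, c1, d1}"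
    "b1 = rot a1" "c1 = rot b1" "d1 = rot c1"
    by (rule crossing_darts[OF q]) blast
  obtain a2 b2 c2 d2 where p': "a2 \<in> X" "a2 \<in> U" "v a2 = p" "{h \<in> X. v h = p} = {a2, b2, c2, d2}"
    "b2 = rot a2" "c2 = rot b2" "d2 = rot c2"
    by (rule crossing_darts[OF p]) blast
  let ?A = "\<lambda>_. A_arc"
  let ?s = "?A(p := Crossed)"
  define K where "K = smoothed (?s(q := Cut))"
  define H where "H = smoothed (?A(p := Cut, q := Cut))"
  define F where "F = smoothed ?A"
  have "\<forall>q'. q' \<noteq> q \<longrightarrow> ?s q' \<noteq> Cut" by simp
  note u = num_loops_upd[OF q', of ?s, OF this, folded K_def]
  have X: "a1 \<in> X" "b1 \<in> X" "c1 \<in> X" "d1 \<in> X" "a2 \<in> X" "b2 \<in> X" "c2 \<in> X" "d2 \<in> X"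
    using q' p' rot_X by simp_all
  note V = X[THEN XV]
  have U: "a1 \<in> U" "b1 \<notin> U" "c1 \<in> U" "d1 \<notin> U" "a2 \<in> U" "b2 \<notin> U" "c2 \<in> U" "d2 \<notin> U"
    using q' p' V rot_U by simp_all
  have r: "rot a1 = b1" "rot b1 = c1" "rot c1 = d1" "rot d1 = a1" "rot a2 = b2" "rot b2 = c2" "rot c2 = d2" "rot d2 = a2"
    using q' p' rot4 by simp_all
  have v: "v b1 = q" "v c1 = q" "v d1 = q" "v b2 = p" "v c2 = p" "v d2 = p"
    using q' p' v_rot X by simp_all
  have ne: "a1 \<noteq> c1" "b1 \<noteq> d1" "a2 \<noteq> c2" "b2 \<noteq> d2"
    using rot2_neq[OF X(1)] rot2_neq[OF X(2)] rot2_neq[OF X(5)] rot2_neq[OF X(6)] r by metis+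
  have s_q: "?s(q := A_arc) = ?s" using \<open>q \<noteq> p\<close> by auto
  have HK: "conn H \<subseteq> conn K" unfolding H_def K_def
    by (rule conn_mono) (auto simp: smoothed_def split: if_splits)
  have HF: "conn H \<subseteq> conn F" unfolding H_def F_def
    by (rule conn_mono) (auto simp: smoothed_def split: if_splits)
  have Farcs: "(h, rot h) \<in> conn F" if "h \<in> X" "h \<in> U" for h
    using that unfolding F_def by (intro conn_base) (auto simp: smoothed_def)
  have F: "(a1, b1) \<in> conn F" "(c1, d1) \<in> conn F" "(a2, b2) \<in> conn F" "(c2, d2) \<in> conn F"
    using Farcs X U r by metis+
  have nF: "(a1, c1) \<notin> conn F" "(a2, c2) \<notin> conn F"
    unfolding F_def by (rule smoothed_A_proper; use X U v q' p' ne in simp)+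
  have Kx: "(h, rot (rot h)) \<in> conn K" if "h \<in> X" "v h = p" for h
    using that \<open>q \<noteq> p\<close> unfolding K_def by (intro conn_base) (auto simp: smoothed_def)
  have K: "(a2, c2) \<in> conn K" "(b2, d2) \<in> conn K"
    using Kx X v p'(3) r by metis+
  have cut: "cut_darts (?A(p := Cut, q := Cut)) = {a1, b1, c1, d1} \<union> {a2, b2, c2, d2}"
    unfolding q'(4)[symmetric] p'(4)[symmetric] by (auto simp: cut_darts_def)
  have "q \<noteq> p" by fact
  then have dist: "a1 \<noteq> a2" "a1 \<noteq> c2" "c1 \<noteq> a2" "c1 \<noteq> c2" "b1 \<noteq> b2" "b1 \<noteq> d2" "d1 \<noteq> b2" "d1 \<noteq> d2"
    using v q'(3) p'(3) by metis+
  have count: "of_bool ((x, a1) \<in> conn H) + of_bool ((x, c1) \<in> conn H) + of_bool ((x, a2) \<in> conn H) + of_bool ((x, c2) \<in> conn H)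
    = of_bool ((x, b1) \<in> conn H) + of_bool ((x, d1) \<in> conn H) + of_bool ((x, b2) \<in> conn H) + (of_bool ((x, d2) \<in> conn H) :: nat)"
    if "x \<in> V" for x
  proof -
    let ?s' = "?A(p := Cut, q := Cut)"
    have 1: "cls ?s' x \<inter> cut_darts ?s' \<inter> U = {a1, c1, a2, c2} \<inter> {y. (x, y) \<in> conn H}"
      unfolding cut cls_def H_def[symmetric] using U by auto
    have 2: "cls ?s' x \<inter> cut_darts ?s' - U = {b1, d1, b2, d2} \<inter> {y. (x, y) \<in> conn H}"
      unfolding cut cls_def H_def[symmetric] using U by auto
    have card: "card (S \<inter> {y. (x, y) \<in> conn H}) = (\<Sum>y\<in>S. of_bool ((x, y) \<in> conn H))" if "finite S" for S
      using that by (simp add: sum_of_bool_eq)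
    have "card ({a1, c1, a2, c2} \<inter> {y. (x, y) \<in> conn H}) = card ({b1, d1, b2, d2} \<inter> {y. (x, y) \<in> conn H})"
      using cls_cut_balanced[OF that, of ?s'] unfolding 1 2 by simp
    then have "(\<Sum>y\<in>{a1, c1, a2, c2}. of_bool ((x, y) \<in> conn H)) = (\<Sum>y\<in>{b1, d1, b2, d2}. of_bool ((x, y) \<in> conn H) :: nat)"
      by (simp only: card finite.intros)
    moreover have "sum f {a1, c1, a2, c2} = f a1 + f c1 + f a2 + f c2"
      "sum f {b1, d1, b2, d2} = f b1 + f d1 + f b2 + f d2" for f :: "'a \<Rightarrow> nat"
      using dist ne by (simp_all add: add.assoc)
    ultimately show ?thesis by (simp only:)
  qed
  have "\<not> ((a1, b1) \<notin> conn K \<and> (b1, c1) \<in> conn K)"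
  proof
    assume bad: "(a1, b1) \<notin> conn K \<and> (b1, c1) \<in> conn K"
    have ad: "(a1, d1) \<in> conn K" using bad u(1) by (auto simp: paired_def)
    have "(a1, c1) \<notin> conn H" "(a1, d1) \<notin> conn H" "(a1, b1) \<notin> conn H"
      using nF(1) F(2) HF HK bad conn_sym conn_trans by (metis subsetD)+
    \<comment> \<open>An end outside \<open>U\<close> connected to \<open>a1\<close> can only be at
      \<open>p\<close>. The two cases differ by a half turn of the labels at
      \<open>p\<close>.\<close>
    then have "(a1, b2) \<in> conn H \<or> (a1, d2) \<in> conn H" using count[OF V(1)] by (auto simp: of_bool_def split: if_splits)
    then show False
    proof
      assume "(a1, b2) \<in> conn H"
      show False
      proof (rule first_switch_aux[OF _ HF HK F nF K ad conjunct2[OF bad] conjunct1[OF bad] \<open>(a1, b2) \<in> conn H\<close>])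
        fix x assume "x \<in> {a1, b1, c1, d1, a2, b2, c2, d2}"
        then have "x \<in> V" using V by auto
        then show "of_bool ((x, a1) \<in> conn H) + of_bool ((x, c1) \<in> conn H) + of_bool ((x, a2) \<in> conn H) + of_bool ((x, c2) \<in> conn H)
          = of_bool ((x, b1) \<in> conn H) + of_bool ((x, d1) \<in> conn H) + of_bool ((x, b2) \<in> conn H) + (of_bool ((x, d2) \<in> conn H) :: nat)"
          by (rule count)
      qed
    next
      assume "(a1, d2) \<in> conn H"
      have sym: "(c2, a2) \<notin> conn F" "(c2, a2) \<in> conn K" "(d2, b2) \<in> conn K"
        using nF K conn_sym by metis+
      show False
      proof (rule first_switch_aux[OF _ HF HK F(1,2,4,3) nF(1) sym ad conjunct2[OF bad] conjunct1[OF bad] \<open>(a1, d2) \<in> conn H\<close>])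
        fix x assume "x \<in> {a1, b1, c1, d1, c2, d2, a2, b2}"
        then have "x \<in> V" using V by auto
        from count[OF this] show "of_bool ((x, a1) \<in> conn H) + of_bool ((x, c1) \<in> conn H) + of_bool ((x, c2) \<in> conn H) + of_bool ((x, a2) \<in> conn H)
          = of_bool ((x, b1) \<in> conn H) + of_bool ((x, d1) \<in> conn H) + of_bool ((x, d2) \<in> conn H) + (of_bool ((x, b2) \<in> conn H) :: nat)"
          by linarith
      qed
    qed
  qed
  then show ?thesis using u(2,3) unfolding s_q by (auto simp: of_bool_def split: if_splits)
qed

text \<open>The first change costs nothing, which is why the induction starts at a singleton; each
  later one adds at most one loop.\<close>

lemma num_loops_bound:
  assumes p: "p \<in> v ` X" and T: "finite T" "T \<noteq> {}" "T \<subseteq> v ` X - {p}"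
  shows "num_loops (\<lambda>q. if q = p then Crossed else if q \<in> T then B_arc else A_arc) + 1
    \<le> num_loops ((\<lambda>_. A_arc)(p := Crossed)) + card T"
  using T
proof (induction rule: finite_ne_induct)
  case (singleton q)
  have "(\<lambda>r. if r = p then Crossed else if r \<in> {q} then B_arc else A_arc) = (\<lambda>_. A_arc)(p := Crossed, q := B_arc)"
    using singleton by auto
  note eq = this
  have "q \<in> v ` X" "q \<noteq> p" using singleton by auto
  note le = num_loops_first_switch[OF p this]
  have "card {q} = 1" by simp
  then show ?case using le by (simp only: eq add_le_cancel_right)
next
  case (insert q T)
  let ?s = "\<lambda>T q. if q = p then Crossed else if q \<in> T then B_arc else A_arc"
  have "?s (insert q T) = (?s T)(q := B_arc)" "?s T = (?s T)(q := A_arc)"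
    using insert.prems insert.hyps by auto
  then have "num_loops (?s (insert q T)) \<le> num_loops (?s T) + 1"
    using num_loops_switch[of q "?s T"] insert.prems by simp
  then show ?case using insert by simp
qed

text \<open>At \<open>p\<close> the bands of opposite darts continue each other, as if the crossing
  were replaced by two bivalent vertices.\<close>

definition crossing_rot :: "'c \<Rightarrow> 'a \<Rightarrow> 'a" where
  "crossing_rot p h = (if h \<in> X \<and> v h = p then rot (rot h) else rot h)"

lemma bij_rot: "bij_betw rot V V"
proof -
  have "inj_on rot V"
  proof (rule inj_onI)
    fix x y assume xy: "x \<in> V" "y \<in> V" "rot x = rot y"
    show "x = y"
    proof (cases "x \<in> X")
      case True
      then have "y \<in> X" using xy rot_X rot_VX by (metis Diff_iff)
      then show ?thesis using rot4 True xy by metis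
    next
      case False
      then have "y \<notin> X" using xy rot_X rot_VX by (metis Diff_iff)
      then show ?thesis using rot2_VX False xy by (metis Diff_iff)
    qed
  qed
  then show ?thesis using rot_V finite_V by (simp add: bij_betw_def endo_inj_surj image_subsetI)
qed

lemma bij_e: "bij_betw e V V"
  by (rule bij_betwI[of _ _ _ e]) (use e_V e_e in auto)

text \<open>Crossing the two strands at \<open>p\<close> composes the face permutation with a 4-cycle, which merges
  the four faces around \<open>p\<close>.\<close>

lemma cycles_crossing_rot:
  assumes "p \<in> v ` X"
  shows "cycles (e \<circ> rot) V = cycles (e \<circ> crossing_rot p) V + 3"
proof -
  obtain a b c d where a: "a \<in> X" "a \<in> U" "v a = p" "{h \<in> X. v h = p} = {a, b, c, d}"
    "b = rot a" "c = rot b" "d = rot c" and dist: "distinct [a, b, c, d]"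
    by (rule crossing_darts[OF assms]) blast
  have X: "a \<in> X" "b \<in> X" "c \<in> X" "d \<in> X" using a rot_X by simp_all
  note V = X[THEN XV]
  have v: "v a = p" "v b = p" "v c = p" "v d = p" using a v_rot X by simp_all
  have r: "rot a = b" "rot b = c" "rot c = d" "rot d = a" using a rot4 by simp_all
  define f0 where "f0 = e \<circ> rot"
  \<comment> \<open>The 4-cycle is a product of three transpositions, each merging two cycles that
    properness still keeps apart; hence the 3.\<close>
  define f1 where "f1 = f0 \<circ> Transposition.transpose a b"
  define f2 where "f2 = f1 \<circ> Transposition.transpose b c"
  define f3 where "f3 = f2 \<circ> Transposition.transpose c d"
  have b0: "bij_betw f0 V V" unfolding f0_def using bij_rot bij_e by (rule bij_betw_trans)
  have b1: "bij_betw f1 V V" unfolding f1_def using b0 V(1,2) by (rule bij_betw_transpose)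
  have b2: "bij_betw f2 V V" unfolding f2_def using b1 V(2,3) by (rule bij_betw_transpose)
  have n: "(x, y) \<notin> conn (graph_of f0 V)" if "x \<in> {a, b, c, d}" "y \<in> {a, b, c, d}" "x \<noteq> y" for x y
    unfolding f0_def by (rule proper) (use that X v in auto)
  have c1: "conn (graph_of f1 V) = conn (insert (a, b) (graph_of f0 V))"
    unfolding f1_def by (rule conn_transpose_merge[OF b0 finite_V V(1,2)]) (use n dist in auto)
  have n1: "(b, c) \<notin> conn (graph_of f1 V)"
    unfolding c1 conn_insert_iff using n dist by auto
  have c2: "conn (graph_of f2 V) = conn (insert (b, c) (graph_of f1 V))"
    unfolding f2_def by (rule conn_transpose_merge[OF b1 finite_V V(2,3) n1])
  have n2: "(c, d) \<notin> conn (graph_of f2 V)"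
    unfolding c2 conn_insert_iff unfolding c1 conn_insert_iff using n dist by auto
  have ne: "a \<noteq> b" "b \<noteq> c" "c \<noteq> d" using dist by auto
  have "cycles f0 V = cycles f1 V + 1"
    unfolding f1_def by (rule cycles_transpose(1)[OF b0 finite_V V(1,2) ne(1)]) (use n dist in auto)
  moreover have "cycles f1 V = cycles f2 V + 1"
    unfolding f2_def by (rule cycles_transpose(1)[OF b1 finite_V V(2,3) ne(2) n1])
  moreover have "cycles f2 V = cycles f3 V + 1"
    unfolding f3_def by (rule cycles_transpose(1)[OF b2 finite_V V(3,4) ne(3) n2])
  moreover have "graph_of f3 V = graph_of (e \<circ> crossing_rot p) V"
  proof (rule graph_of_cong)
    fix x assume "x \<in> V"
    show "f3 x = (e \<circ> crossing_rot p) x"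
    proof (cases "x \<in> {a, b, c, d}")
      case True
      then show ?thesis using dist X v r
        by (auto simp: f3_def f2_def f1_def f0_def crossing_rot_def Transposition.transpose_def)
    next
      case False
      then have "\<not> (x \<in> X \<and> v x = p)" using a(4) by blast
      then show ?thesis using False
        by (auto simp: f3_def f2_def f1_def f0_def crossing_rot_def Transposition.transpose_def)
    qed
  qed
  ultimately show ?thesis by (simp add: f0_def)
qed

text \<open>An edge returning to its crossing puts two corners of this crossing on one face.
  Properness makes the corners equal; done from both ends of the edge, this makes \<open>rot\<close>
  applied twice fix \<open>x\<close>.\<close>

lemma no_loop_edge:
  assumes "x \<in> X" "e x \<in> X"
  shows "v (e x) \<noteq> v x"
proof
  assume eq: "v (e x) = v x"
  have *: "rot z = y" if "y \<in> X" "z \<in> X" "e y = z" "v y = v z" for y z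
  proof -
    let ?w = "rot (rot (rot y))"
    have w: "?w \<in> V" "?w \<in> X" "v ?w = v z" "rot ?w = y" using that rot_X v_rot rot4 XV by simp_all
    have "(?w, z) \<in> conn (graph_of (e \<circ> rot) V)"
      using conn_graph_of_step[OF w(1), of "e \<circ> rot"] w(4) that by simp
    then have "?w = z" using proper[of ?w z] w that by blast
    then show ?thesis using w by simp
  qed
  have "rot (e x) = x" "rot x = e x"
    using *[of x "e x"] *[of "e x" x] assms eq e_e[OF XV] by simp_all
  then show False using rot2_neq[OF assms(1)] by simp
qed

section \<open>Deleting the darts of one crossing\<close>

definition removed :: "'c \<Rightarrow> 'a set" where
  "removed p = {h \<in> X. v h = p}"

text \<open>The edges after virtualizing \<open>p\<close>: an edge ending at \<open>p\<close> is
  continued by the opposite one. One continuation suffices, as by \<open>no_loop_edge\<close> the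
  opposite edge does not end at \<open>p\<close> again.\<close>

definition through_edge :: "'c \<Rightarrow> 'a \<Rightarrow> 'a" where
  "through_edge p h = (if e h \<in> removed p then e (rot (rot (e h))) else e h)"

lemma removed_step:
  assumes "h \<in> removed p"
  shows "h \<in> V" "rot (rot h) \<in> removed p" "e h \<in> V - removed p" "rot (rot (rot (rot h))) = h"
    "e (rot (rot h)) \<in> V - removed p"
proof -
  have h: "h \<in> X" "v h = p" using assms by (auto simp: removed_def)
  show "h \<in> V" using h XV by blast
  show h2: "rot (rot h) \<in> removed p" using h rot_X v_rot by (simp add: removed_def)
  show "rot (rot (rot (rot h))) = h" using h rot4 by blast
  have *: "e g \<in> V - removed p" if "g \<in> removed p" for g
    using that no_loop_edge[of g] e_V XV by (auto simp: removed_def)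
  show "e h \<in> V - removed p" "e (rot (rot h)) \<in> V - removed p" using * assms h2 by blast+
qed

lemma removed_V: "removed p \<subseteq> V"
  using removed_step(1) by blast

text \<open>A removed dart is retracted to the other end of its edge, which survives by
  \<open>no_loop_edge\<close>. Thus states of the virtualized diagram can be computed on the old set
  of darts.\<close>

lemma num_loops_removed:
  assumes s: "s p = Crossed" "\<And>q. q \<noteq> p \<Longrightarrow> s q = (if q \<in> T then B_arc else A_arc)"
  shows "num_classes (V - removed p) (graph_of (through_edge p) (V - removed p) \<union>
      {(h, rot h) | h. h \<in> V - removed p \<and> (h \<in> X \<longrightarrow> (h \<in> U \<longleftrightarrow> v h \<notin> T))})
    = num_loops s" (is "num_classes _ ?R = _")
proof (rule num_classes_retract[where r = "\<lambda>h. if h \<in> removed p then e h else h"])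
  let ?r = "\<lambda>h. if h \<in> removed p then e h else h"
  have edge: "(h, e h) \<in> conn (smoothed s)" if "h \<in> V" for h
    using that by (intro conn_base) (auto simp: smoothed_def graph_of_def)
  show "(h, ?r h) \<in> conn (smoothed s)" if "h \<in> V" for h using edge that by simp
  show "V - removed p \<subseteq> V" by blast
  show "?r h \<in> V - removed p" if "h \<in> V" for h using that removed_step(3) by simp
  show "(h, ?r h) \<in> conn ?R" if "h \<in> V - removed p" for h using that by simp
  have tr: "(h, through_edge p h) \<in> conn ?R" if "h \<in> V - removed p" for h
    using that by (intro conn_base) (auto simp: graph_of_def)
  show "(?r g, ?r h) \<in> conn ?R" if gh: "(g, h) \<in> smoothed s" for g h
  proof -
    have gV: "g \<in> V" using gh smoothed_V by blast
    have sA: "s q = A_arc \<longleftrightarrow> q \<noteq> p \<and> q \<notin> T" and sB: "s q = B_arc \<longleftrightarrow> q \<noteq> p \<and> q \<in> T"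
      and sX: "s q = Crossed \<longleftrightarrow> q = p" for q
      using s by (cases "q = p"; simp)+
    from gh consider "h = e g" | "h = rot g" "h \<noteq> e g" "g \<in> V - removed p" "g \<in> X \<longrightarrow> (g \<in> U \<longleftrightarrow> v g \<notin> T)"
      | "h = rot (rot g)" "g \<in> removed p"
      unfolding smoothed_def sA sB sX using gV by (auto simp: graph_of_def removed_def)
    then show ?thesis
    proof cases
      case 1
      show ?thesis
      proof (cases "g \<in> removed p")
        case True
        then show ?thesis using 1 removed_step(3)[OF True] by simp
      next
        case g: False
        show ?thesis
        proof (cases "h \<in> removed p")
          case True
          then show ?thesis using 1 g e_e[OF gV] by simp
        next
          case False
          then have "h = through_edge p g" using 1 by (simp add: through_edge_def)
          then show ?thesis using tr[of g] g gV False by simp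
        qed
      qed
    next
      case 2
      have "h \<notin> removed p"
      proof
        assume "h \<in> removed p"
        then have "g \<in> X" using 2 gV rot_VX[of g] by (auto simp: removed_def)
        then show False using 2 \<open>h \<in> removed p\<close> v_rot by (auto simp: removed_def)
      qed
      then show ?thesis using 2 by (auto intro!: conn_base)
    next
      case 3
      have "through_edge p (e g) = e h" using 3 e_e[OF gV] by (simp add: through_edge_def)
      then show ?thesis using tr[of "e g"] 3 removed_step[OF 3(2)] by simp
    qed
  qed
  show "(g, h) \<in> conn (smoothed s)" if "(g, h) \<in> ?R" for g h
  proof -
    from that consider "g \<in> V - removed p" "h = through_edge p g"
      | "g \<in> V - removed p" "h = rot g" "g \<in> X \<longrightarrow> (g \<in> U \<longleftrightarrow> v g \<notin> T)"
      by (auto simp: graph_of_def)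
    then show ?thesis
    proof cases
      case 1
      show ?thesis
      proof (cases "e g \<in> removed p")
        case True
        note x = removed_step[OF True]
        have "(e g, rot (rot (e g))) \<in> conn (smoothed s)"
          using True s(1) by (intro conn_base) (auto simp: smoothed_def removed_def)
        moreover have "h = e (rot (rot (e g)))" using 1 True by (simp add: through_edge_def)
        ultimately show ?thesis
          using edge[of g] edge[of "rot (rot (e g))"] 1 removed_step(1)[OF x(2)] conn_trans by (metis DiffD1)
      qed (use 1 edge in \<open>simp add: through_edge_def\<close>)
    next
      case 2
      then have "(g, h) \<in> smoothed s"
        using s(2) by (cases "g \<in> X") (auto simp: smoothed_def removed_def)
      then show ?thesis by (rule conn_base)
    qed
  qed
qed

text \<open>Here a removed dart is retracted one step forward along its face.\<close>

lemma cycles_removed: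
  "cycles (through_edge p \<circ> rot) (V - removed p) = cycles (e \<circ> crossing_rot p) V"
proof (rule num_classes_retract[where r = "\<lambda>h. if h \<in> removed p then (e \<circ> crossing_rot p) h else h"])
  let ?f = "e \<circ> crossing_rot p" and ?P = "removed p"
  let ?r = "\<lambda>h. if h \<in> ?P then ?f h else h"
  let ?R = "graph_of (through_edge p \<circ> rot) (V - ?P)"
  have fP: "?f h = e (rot (rot h))" if "h \<in> ?P" for h using that by (simp add: crossing_rot_def removed_def)
  have fnP: "?f h = e (rot h)" if "h \<notin> ?P" for h using that by (auto simp: crossing_rot_def removed_def)
  have fV: "?f h \<in> V" if "h \<in> V" for h using that rot_V e_V by (simp add: crossing_rot_def)
  have step: "(h, ?f h) \<in> conn (graph_of ?f V)" if "h \<in> V" for h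
    using conn_graph_of_step[OF that] .
  show "V - ?P \<subseteq> V" by blast
  show "?r h \<in> V - ?P" if "h \<in> V" for h using that removed_step(5)[of h] fP[of h] by auto
  show "(h, ?r h) \<in> conn (graph_of ?f V)" if "h \<in> V" for h using step[OF that] by simp
  show "(h, ?r h) \<in> conn ?R" if "h \<in> V - ?P" for h using that by simp
  have tr: "(h, through_edge p (rot h)) \<in> conn ?R" if "h \<in> V - ?P" for h
    using conn_graph_of_step[OF that, of "through_edge p \<circ> rot"] by simp
  \<comment> \<open>A step after the deletion is one step of \<open>?f\<close>, or two if the first
    lands on a removed dart.\<close>
  have double: "through_edge p (rot h) = (if ?f h \<in> ?P then ?f (?f h) else ?f h)" if "h \<in> V - ?P" for h
    using that fP[of "?f h"] fnP[of h] by (simp add: through_edge_def)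
  show "(?r g, ?r h) \<in> conn ?R" if "(g, h) \<in> graph_of ?f V" for g h
  proof -
    have g: "g \<in> V" "h = ?f g" using that by (auto simp: graph_of_def)
    show ?thesis
    proof (cases "g \<in> ?P")
      case True
      then have "h \<notin> ?P" using g removed_step(5)[OF True] fP[OF True] by simp
      then show ?thesis using True g by simp
    next
      case False
      then have "?r h = through_edge p (rot g)" using double[of g] g by simp
      then show ?thesis using tr[of g] False g by simp
    qed
  qed
  show "(g, h) \<in> conn (graph_of ?f V)" if "(g, h) \<in> ?R" for g h
  proof -
    have g: "g \<in> V - ?P" "h = through_edge p (rot g)" using that by (auto simp: graph_of_def)
    then have "h = (if ?f g \<in> ?P then ?f (?f g) else ?f g)" using double by simp
    then show ?thesis using g step[of g] step[of "?f g"] fV[of g] conn_trans by (metis DiffD1)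
  qed
qed

end

section \<open>Extreme exponents of the bracket\<close>

lemma lookup_single_times:
  fixes f :: laurent
  shows "Poly_Mapping.lookup (Poly_Mapping.single a c * f) k = c * Poly_Mapping.lookup f (k - a)"
proof -
  have "Sum_any (\<lambda>q. Poly_Mapping.lookup f q when k = l + q) = Poly_Mapping.lookup f (k - l)" for l
  proof -
    have "k = l + q \<longleftrightarrow> q = k - l" for q by auto
    then show ?thesis by simp
  qed
  then show ?thesis by (simp add: lookup_mult lookup_single when_mult)
qed

abbreviation loop_value :: laurent where
  "loop_value \<equiv> - A_power 2 - A_power (- 2)"

lemma lookup_loop_value_times:
  "Poly_Mapping.lookup (loop_value * f) k = - Poly_Mapping.lookup f (k - 2) - Poly_Mapping.lookup f (k + 2)"
proof -
  have "loop_value * f = - (A_power 2 * f) - A_power (- 2) * f" by (simp add: algebra_simps)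
  then show ?thesis by (simp add: lookup_minus lookup_single_times)
qed

text \<open>Each factor shifts exponents by 2 or -2, and an extreme exponent is reached only by the
  same shift throughout, so nothing cancels there.\<close>

lemma lookup_loop_value_power:
  "\<bar>k\<bar> > 2 * int n \<Longrightarrow> Poly_Mapping.lookup (loop_value ^ n) k = 0"
  "Poly_Mapping.lookup (loop_value ^ n) (2 * int n) = (- 1) ^ n"
  "Poly_Mapping.lookup (loop_value ^ n) (- (2 * int n)) = (- 1) ^ n"
proof -
  have "(\<forall>k. \<bar>k\<bar> > 2 * int n \<longrightarrow> Poly_Mapping.lookup (loop_value ^ n) k = 0) \<and>
    Poly_Mapping.lookup (loop_value ^ n) (2 * int n) = (- 1) ^ n \<and>
    Poly_Mapping.lookup (loop_value ^ n) (- (2 * int n)) = (- 1) ^ n"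
  proof (induction n)
    case 0
    then show ?case by (auto simp: lookup_one)
  next
    case (Suc n)
    have s: "2 * int (Suc n) - 2 = 2 * int n" "- (2 * int (Suc n)) + 2 = - (2 * int n)" by simp_all
    have z: "Poly_Mapping.lookup (loop_value ^ n) k = 0" if "\<bar>k\<bar> > 2 * int n" for k
      using Suc that by blast
    have "Poly_Mapping.lookup (loop_value ^ Suc n) k = 0" if "\<bar>k\<bar> > 2 * int (Suc n)" for k
      unfolding power_Suc lookup_loop_value_times using z[of "k - 2"] z[of "k + 2"] that by auto
    moreover have "Poly_Mapping.lookup (loop_value ^ Suc n) (2 * int (Suc n)) = (- 1) ^ Suc n"
      unfolding power_Suc lookup_loop_value_times s using Suc z[of "2 * int (Suc n) + 2"] by simp
    moreover have "Poly_Mapping.lookup (loop_value ^ Suc n) (- (2 * int (Suc n))) = (- 1) ^ Suc n"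
      unfolding power_Suc lookup_loop_value_times s using Suc z[of "- (2 * int (Suc n)) - 2"] by simp
    ultimately show ?case by blast
  qed
  then show "\<bar>k\<bar> > 2 * int n \<Longrightarrow> Poly_Mapping.lookup (loop_value ^ n) k = 0"
    "Poly_Mapping.lookup (loop_value ^ n) (2 * int n) = (- 1) ^ n"
    "Poly_Mapping.lookup (loop_value ^ n) (- (2 * int n)) = (- 1) ^ n" by blast+
qed

text \<open>The normalizing factor is a monomial, so it only translates the exponents of the
  bracket.\<close>

lemma minus_A_cubed_power_single: "\<exists>m s. s \<noteq> 0 \<and> minus_A_cubed_power k = Poly_Mapping.single m s"
proof -
  have pow: "\<exists>m s. s \<noteq> 0 \<and> (- A_power a) ^ n = Poly_Mapping.single m (s :: int)" for a n
  proof (induction n)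
    case 0
    then show ?case by (intro exI[of _ 0] exI[of _ 1]) simp
  next
    case (Suc n)
    then obtain m s where "s \<noteq> 0" "(- A_power a) ^ n = Poly_Mapping.single m s" by blast
    then show ?case by (intro exI[of _ "a + m"] exI[of _ "- s"]) (simp add: mult_single single_uminus)
  qed
  show ?thesis unfolding minus_A_cubed_power_def using pow by simp
qed

lemma span_single_times:
  fixes f :: laurent
  assumes "s \<noteq> 0" "Poly_Mapping.lookup f M \<noteq> 0" "Poly_Mapping.lookup f N \<noteq> 0"
    and "\<And>k. Poly_Mapping.lookup f k \<noteq> 0 \<Longrightarrow> N \<le> k \<and> k \<le> M"
  shows "Max (Poly_Mapping.keys (Poly_Mapping.single m s * f)) - Min (Poly_Mapping.keys (Poly_Mapping.single m s * f)) = M - N"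
proof -
  have k: "k \<in> Poly_Mapping.keys (Poly_Mapping.single m s * f) \<longleftrightarrow> Poly_Mapping.lookup f (k - m) \<noteq> 0" for k
    using assms(1) by (simp add: in_keys_iff lookup_single_times)
  have "Max (Poly_Mapping.keys (Poly_Mapping.single m s * f)) = M + m"
    by (rule Max_eqI) (use k assms(2,4) in force)+
  moreover have "Min (Poly_Mapping.keys (Poly_Mapping.single m s * f)) = N + m"
    by (rule Min_eqI) (use k assms(3,4) in force)+
  ultimately show ?thesis by simp
qed

text \<open>The hypotheses on \<open>L\<close> say that the extreme exponents are attained only by the all-A and the
  all-B state.\<close>

lemma bracket_extreme_exponents:
  fixes L :: "'c set \<Rightarrow> nat"
  assumes R: "finite R" and pos: "\<And>S. S \<subseteq> R \<Longrightarrow> L S \<ge> 1"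
    and A: "\<And>S. S \<subset> R \<Longrightarrow> L S + 1 \<le> L R + card (R - S)"
    and B: "\<And>S. S \<subseteq> R \<Longrightarrow> S \<noteq> {} \<Longrightarrow> L S + 1 \<le> L {} + card S"
  defines "f \<equiv> \<Sum>S\<in>Pow R. A_power (int (card S) - int (card (R - S))) * loop_value ^ (L S - 1)"
    and "M \<equiv> int (card R) + 2 * (int (L R) - 1)" and "N \<equiv> - int (card R) - 2 * (int (L {}) - 1)"
  shows "Poly_Mapping.lookup f M \<noteq> 0" "Poly_Mapping.lookup f N \<noteq> 0"
    and "Poly_Mapping.lookup f k \<noteq> 0 \<Longrightarrow> N \<le> k \<and> k \<le> M"
proof -
  define t where "t S k = Poly_Mapping.lookup (loop_value ^ (L S - 1)) (k - (int (card S) - int (card (R - S))))" for S k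
  have f: "Poly_Mapping.lookup f k = (\<Sum>S\<in>Pow R. t S k)" for k
    by (simp add: f_def t_def lookup_sum lookup_single_times)
  have c: "card (R - S) + card S = card R" if "S \<subseteq> R" for S
    using that R by (metis card_Diff_subset card_mono finite_subset le_add_diff_inverse2)
  \<comment> \<open>A state with n B-splices, n > 0, loses 2n in the exponent in front and gains at
    most 2(n - 1) from its loops, so it stays below \<open>M\<close>.\<close>
  have hi: "t S k = 0" if "S \<subset> R" "k \<ge> M" for S k
  proof -
    have "int (card (R - S)) + int (card S) = int (card R)" using c[of S] that by (simp add: psubset_imp_subset flip: of_nat_add)
    then show ?thesis unfolding t_def
      by (intro lookup_loop_value_power(1)) (use A[of S] pos[of S] that in \<open>auto simp: M_def\<close>)
  qed
  have lo: "t S k = 0" if "S \<subseteq> R" "S \<noteq> {}" "k \<le> N" for S k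
  proof -
    have "int (card (R - S)) + int (card S) = int (card R)" using c[of S] that by (simp add: psubset_imp_subset flip: of_nat_add)
    then show ?thesis unfolding t_def
      by (intro lookup_loop_value_power(1)) (use B[of S] pos[of S] that in \<open>auto simp: N_def\<close>)
  qed
  have fhi: "Poly_Mapping.lookup f k = t R k" if "k \<ge> M" for k
    unfolding f using R hi that by (subst sum.remove[of _ R]) (auto intro!: sum.neutral)
  have flo: "Poly_Mapping.lookup f k = t {} k" if "k \<le> N" for k
    unfolding f using R lo that by (subst sum.remove[of _ "{}"]) (auto intro!: sum.neutral)
  \<comment> \<open>The subtraction \<open>L R - 1\<close> of natural numbers is exact by
    \<open>pos\<close>.\<close>
  have eM: "M - (int (card R) - int (card (R - R))) = 2 * int (L R - 1)" using pos[of R] by (simp add: M_def of_nat_diff)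
  have eN: "N - (int (card {}) - int (card (R - {}))) = - (2 * int (L {} - 1))" using pos[of "{}"] by (simp add: N_def of_nat_diff)
  show "Poly_Mapping.lookup f M \<noteq> 0"
    unfolding fhi[OF order_refl] t_def eM lookup_loop_value_power(2) by simp
  show "Poly_Mapping.lookup f N \<noteq> 0"
    unfolding flo[OF order_refl] t_def eN lookup_loop_value_power(3) by simp
  have abs: "y < \<bar>x\<bar>" if "x > y \<or> x < - y" for x y :: int using that by arith
  have "Poly_Mapping.lookup f k = 0" if "k > M"
  proof -
    have "k - (int (card R) - int (card (R - R))) > M - (int (card R) - int (card (R - R)))"
      using that by simp
    then show ?thesis
      unfolding fhi[OF less_imp_le[OF that]] t_def eM by (intro lookup_loop_value_power(1) abs) blast
  qed
  moreover have "Poly_Mapping.lookup f k = 0" if "k < N"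
  proof -
    have "k - (int (card {}) - int (card (R - {}))) < N - (int (card {}) - int (card (R - {})))"
      using that by simp
    then show ?thesis
      unfolding flo[OF less_imp_le[OF that]] t_def eN by (intro lookup_loop_value_power(1) abs) blast
  qed
  ultimately show "N \<le> k \<and> k \<le> M" if "Poly_Mapping.lookup f k \<noteq> 0" using that by force
qed

section \<open>The half-edges of a diagram\<close>

text \<open>The next time on the real line, not reduced modulo 1, so that times remain comparable;
  \<open>nxt\<close> reduces it by \<open>frac\<close>.\<close>

definition pnext :: "real set \<Rightarrow> real \<Rightarrow> real" where
  "pnext T s = (LEAST u. s < u \<and> frac u \<in> T)"

lemma frac_add_of_int: "frac (x + of_int n) = frac (x :: real)"
  by (simp add: frac_def)

text \<open>The reals are not well ordered; this finiteness is why the minimum in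
  \<open>pnext\<close> exists.\<close>

lemma finite_frac_interval:
  assumes "finite T"
  shows "finite {u :: real. s < u \<and> u \<le> w \<and> frac u \<in> T}"
proof (rule finite_subset)
  show "{u. s < u \<and> u \<le> w \<and> frac u \<in> T} \<subseteq> (\<lambda>(t, n). t + of_int n) ` (T \<times> {\<lfloor>s\<rfloor>..\<lfloor>w\<rfloor>})"
  proof
    fix u assume "u \<in> {u. s < u \<and> u \<le> w \<and> frac u \<in> T}"
    moreover have "u = frac u + of_int \<lfloor>u\<rfloor>" by (simp add: frac_def)
    ultimately show "u \<in> (\<lambda>(t, n). t + of_int n) ` (T \<times> {\<lfloor>s\<rfloor>..\<lfloor>w\<rfloor>})"
      by (intro image_eqI[of _ _ "(frac u, \<lfloor>u\<rfloor>)"]) (auto simp: floor_mono)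
  qed
qed (use assms in simp)

lemma pnext_eqI:
  assumes "s < u" "frac u \<in> T" "\<And>w. s < w \<Longrightarrow> frac w \<in> T \<Longrightarrow> u \<le> w"
  shows "pnext T s = u"
  unfolding pnext_def by (rule Least_equality) (use assms in auto)

lemma pnext:
  assumes "finite T" "T \<noteq> {}" "T \<subseteq> {0..<1}"
  shows "s < pnext T s" "frac (pnext T s) \<in> T" "\<And>u. s < u \<Longrightarrow> frac u \<in> T \<Longrightarrow> pnext T s \<le> u"
proof -
  let ?A = "{u. s < u \<and> u \<le> s + 1 \<and> frac u \<in> T}"
  have fin: "finite ?A" using assms(1) by (rule finite_frac_interval)
  obtain t where t: "t \<in> T" using assms(2) by blast
  \<comment> \<open>The integer translate of \<open>t\<close> that lies in the period following
    \<open>s\<close>.\<close>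
  have "frac (t + of_int (\<lfloor>s - t\<rfloor> + 1)) = t"
    unfolding frac_add_of_int using t assms(3) by (intro frac_eq_id) auto
  moreover have "s < t + of_int (\<lfloor>s - t\<rfloor> + 1)" "t + of_int (\<lfloor>s - t\<rfloor> + 1) \<le> s + 1" by linarith+
  ultimately have "t + of_int (\<lfloor>s - t\<rfloor> + 1) \<in> ?A" using t by simp
  then have ne: "?A \<noteq> {}" by blast
  let ?m = "Min ?A"
  have m: "?m \<in> ?A" using fin ne by (rule Min_in)
  have le: "?m \<le> w" if "s < w" "frac w \<in> T" for w
  proof (cases "w \<le> s + 1")
    case True
    then show ?thesis using that fin by (intro Min_le) auto
  next
    case False
    then show ?thesis using m by auto
  qed
  have "pnext T s = ?m" by (rule pnext_eqI) (use m le in auto)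
  then show "s < pnext T s" "frac (pnext T s) \<in> T" "\<And>u. s < u \<Longrightarrow> frac u \<in> T \<Longrightarrow> pnext T s \<le> u"
    using m le by auto
qed

lemma pnext_add_int:
  assumes "finite T" "T \<noteq> {}" "T \<subseteq> {0..<1}"
  shows "pnext T (s + of_int n) = pnext T s + of_int n"
proof (rule pnext_eqI)
  fix w assume "s + of_int n < w" "frac w \<in> T"
  then have "pnext T s \<le> w + of_int (- n)"
    by (intro pnext(3)[OF assms]) (simp, simp only: frac_add_of_int)
  then show "pnext T s + of_int n \<le> w" by simp
qed (use pnext[OF assms] in \<open>simp_all add: frac_add_of_int\<close>)

lemma frac_pnext_frac:
  assumes "finite T" "T \<noteq> {}" "T \<subseteq> {0..<1}"
  shows "frac (pnext T (frac s)) = frac (pnext T s)"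
proof -
  have "frac s = s + of_int (- \<lfloor>s\<rfloor>)" by (simp add: frac_def)
  then show ?thesis using pnext_add_int[OF assms] frac_add_of_int by metis
qed

text \<open>Skipping a single removed point is enough for virtualizing, since two consecutive
  passages are never at the same crossing.\<close>

lemma pnext_remove:
  assumes T: "finite T" "T \<noteq> {}" "T \<subseteq> {0..<1}"
  shows "frac (pnext T s) \<notin> Q \<Longrightarrow> pnext (T - Q) s = pnext T s"
    and "frac (pnext T s) \<in> Q \<Longrightarrow> frac (pnext T (pnext T s)) \<notin> Q \<Longrightarrow> pnext (T - Q) s = pnext T (pnext T s)"
proof -
  show "pnext (T - Q) s = pnext T s" if "frac (pnext T s) \<notin> Q"
    by (rule pnext_eqI) (use pnext[OF T] that in auto)
  show "pnext (T - Q) s = pnext T (pnext T s)"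
    if Q: "frac (pnext T s) \<in> Q" "frac (pnext T (pnext T s)) \<notin> Q"
  proof (rule pnext_eqI)
    fix w assume w: "s < w" "frac w \<in> T - Q"
    then have "pnext T s \<le> w" by (intro pnext(3)[OF T]) auto
    moreover have "w \<noteq> pnext T s" using w Q by auto
    ultimately show "pnext T (pnext T s) \<le> w" using w by (intro pnext(3)[OF T]) auto
  next
    show "s < pnext T (pnext T s)" using pnext(1)[OF T] by (meson less_trans)
  qed (use pnext[OF T] Q in auto)
qed

text \<open>\<open>pnext\<close> is strictly increasing on the points over \<open>T\<close> and
  commutes with integer shifts, so values equal modulo 1 come from arguments equal modulo 1.\<close>

lemma inj_on_pnext:
  assumes T: "finite T" "T \<noteq> {}" "T \<subseteq> {0..<1}"
  shows "inj_on (\<lambda>t. frac (pnext T t)) T"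
proof (rule inj_onI)
  fix t t' assume t: "t \<in> T" "t' \<in> T" "frac (pnext T t) = frac (pnext T t')"
  have mono: "pnext T a < pnext T b" if "a < b" "frac b \<in> T" for a b
    using pnext(3)[OF T that] pnext(1)[OF T, of b] by simp
  define n where "n = \<lfloor>pnext T t'\<rfloor> - \<lfloor>pnext T t\<rfloor>"
  have "pnext T t' = pnext T t + of_int n" using t(3) by (simp add: frac_def n_def)
  then have eq: "pnext T t' = pnext T (t + of_int n)" by (simp add: pnext_add_int[OF T])
  have ft: "frac t = t" "frac t' = t'" using t T by (auto intro!: frac_eq_id)
  have "t' = t + of_int n"
    using mono[of t' "t + of_int n"] mono[of "t + of_int n" t'] eq ft t
    by (cases t' "t + of_int n" rule: linorder_cases) (auto simp: frac_add_of_int)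
  then show "t = t'" using ft frac_add_of_int by metis
qed

lemma pnext_connected:
  assumes T: "finite T" "T \<noteq> {}" "T \<subseteq> {0..<1}" and t: "t \<in> T" "t' \<in> T"
  shows "(t, t') \<in> conn (graph_of (\<lambda>t. frac (pnext T t)) T)"
proof -
  let ?R = "conn (graph_of (\<lambda>t. frac (pnext T t)) T)"
  \<comment> \<open>The induction is on the number of points over \<open>T\<close> after
    \<open>s\<close> and up to \<open>w\<close>.\<close>
  have *: "(frac s, frac w) \<in> ?R" if "s \<le> w" "frac s \<in> T" "frac w \<in> T" for s w
    using that
  proof (induction "card {u. s < u \<and> u \<le> w \<and> frac u \<in> T}" arbitrary: s rule: less_induct)
    case less
    show ?case
    proof (cases "s = w")
      case False
      then have "s < w" using less.prems by simp
      then have le: "pnext T s \<le> w" using less.prems by (intro pnext(3)[OF T])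
      note n = pnext(1,2)[OF T, of s]
      have "{u. pnext T s < u \<and> u \<le> w \<and> frac u \<in> T} \<subset> {u. s < u \<and> u \<le> w \<and> frac u \<in> T}"
        using n le by (auto simp: psubset_eq)
      then have "card {u. pnext T s < u \<and> u \<le> w \<and> frac u \<in> T} < card {u. s < u \<and> u \<le> w \<and> frac u \<in> T}"
        by (rule psubset_card_mono[OF finite_frac_interval[OF T(1)]])
      then have "(frac (pnext T s), frac w) \<in> ?R" using less.hyps n le less.prems by blast
      moreover have "(frac s, frac (pnext T s)) \<in> ?R"
        using conn_graph_of_step[OF less.prems(2), of "\<lambda>t. frac (pnext T t)"]
        by (simp only: frac_pnext_frac[OF T])
      ultimately show ?thesis using conn_trans by metis
    qed simp
  qed
  have ft: "frac t = t" "frac t' = t'" using t T by (auto intro!: frac_eq_id)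
  show ?thesis
  proof (cases "t \<le> t'")
    case True
    then show ?thesis using *[of t t'] t ft by simp
  next
    case False
    then show ?thesis using *[of t' t] t ft conn_sym by fastforce
  qed
qed

section \<open>Half-edges of a diagram and their rotation\<close>

lemma det2_simps [simp]:
  "det2 u u = 0" "det2 (- u) v = - det2 u v" "det2 u (- v) = - det2 u v"
  by (simp_all add: det2_def)

lemma det2_commute: "det2 u v = - det2 v u"
  by (simp add: det2_def)

locale link_diagram =
  fixes D :: vdiagram
  assumes vld: "virtual_link_diagram D"
begin

lemma gen: "generic_immersion D" and ncomp_pos: "ncomp D \<ge> 1" and reals_double: "reals D \<subseteq> double_points D"
  and over_passages: "over D \<subseteq> passages D" and over_unique: "r \<in> reals D \<Longrightarrow> \<exists>!x. x \<in> over D \<and> pt D x = r"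
  using vld by (auto simp: virtual_link_diagram_def)

lemma finite_reals: "finite (reals D)"
  using gen reals_double by (auto simp: generic_immersion_def intro: finite_subset)

lemma transversal: "x \<in> source D \<Longrightarrow> y \<in> source D \<Longrightarrow> x \<noteq> y \<Longrightarrow> pt D x = pt D y \<Longrightarrow>
    det2 (tangent D x) (tangent D y) \<noteq> 0"
  and no_triple: "x \<in> source D \<Longrightarrow> y \<in> source D \<Longrightarrow> z \<in> source D \<Longrightarrow> pt D x = pt D y \<Longrightarrow> pt D y = pt D z \<Longrightarrow>
    x = y \<or> y = z \<or> x = z"
  using gen unfolding generic_immersion_def by blast+

lemma passage_source: "x \<in> passages D \<Longrightarrow> x \<in> source D"
  and passage_reals: "x \<in> passages D \<Longrightarrow> pt D x \<in> reals D"
  by (auto simp: passages_def)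

text \<open>The passages are ordered by the sign of the determinant, which makes
  \<open>Out x\<close>, \<open>Out y\<close>, \<open>In x\<close>, \<open>In y\<close> the
  counterclockwise order.\<close>

lemma crossing_passages:
  assumes "r \<in> reals D"
  obtains x y where "x \<in> passages D" "y \<in> passages D" "pt D x = r" "pt D y = r" "x \<noteq> y"
    "0 < det2 (tangent D x) (tangent D y)" "{z \<in> passages D. pt D z = r} = {x, y}"
    "x \<in> over D \<longleftrightarrow> y \<notin> over D"
proof -
  obtain x y where xy: "x \<in> source D" "y \<in> source D" "x \<noteq> y" "pt D x = r" "pt D y = r"
    using subsetD[OF reals_double assms] unfolding double_points_def by blast
  have p: "x \<in> passages D" "y \<in> passages D" using xy assms by (auto simp: passages_def)
  have fib: "{z \<in> passages D. pt D z = r} = {x, y}"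
  proof (intro equalityI subsetI)
    fix z assume "z \<in> {z \<in> passages D. pt D z = r}"
    then show "z \<in> {x, y}" using no_triple[of x y z] xy passage_source by auto
  qed (use p xy in auto)
  have ov: "x \<in> over D \<longleftrightarrow> y \<notin> over D"
  proof -
    obtain z where z: "z \<in> over D" "pt D z = r" "\<And>w. w \<in> over D \<Longrightarrow> pt D w = r \<Longrightarrow> w = z"
      using over_unique[OF assms] by blast
    have "z \<in> {x, y}" using z over_passages fib by blast
    then show ?thesis using z(1) z(3)[of x] z(3)[of y] xy by auto
  qed
  show ?thesis
  proof (cases "0 < det2 (tangent D x) (tangent D y)")
    case True
    then show ?thesis using that p xy fib ov by blast
  next
    case False
    then have "0 < det2 (tangent D y) (tangent D x)"
      using transversal[of x y] xy det2_commute[of "tangent D x" "tangent D y"] by simp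
    moreover have "{z \<in> passages D. pt D z = r} = {y, x}" using fib by auto
    ultimately show ?thesis using that[of y x] p xy ov by blast
  qed
qed

lemma finite_passages: "finite (passages D)"
proof (rule finite_subset)
  show "passages D \<subseteq> (\<Union>r\<in>reals D. {z \<in> passages D. pt D z = r})" by (auto simp: passages_def)
  show "finite (\<Union>r\<in>reals D. {z \<in> passages D. pt D z = r})"
  proof (intro finite_UN_I finite_reals)
    fix r assume "r \<in> reals D"
    then show "finite {z \<in> passages D. pt D z = r}" by (rule crossing_passages) simp
  qed
qed

lemma finite_sites: "finite (sites D)"
proof (rule finite_subset)
  show "sites D \<subseteq> passages D \<union> (\<lambda>i. (i, 0)) ` {..<ncomp D}" by (auto simp: sites_def)
qed (use finite_passages in simp)

lemma sites_source: "sites D \<subseteq> source D"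
  by (auto simp: sites_def source_def passages_def)

lemma passage_site: "x \<in> passages D \<Longrightarrow> x \<in> sites D"
  by (simp add: sites_def)

definition times :: "nat \<Rightarrow> real set" where
  "times i = {t. (i, t) \<in> sites D}"

lemma finite_times: "finite (times i)"
proof (rule finite_subset)
  show "times i \<subseteq> snd ` sites D" unfolding times_def by force
qed (use finite_sites in simp)

lemma times_subset: "times i \<subseteq> {0..<1}"
  using sites_source by (auto simp: times_def source_def)

lemma times_nonempty: "i < ncomp D \<Longrightarrow> times i \<noteq> {}"
  by (cases "\<exists>t. (i, t) \<in> passages D") (auto simp: times_def sites_def)

lemma site_comp: "x \<in> sites D \<Longrightarrow> fst x < ncomp D"
  using sites_source by (auto simp: source_def)

lemma nxt_pnext: "nxt D x = (fst x, frac (pnext (times (fst x)) (snd x)))"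
  by (simp add: nxt_def pnext_def times_def)

lemma times_site: "x \<in> sites D \<longleftrightarrow> snd x \<in> times (fst x)"
  by (simp add: times_def)

lemmas times_facts = finite_times times_nonempty[OF site_comp] times_subset

lemma nxt_site: "x \<in> sites D \<Longrightarrow> nxt D x \<in> sites D"
  using pnext(2)[OF times_facts, of x "snd x"] by (simp add: nxt_pnext times_site)

lemma fst_nxt [simp]: "fst (nxt D x) = fst x"
  by (simp add: nxt_pnext)

lemma inj_nxt: "inj_on (nxt D) (sites D)"
proof (rule inj_onI)
  fix x y assume xy: "x \<in> sites D" "y \<in> sites D" "nxt D x = nxt D y"
  then have f: "fst x = fst y" by (metis fst_nxt)
  then have "frac (pnext (times (fst x)) (snd x)) = frac (pnext (times (fst x)) (snd y))"
    using xy(3) by (simp add: nxt_pnext)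
  then have "snd x = snd y"
    using inj_on_pnext[OF times_facts, OF xy(1)] xy f by (auto simp: times_site inj_on_def)
  then show "x = y" using f by (simp add: prod_eq_iff)
qed

lemma bij_nxt: "bij_betw (nxt D) (sites D) (sites D)"
  using inj_nxt finite_sites nxt_site by (simp add: bij_betw_def endo_inj_surj image_subsetI)

lemma nxt_connected:
  assumes "x \<in> sites D" "y \<in> sites D" "fst x = fst y"
  shows "(x, y) \<in> conn (graph_of (nxt D) (sites D))"
proof -
  let ?T = "times (fst x)"
  have "(snd x, snd y) \<in> conn (graph_of (\<lambda>t. frac (pnext ?T t)) ?T)"
    by (rule pnext_connected[OF times_facts, OF assms(1)]) (use assms in \<open>simp_all add: times_site\<close>)
  then have "(Pair (fst x) (snd x), Pair (fst x) (snd y)) \<in> conn (graph_of (nxt D) (sites D))"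
  proof (rule conn_map)
    fix u v assume "(u, v) \<in> graph_of (\<lambda>t. frac (pnext ?T t)) ?T"
    then have "(fst x, u) \<in> sites D" "(fst x, v) = nxt D (fst x, u)"
      by (auto simp: graph_of_def nxt_pnext times_def)
    then show "((fst x, u), (fst x, v)) \<in> conn (graph_of (nxt D) (sites D))"
      using conn_graph_of_step by metis
  qed
  then show ?thesis using assms(3) by (metis prod.collapse)
qed

lemma passage_same_comp:
  assumes "x \<in> passages D" "y \<in> sites D" "fst x = fst y"
  shows "y \<in> passages D"
  using assms by (cases x) (auto simp: sites_def)

lemma nxt_passage: "x \<in> passages D \<Longrightarrow> nxt D x \<in> passages D"
  by (rule passage_same_comp[of x]) (simp_all add: nxt_site passage_site)

text \<open>The base point is the only site of its circle, hence its own successor.\<close>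

lemma nxt_base: "x \<in> sites D \<Longrightarrow> x \<notin> passages D \<Longrightarrow> nxt D x = x"
proof -
  assume x: "x \<in> sites D" "x \<notin> passages D"
  have *: "y = (fst x, 0)" if "y \<in> sites D" "fst y = fst x" for y
    using that x passage_same_comp[of y x] by (auto simp: sites_def)
  show ?thesis using *[of x] *[of "nxt D x"] x nxt_site by simp
qed

lemma half_edge_iff [simp]: "Out x \<in> half_edges D \<longleftrightarrow> x \<in> sites D" "In x \<in> half_edges D \<longleftrightarrow> x \<in> sites D"
  by (auto simp: half_edges_def)

lemma half_edge_site: "h \<in> half_edges D \<longleftrightarrow> site h \<in> sites D"
  by (cases h) auto

lemma finite_half_edges: "finite (half_edges D)"
  using finite_sites by (simp add: half_edges_def)

lemma other_end_In: "x \<in> sites D \<Longrightarrow> other_end D (In (nxt D x)) = Out x"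
  using inj_nxt by simp

lemma In_nxt_cases:
  assumes "x \<in> sites D"
  obtains y where "y \<in> sites D" "x = nxt D y"
proof -
  have "x \<in> nxt D ` sites D" using assms bij_nxt by (simp add: bij_betw_def)
  then show ?thesis using that by blast
qed

lemma other_end_closed:
  assumes "h \<in> half_edges D"
  shows "other_end D h \<in> half_edges D" "other_end D (other_end D h) = h" "other_end D h \<noteq> h"
    "fst (site (other_end D h)) = fst (site h)"
proof -
  have "other_end D h \<in> half_edges D \<and> other_end D (other_end D h) = h \<and> other_end D h \<noteq> h \<and>
    fst (site (other_end D h)) = fst (site h)"
  proof (cases h)
    case (Out x)
    then show ?thesis using assms nxt_site inj_nxt by simp
  next
    case (In x)
    then have "x \<in> sites D" using assms by simp
    then obtain y where y: "y \<in> sites D" "x = nxt D y" by (rule In_nxt_cases)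
    then have "other_end D h = Out y" using In other_end_In by simp
    then show ?thesis using y In by simp
  qed
  then show "other_end D h \<in> half_edges D" "other_end D (other_end D h) = h" "other_end D h \<noteq> h"
    "fst (site (other_end D h)) = fst (site h)" by blast+
qed

lemma det2_direction_same_site: "site g = site h \<Longrightarrow> det2 (direction D h) (direction D g) = 0"
  by (cases g; cases h) simp_all

text \<open>This justifies the definite description in \<open>ccw\<close>: there is no third strand,
  the strand of \<open>h\<close> itself has determinant 0, and of the two ends of the other strand
  only one has positive determinant.\<close>

lemma ccw_eqI:
  assumes "site h \<in> passages D" "h' \<in> half_edges D" "pt D (site h') = pt D (site h)"
    "0 < det2 (direction D h) (direction D h')"
  shows "ccw D h = h'"
proof -
  have uniq: "g = h'" if g: "g \<in> half_edges D" "pt D (site g) = pt D (site h)"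
    "0 < det2 (direction D h) (direction D g)" for g
  proof -
    have src: "site h \<in> source D" "site g \<in> source D" "site h' \<in> source D"
      using assms g sites_source passage_source by (auto simp: half_edge_site)
    have ne: "site g \<noteq> site h" "site h' \<noteq> site h"
      using g(3) assms(4) det2_direction_same_site by (metis less_irrefl)+
    have "site g = site h'" using no_triple[OF src(2,1,3) g(2) assms(3)[symmetric]] ne by metis
    then show ?thesis using g(3) assms(4) by (cases h; cases g; cases h') auto
  qed
  have "(THE h'. h' \<in> half_edges D \<and> pt D (site h') = pt D (site h) \<and>
      0 < det2 (direction D h) (direction D h')) = h'"
    by (rule the_equality) (rule conjI[OF assms(2) conjI[OF assms(3,4)]], elim conjE, rule uniq)
  then show ?thesis using assms(1) by (simp add: ccw_def)
qed

lemma ccw_crossing: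
  assumes "x \<in> passages D" "y \<in> passages D" "pt D x = pt D y" "0 < det2 (tangent D x) (tangent D y)"
  shows "ccw D (Out x) = Out y" "ccw D (Out y) = In x" "ccw D (In x) = In y" "ccw D (In y) = Out x"
  by (rule ccw_eqI; use assms passage_site det2_commute[of "tangent D y" "tangent D x"] in simp)+

lemma ccw_base:
  assumes "x \<notin> passages D"
  shows "ccw D (Out x) = In x" "ccw D (In x) = Out x"
  using assms by (simp_all add: ccw_def)

definition crossing_darts :: "half_edge set" where
  "crossing_darts = {h \<in> half_edges D. site h \<in> passages D}"

text \<open>One of the two colours. At a base point the outgoing half-edge is chosen, so that
  rotation and edge switch the colour there as well.\<close>

definition under_darts :: "half_edge set" where
  "under_darts = {h. if site h \<in> passages D then site h \<notin> over D else h = Out (site h)}"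

lemma crossing_dart_cases:
  assumes "h \<in> crossing_darts"
  obtains x y where "x \<in> passages D" "y \<in> passages D" "pt D x = pt D y" "x \<noteq> y"
    "x \<in> over D \<longleftrightarrow> y \<notin> over D" "pt D (site h) = pt D x"
    "h \<in> {Out x, Out y, In x, In y}"
    "ccw D (Out x) = Out y" "ccw D (Out y) = In x" "ccw D (In x) = In y" "ccw D (In y) = Out x"
    "\<And>g. g \<in> crossing_darts \<Longrightarrow> pt D (site g) = pt D x \<Longrightarrow> g \<in> {Out x, Out y, In x, In y}"
proof -
  have h: "site h \<in> passages D" using assms by (simp add: crossing_darts_def)
  obtain x y where xy: "x \<in> passages D" "y \<in> passages D" "pt D x = pt D (site h)" "pt D y = pt D (site h)"
    "x \<noteq> y" "0 < det2 (tangent D x) (tangent D y)" "{z \<in> passages D. pt D z = pt D (site h)} = {x, y}"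
    "x \<in> over D \<longleftrightarrow> y \<notin> over D"
    by (rule crossing_passages[OF passage_reals[OF h]])
  have fib: "g \<in> {Out x, Out y, In x, In y}" if "g \<in> crossing_darts" "pt D (site g) = pt D x" for g
  proof -
    have "site g \<in> {x, y}" using that xy(3,7) by (auto simp: crossing_darts_def)
    then show ?thesis by (cases g) auto
  qed
  show ?thesis
    by (rule that[of x y]) (use xy fib assms ccw_crossing[of x y] in auto)
qed

lemma crossing_dart_ccw:
  assumes "h \<in> crossing_darts"
  shows "ccw D h \<in> crossing_darts \<and> ccw D (ccw D (ccw D (ccw D h))) = h \<and>
    pt D (site (ccw D h)) = pt D (site h) \<and> ccw D (ccw D h) \<noteq> h"
proof (rule crossing_dart_cases[OF assms])
  fix x y assume "x \<in> passages D" "y \<in> passages D" "pt D x = pt D y" "h \<in> {Out x, Out y, In x, In y}"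
    "ccw D (Out x) = Out y" "ccw D (Out y) = In x" "ccw D (In x) = In y" "ccw D (In y) = Out x"
  then show ?thesis
    by (elim insertE emptyE) (simp_all add: crossing_darts_def passage_site)
qed

lemma no_crossing_dart:
  assumes "h \<in> half_edges D - crossing_darts"
  shows "ccw D h \<in> half_edges D - crossing_darts" "ccw D (ccw D h) = h" "ccw D h \<noteq> h" "site (ccw D h) = site h"
  using assms by (cases h; auto simp: crossing_darts_def ccw_base)+

lemma ccw_half_edge: "h \<in> half_edges D \<Longrightarrow> ccw D h \<in> half_edges D"
proof (cases "h \<in> crossing_darts")
  case True
  then show ?thesis by (rule crossing_dart_cases) (auto simp: passage_site)
next
  case False
  then show "h \<in> half_edges D \<Longrightarrow> ccw D h \<in> half_edges D" using no_crossing_dart(1) by blast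
qed

lemma alternating_darts_half_edges:
  assumes alt: "alternating D" and prp: "proper D" and U: "U = under_darts \<or> U = - under_darts"
  shows "alternating_darts (half_edges D) (other_end D) (ccw D) crossing_darts U (\<lambda>h. pt D (site h))"
proof
  show "finite (half_edges D)" by (rule finite_half_edges)
  show "crossing_darts \<subseteq> half_edges D" by (auto simp: crossing_darts_def)
  fix h
  show "h \<in> half_edges D \<Longrightarrow> other_end D h \<in> half_edges D" "h \<in> half_edges D \<Longrightarrow> other_end D (other_end D h) = h"
    using other_end_closed by blast+
  show "ccw D h \<in> half_edges D - crossing_darts" "ccw D (ccw D h) = h" if "h \<in> half_edges D - crossing_darts"
    using no_crossing_dart[OF that] by blast+
  have colour: "ccw D h \<in> under_darts \<longleftrightarrow> h \<notin> under_darts" if "h \<in> half_edges D"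
  proof (cases "h \<in> crossing_darts")
    case True
    then show ?thesis by (rule crossing_dart_cases) (auto simp: under_darts_def)
  next
    case False
    then have "site h \<notin> passages D" using that by (simp add: crossing_darts_def)
    then show ?thesis by (cases h) (auto simp: under_darts_def ccw_base)
  qed
  then show "ccw D h \<in> U \<longleftrightarrow> h \<notin> U" if "h \<in> half_edges D" using U that by auto
  have nxt_colour: "nxt D x \<in> over D \<longleftrightarrow> x \<notin> over D" if "x \<in> passages D" for x
    using alt that by (simp add: alternating_def)
  have out: "In (nxt D x) \<in> under_darts \<longleftrightarrow> Out x \<notin> under_darts" if "x \<in> sites D" for x
  proof (cases "x \<in> passages D")
    case True
    then show ?thesis using nxt_passage nxt_colour by (simp add: under_darts_def)
  next
    case False
    then show ?thesis using nxt_base that by (simp add: under_darts_def)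
  qed
  have "other_end D h \<in> under_darts \<longleftrightarrow> h \<notin> under_darts" if "h \<in> half_edges D"
  proof (cases h)
    case (Out x)
    then show ?thesis using out that by simp
  next
    case (In x)
    then have "x \<in> sites D" using that by simp
    then obtain y where y: "y \<in> sites D" "x = nxt D y" by (rule In_nxt_cases)
    then have "other_end D h = Out y" using In other_end_In by simp
    then show ?thesis using In y out by simp
  qed
  then show "other_end D h \<in> U \<longleftrightarrow> h \<notin> U" if "h \<in> half_edges D" using U that by auto
  show "ccw D h \<in> crossing_darts" "ccw D (ccw D (ccw D (ccw D h))) = h" "pt D (site (ccw D h)) = pt D (site h)"
    "ccw D (ccw D h) \<noteq> h" if "h \<in> crossing_darts"
    using crossing_dart_ccw[OF that] by blast+
  fix g
  show "g \<in> {h, ccw D h, ccw D (ccw D h), ccw D (ccw D (ccw D h))}"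
    if "h \<in> crossing_darts" "g \<in> crossing_darts" "pt D (site h) = pt D (site g)"
  proof (rule crossing_dart_cases[OF that(1)])
    fix x y assume "ccw D (Out x) = Out y" "ccw D (Out y) = In x" "ccw D (In x) = In y" "ccw D (In y) = Out x"
      "h \<in> {Out x, Out y, In x, In y}" "pt D (site h) = pt D x"
      "\<And>g. g \<in> crossing_darts \<Longrightarrow> pt D (site g) = pt D x \<Longrightarrow> g \<in> {Out x, Out y, In x, In y}"
    moreover from this have "g \<in> {Out x, Out y, In x, In y}" using that by metis
    ultimately show ?thesis by (elim insertE emptyE) simp_all
  qed
  show "(h, g) \<notin> conn (graph_of (other_end D \<circ> ccw D) (half_edges D))"
    if "h \<in> crossing_darts" "g \<in> crossing_darts" "pt D (site h) = pt D (site g)" "h \<noteq> g"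
  proof -
    have "pt D (site h) \<in> reals D" using that passage_reals by (simp add: crossing_darts_def)
    then have "proper_crossing D (pt D (site h))" using prp by (simp add: proper_def)
    then have "\<not> same_boundary (ald D) h g"
      using that unfolding proper_crossing_def crossing_darts_def by auto
    then show ?thesis by (simp add: same_boundary_def conn_def ald_def)
  qed
qed

end

section \<open>Counting vertices, half-edges and components\<close>

context link_diagram
begin

text \<open>The bivalent base points. Each brings one vertex and one edge, so they cancel in the
  Euler characteristic.\<close>

definition noncrossing_sites :: "passage set" where
  "noncrossing_sites = sites D - passages D"

lemma over_reals: "bij_betw (pt D) (over D) (reals D)"
proof (rule bij_betw_imageI)
  show "inj_on (pt D) (over D)"
  proof (rule inj_onI)
    fix x y assume xy: "x \<in> over D" "y \<in> over D" "pt D x = pt D y"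
    have "x \<in> passages D" using xy(1) over_passages by blast
    then have "pt D x \<in> reals D" by (rule passage_reals)
    from over_unique[OF this] show "x = y" using xy by auto
  qed
  show "pt D ` over D = reals D"
  proof (intro equalityI subsetI)
    fix r assume "r \<in> reals D"
    from over_unique[OF this] show "r \<in> pt D ` over D" by blast
  next
    fix r assume "r \<in> pt D ` over D"
    then show "r \<in> reals D" using over_passages passage_reals by blast
  qed
qed

lemma card_over: "card (over D) = crossing_number D"
  using bij_betw_same_card[OF over_reals] by (simp add: crossing_number_def)

lemma card_under: "card (passages D - over D) = crossing_number D"
proof -
  have "bij_betw (pt D) (passages D - over D) (reals D)"
  proof (rule bij_betw_imageI)
    show "inj_on (pt D) (passages D - over D)"
    proof (rule inj_onI)
      fix a b assume ab: "a \<in> passages D - over D" "b \<in> passages D - over D" "pt D a = pt D b"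
      show "a = b"
      proof (rule crossing_passages[OF passage_reals, of a])
        fix x y assume "{z \<in> passages D. pt D z = pt D a} = {x, y}" "(x \<in> over D) = (y \<notin> over D)"
        moreover from this(1) have "a \<in> {x, y}" "b \<in> {x, y}" using ab by auto
        ultimately show ?thesis using ab by auto
      qed (use ab in auto)
    qed
    show "pt D ` (passages D - over D) = reals D"
    proof (intro equalityI subsetI)
      fix r assume "r \<in> reals D"
      then show "r \<in> pt D ` (passages D - over D)"
        by (rule crossing_passages) (metis Diff_iff image_eqI)
    qed (use passage_reals in auto)
  qed
  from bij_betw_same_card[OF this] show ?thesis by (simp add: crossing_number_def)
qed

lemma card_sites: "card (sites D) = 2 * crossing_number D + card noncrossing_sites"
proof -
  have "finite (over D)" using over_passages finite_passages by (rule finite_subset)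
  then have "card (over D \<union> (passages D - over D)) = card (over D) + card (passages D - over D)"
    using finite_passages by (intro card_Un_disjoint) auto
  moreover have "over D \<union> (passages D - over D) = passages D" using over_passages by blast
  moreover have "card (passages D \<union> noncrossing_sites) = card (passages D) + card noncrossing_sites"
    using finite_passages finite_sites by (intro card_Un_disjoint) (auto simp: noncrossing_sites_def)
  moreover have "passages D \<union> noncrossing_sites = sites D"
    using passage_site by (auto simp: noncrossing_sites_def)
  ultimately show ?thesis by (simp add: card_over card_under)
qed

lemma card_half_edges: "card (half_edges D) = 2 * card (sites D)"
proof -
  have "card (Out ` sites D \<union> In ` sites D) = card (Out ` sites D) + card (In ` sites D)"
    by (rule card_Un_disjoint) (use finite_sites in auto)
  then show ?thesis by (simp add: half_edges_def card_image inj_on_def)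
qed

lemma conn_ccw: "h \<in> half_edges D \<Longrightarrow> (h, ccw D h) \<in> conn (graph_of (ccw D) (half_edges D))"
  by (rule conn_graph_of_step)

text \<open>A vertex is represented by its over-passage, or by its base point if it is bivalent.\<close>

lemma cycles_ccw: "cycles (ccw D) (half_edges D) = crossing_number D + card noncrossing_sites"
proof -
  let ?C = "conn (graph_of (ccw D) (half_edges D))"
  have inv: "pt D (site h) = pt D (site g) \<and> (site h \<notin> passages D \<or> site g \<notin> passages D \<longrightarrow> site h = site g)"
    if "(h, g) \<in> ?C" for h g
    using that
  proof (induction rule: conn_induct)
    case (step g k)
    have *: "pt D (site (ccw D h)) = pt D (site h) \<and> (site (ccw D h) \<in> passages D \<longleftrightarrow> site h \<in> passages D) \<and>
      (site h \<notin> passages D \<longrightarrow> site (ccw D h) = site h)" if "h \<in> half_edges D" for h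
      using crossing_dart_ccw[of h] no_crossing_dart[of h] that
      by (cases "site h \<in> passages D") (auto simp: crossing_darts_def)
    from step(2) have "g \<in> half_edges D \<and> k = ccw D g \<or> k \<in> half_edges D \<and> g = ccw D k"
      by (auto simp: graph_of_def)
    then show ?case using *[of g] *[of k] step(3) by metis
  qed simp
  have "num_classes (over D \<union> noncrossing_sites) {} = cycles (ccw D) (half_edges D)"
  proof (rule num_classes_transfer[where f = Out])
    fix x assume "x \<in> over D \<union> noncrossing_sites"
    then have "x \<in> sites D" using subsetD[OF over_passages, of x] passage_site[of x] by (auto simp: noncrossing_sites_def)
    then show "Out x \<in> half_edges D" by simp
  next
    fix x y assume xy: "x \<in> over D \<union> noncrossing_sites" "y \<in> over D \<union> noncrossing_sites"
    have "x = y" if "(Out x, Out y) \<in> ?C"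
    proof (cases "x \<in> over D \<and> y \<in> over D")
      case True
      then show ?thesis using inv[OF that] over_reals by (auto simp: bij_betw_def inj_on_def)
    next
      case False
      then show ?thesis using inv[OF that] xy by (auto simp: noncrossing_sites_def)
    qed
    then show "(x, y) \<in> conn {} \<longleftrightarrow> (Out x, Out y) \<in> ?C" by (auto simp: conn_def)
  next
    fix h assume h: "h \<in> half_edges D"
    show "\<exists>x\<in>over D \<union> noncrossing_sites. (Out x, h) \<in> ?C"
    proof (cases "h \<in> crossing_darts")
      case True
      then show ?thesis
      proof (rule crossing_dart_cases)
        fix x y assume x: "x \<in> passages D" "y \<in> passages D" "h \<in> {Out x, Out y, In x, In y}" "x \<in> over D \<longleftrightarrow> y \<notin> over D"
          and c: "ccw D (Out x) = Out y" "ccw D (Out y) = In x" "ccw D (In x) = In y" "ccw D (In y) = Out x"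
        have 1: "(Out x, Out y) \<in> ?C" "(Out y, In x) \<in> ?C" "(In x, In y) \<in> ?C"
          using conn_ccw[of "Out x"] conn_ccw[of "Out y"] conn_ccw[of "In x"] c x passage_site by simp_all
        have "(Out x, h) \<in> ?C" using x(3) 1 conn_trans by (metis conn_refl insertE singletonD)
        moreover from this have "(Out y, h) \<in> ?C" using 1(1) conn_sym conn_trans by metis
        ultimately show ?thesis using x(4) by blast
      qed
    next
      case False
      then have s: "site h \<in> noncrossing_sites"
        using h by (simp add: crossing_darts_def noncrossing_sites_def half_edge_site)
      have "(Out (site h), h) \<in> ?C"
      proof (cases h)
        case (In z)
        then show ?thesis using conn_ccw[of "Out z"] s h ccw_base[of z] by (simp add: noncrossing_sites_def)
      qed simp
      then show ?thesis using s by blast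
    qed
  qed
  moreover have "card (over D \<union> noncrossing_sites) = crossing_number D + card noncrossing_sites"
    using over_passages finite_passages finite_sites
    by (subst card_Un_disjoint) (auto simp: noncrossing_sites_def card_over intro: finite_subset)
  ultimately show ?thesis by simp
qed

text \<open>The half-edges of one circle are connected by its edges and by going straight through
  its vertices, and the rotation links two circles exactly at a common real crossing.\<close>

lemma num_components_eq: "num_components D = surface_components (ald D)"
proof -
  let ?Q = "graph_of (ccw D) (half_edges D) \<union> graph_of (other_end D) (half_edges D)"
  have out_in: "(Out x, In x) \<in> conn ?Q" if "x \<in> sites D" for x
  proof -
    have s: "(h, ccw D h) \<in> conn ?Q" if "h \<in> half_edges D" for h
      using conn_mono[of "graph_of (ccw D) (half_edges D)" ?Q] conn_ccw[OF that] by blast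
    show ?thesis
    proof (cases "x \<in> passages D")
      case True
      then have "Out x \<in> crossing_darts" using that by (simp add: crossing_darts_def)
      then show ?thesis
      proof (rule crossing_dart_cases)
        fix a b assume a: "a \<in> passages D" "b \<in> passages D" "Out x \<in> {Out a, Out b, In a, In b}"
          "ccw D (Out a) = Out b" "ccw D (Out b) = In a" "ccw D (In a) = In b"
        have "(Out a, Out b) \<in> conn ?Q" "(Out b, In a) \<in> conn ?Q" "(In a, In b) \<in> conn ?Q"
          using s[of "Out a"] s[of "Out b"] s[of "In a"] a passage_site by simp_all
        then have "(Out a, In a) \<in> conn ?Q" "(Out b, In b) \<in> conn ?Q" using conn_trans by metis+
        then show ?thesis using a(3) by auto
      qed
    next
      case False
      then show ?thesis using s[of "Out x"] that ccw_base by simp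
    qed
  qed
  have out_site: "(Out (site h), h) \<in> conn ?Q" if "h \<in> half_edges D" for h
    using that out_in by (cases h) auto
  have same_comp: "(g, h) \<in> conn ?Q" if "g \<in> half_edges D" "h \<in> half_edges D" "fst (site g) = fst (site h)" for g h
  proof -
    have "(site g, site h) \<in> conn (graph_of (nxt D) (sites D))"
      using nxt_connected that by (simp add: half_edge_site)
    then have "(Out (site g), Out (site h)) \<in> conn ?Q"
    proof (rule conn_map)
      fix u v assume "(u, v) \<in> graph_of (nxt D) (sites D)"
      then have u: "u \<in> sites D" "v = nxt D u" by (auto simp: graph_of_def)
      then have "(Out u, In v) \<in> ?Q" by (auto simp: graph_of_def)
      then show "(Out u, Out v) \<in> conn ?Q" using out_in[of v] nxt_site u conn_base conn_sym conn_trans by metis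
    qed
    then show ?thesis using out_site that conn_sym conn_trans by metis
  qed
  have "num_classes (half_edges D) ?Q = num_classes {..<ncomp D} (meets D)"
  proof (rule num_classes_transfer[where f = "\<lambda>h. fst (site h)"])
    fix h assume "h \<in> half_edges D"
    then show "fst (site h) \<in> {..<ncomp D}" using site_comp by (simp add: half_edge_site)
  next
    fix i assume "i \<in> {..<ncomp D}"
    then obtain t where "t \<in> times i" using times_nonempty by blast
    then show "\<exists>h\<in>half_edges D. (fst (site h), i) \<in> conn (meets D)"
      by (intro bexI[of _ "Out (i, t)"]) (auto simp: times_def)
  next
    fix g h assume gh: "g \<in> half_edges D" "h \<in> half_edges D"
    show "(g, h) \<in> conn ?Q \<longleftrightarrow> (fst (site g), fst (site h)) \<in> conn (meets D)"
    proof
      assume "(g, h) \<in> conn ?Q"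
      then show "(fst (site g), fst (site h)) \<in> conn (meets D)"
      proof (rule conn_map)
        fix u v assume "(u, v) \<in> ?Q"
        then consider "u \<in> half_edges D" "v = ccw D u" | "u \<in> half_edges D" "v = other_end D u"
          by (auto simp: graph_of_def)
        then show "(fst (site u), fst (site v)) \<in> conn (meets D)"
        proof cases
          case 1
          show ?thesis
          proof (cases "u \<in> crossing_darts")
            case True
            have c: "site u \<in> passages D" "site v \<in> passages D" "pt D (site v) = pt D (site u)"
              using crossing_dart_ccw[OF True] 1 True by (auto simp: crossing_darts_def)
            then have "pt D (site u) \<in> range (curve D (fst (site u))) \<inter> range (curve D (fst (site v))) \<inter> reals D"
              using passage_reals by (auto simp: pt_def) (metis pt_def rangeI)
            then have "(fst (site u), fst (site v)) \<in> meets D"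
              using c passage_site site_comp by (auto simp: meets_def)
            then show ?thesis by (rule conn_base)
          next
            case False
            then show ?thesis using 1 no_crossing_dart(4)[of u] by simp
          qed
        next
          case 2
          then show ?thesis using other_end_closed(4)[of u] by simp
        qed
      qed
    next
      assume "(fst (site g), fst (site h)) \<in> conn (meets D)"
      moreover have "\<forall>h. h \<in> half_edges D \<and> fst (site h) = j \<longrightarrow> (g, h) \<in> conn ?Q"
        if "(fst (site g), j) \<in> conn (meets D)" for j
        using that
      proof (induction rule: conn_induct)
        case refl
        then show ?case using same_comp[OF gh(1)] by simp
      next
        case (step j k)
        then have "range (curve D j) \<inter> range (curve D k) \<inter> reals D \<noteq> {}" "j < ncomp D" "k < ncomp D"
          by (auto simp: meets_def)
        then obtain s t where st: "curve D j s = curve D k t" "curve D j s \<in> reals D" by blast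
        \<comment> \<open>\<open>meets\<close> refers to arbitrary real parameters, passages only to
          those in \<open>{0..<1}\<close>.\<close>
        have per: "curve D i (frac s) = curve D i s" if "i < ncomp D" for i s
        proof -
          have p: "curve D i (u + 1) = curve D i u" for u
            using gen that by (simp add: generic_immersion_def)
          have n: "curve D i (u + real n) = curve D i u" for u n
          proof (induction n)
            case (Suc n)
            have "u + real (Suc n) = (u + real n) + 1" by simp
            then show ?case using p Suc by metis
          qed simp
          have z: "curve D i (u + of_int m) = curve D i u" for u m
          proof (cases "m \<ge> 0")
            case True
            then show ?thesis using n[of u "nat m"] by simp
          next
            case False
            then show ?thesis using n[of "u + of_int m" "nat (- m)"] by simp
          qed
          show ?thesis using z[of "frac s" "\<lfloor>s\<rfloor>"] by (simp add: frac_def)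
        qed
        let ?x = "(j, frac s)" and ?y = "(k, frac t)"
        have p: "pt D ?x = curve D j s" "pt D ?y = curve D j s"
          using per \<open>j < ncomp D\<close> \<open>k < ncomp D\<close> st by (simp_all add: pt_def)
        then have xy: "?x \<in> passages D" "?y \<in> passages D"
          using st \<open>j < ncomp D\<close> \<open>k < ncomp D\<close> by (simp_all add: passages_def source_def frac_lt_1)
        have "(Out ?x, Out ?y) \<in> conn ?Q"
        proof -
          have "Out ?x \<in> crossing_darts" "Out ?y \<in> crossing_darts"
            using xy passage_site by (simp_all add: crossing_darts_def)
          show ?thesis
          proof (rule crossing_dart_cases[OF \<open>Out ?x \<in> crossing_darts\<close>])
            fix a b assume a: "a \<in> passages D" "b \<in> passages D" "Out ?x \<in> {Out a, Out b, In a, In b}"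
              "ccw D (Out a) = Out b" "pt D (site (Out ?x)) = pt D a"
              "\<And>g. g \<in> crossing_darts \<Longrightarrow> pt D (site g) = pt D a \<Longrightarrow> g \<in> {Out a, Out b, In a, In b}"
            have "Out ?y \<in> {Out a, Out b, In a, In b}"
              using a(5) a(6)[OF \<open>Out ?y \<in> crossing_darts\<close>] p by simp
            then have "?y = a \<or> ?y = b" by simp
            moreover have "?x = a \<or> ?x = b" using a(3) by simp
            moreover have "(Out a, ccw D (Out a)) \<in> ?Q" using a passage_site by (auto simp: graph_of_def)
            then have "(Out a, Out b) \<in> conn ?Q" using a(4) conn_base by metis
            ultimately show ?thesis using conn_sym conn_refl by metis
          qed
        qed
        moreover have "(g, Out ?x) \<in> conn ?Q" using step(3) xy passage_site by simp
        ultimately have gy: "(g, Out ?y) \<in> conn ?Q" using conn_trans by metis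
        show ?case
        proof (intro allI impI)
          fix h assume "h \<in> half_edges D \<and> fst (site h) = k"
          then have "(Out ?y, h) \<in> conn ?Q" using same_comp[of "Out ?y" h] xy passage_site by simp
          then show "(g, h) \<in> conn ?Q" using gy conn_trans by metis
        qed
      qed
      ultimately show "(g, h) \<in> conn ?Q" using gh by blast
    qed
  qed
  then show ?thesis by (simp add: num_components_def surface_components_def ald_def)
qed

end

section \<open>Virtualizing a crossing\<close>

lemma virtualize_simps [simp]:
  "ncomp (virtualize D p) = ncomp D" "curve (virtualize D p) = curve D"
  "reals (virtualize D p) = reals D - {p}" "over (virtualize D p) = {x \<in> over D. pt D x \<noteq> p}"
  by (simp_all add: virtualize_def)

lemma virtualize_geometry [simp]:
  "source (virtualize D p) = source D" "pt (virtualize D p) = pt D" "tangent (virtualize D p) = tangent D"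
  by (auto simp: source_def pt_def tangent_def fun_eq_iff)

lemma virtualize_generic [simp]:
  "double_points (virtualize D p) = double_points D" "generic_immersion (virtualize D p) = generic_immersion D"
  by (simp_all add: double_points_def generic_immersion_def)

lemma passages_virtualize [simp]: "passages (virtualize D p) = {x \<in> passages D. pt D x \<noteq> p}"
  by (auto simp: passages_def)

locale v_alternating_diagram = link_diagram D' for D' :: vdiagram +
  fixes p :: complex
  assumes proper_D': "proper D'" and alternating_D': "alternating D'" and p_reals: "p \<in> reals D'"
begin

abbreviation D :: vdiagram where "D \<equiv> virtualize D' p"

sublocale alt: alternating_darts "half_edges D'" "other_end D'" "ccw D'" crossing_darts under_darts "\<lambda>h. pt D' (site h)"
  by (rule alternating_darts_half_edges[OF alternating_D' proper_D']) simp

text \<open>With the complementary colour the \<open>A_arc\<close> of the locale is the B-splice, so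
  its bounds also hold for the all-B state.\<close>

sublocale alt': alternating_darts "half_edges D'" "other_end D'" "ccw D'" crossing_darts "- under_darts" "\<lambda>h. pt D' (site h)"
  by (rule alternating_darts_half_edges[OF alternating_D' proper_D']) simp

lemma vld_D: "virtual_link_diagram D"
proof -
  have "\<exists>!x. x \<in> over D \<and> pt D x = r" if "r \<in> reals D" for r
    using over_unique[of r] that by auto
  then show ?thesis
    using vld over_passages by (auto simp: virtual_link_diagram_def)
qed

sublocale virt: link_diagram D
  by (rule link_diagram.intro) (rule vld_D)

lemma crossings_image: "(\<lambda>h. pt D' (site h)) ` crossing_darts = reals D'"
proof (intro equalityI subsetI)
  fix r assume "r \<in> reals D'"
  then show "r \<in> (\<lambda>h. pt D' (site h)) ` crossing_darts"
  proof (rule crossing_passages)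
    fix x y assume "x \<in> passages D'" "pt D' x = r"
    then show ?thesis by (intro image_eqI[of _ _ "Out x"]) (simp_all add: crossing_darts_def passage_site)
  qed
qed (auto simp: crossing_darts_def intro: passage_reals)

lemma removed_iff:
  "h \<in> alt.removed p \<longleftrightarrow> h \<in> half_edges D' \<and> site h \<in> passages D' \<and> pt D' (site h) = p"
  unfolding alt.removed_def by (simp add: crossing_darts_def)

lemma nxt_not_p:
  assumes "x \<in> passages D'" "pt D' x = p"
  shows "nxt D' x \<in> passages D'" "pt D' (nxt D' x) \<noteq> p"
proof -
  show n: "nxt D' x \<in> passages D'" using assms by (simp add: nxt_passage)
  have "pt D' (site (other_end D' (Out x))) \<noteq> pt D' (site (Out x))"
    by (rule alt.no_loop_edge) (use assms n passage_site in \<open>simp_all add: crossing_darts_def\<close>)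
  then show "pt D' (nxt D' x) \<noteq> p" using assms by simp
qed

text \<open>No circle loses all its passages, because the one following a passage through
  \<open>p\<close> is elsewhere. Hence virtualizing creates no new base point.\<close>

lemma sites_D: "sites D = {x \<in> sites D'. \<not> (x \<in> passages D' \<and> pt D' x = p)}"
proof -
  have "(\<forall>t. (i, t) \<notin> passages D) \<longleftrightarrow> (\<forall>t. (i, t) \<notin> passages D')" for i
  proof
    assume none: "\<forall>t. (i, t) \<notin> passages D"
    show "\<forall>t. (i, t) \<notin> passages D'"
    proof (intro allI notI)
      fix t assume t: "(i, t) \<in> passages D'"
      then have "pt D' (i, t) = p" using none by auto
      then have "nxt D' (i, t) \<in> passages D" using nxt_not_p[OF t] by simp
      moreover have "nxt D' (i, t) = (i, snd (nxt D' (i, t)))" by (simp add: prod_eq_iff)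
      ultimately show False using none by metis
    qed
  qed auto
  then show ?thesis by (auto simp: sites_def)
qed

lemma half_edges_D: "half_edges D = half_edges D' - alt.removed p"
proof (rule set_eqI)
  fix h show "h \<in> half_edges D \<longleftrightarrow> h \<in> half_edges D' - alt.removed p"
    by (auto simp: virt.half_edge_site half_edge_site sites_D removed_iff)
qed

lemma nxt_D:
  assumes "x \<in> sites D"
  shows "nxt D x = (if nxt D' x \<in> passages D' \<and> pt D' (nxt D' x) = p then nxt D' (nxt D' x) else nxt D' x)"
proof -
  let ?i = "fst x"
  let ?T = "times ?i" and ?Q = "{t. (?i, t) \<in> passages D' \<and> pt D' (?i, t) = p}"
  have x: "x \<in> sites D'" using assms sites_D by simp
  note T = finite_times times_nonempty[OF site_comp[OF x]] times_subset
  have times_D: "virt.times ?i = ?T - ?Q"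
    by (auto simp: virt.times_def times_def sites_D)
  have n: "nxt D' x = (?i, frac (pnext ?T (snd x)))" by (rule nxt_pnext)
  have nn: "nxt D' (nxt D' x) = (?i, frac (pnext ?T (pnext ?T (snd x))))"
    unfolding n by (simp add: nxt_pnext frac_pnext_frac[OF T])
  show ?thesis
  proof (cases "nxt D' x \<in> passages D' \<and> pt D' (nxt D' x) = p")
    case True
    then have "frac (pnext ?T (snd x)) \<in> ?Q" "frac (pnext ?T (pnext ?T (snd x))) \<notin> ?Q"
      using nxt_not_p[of "nxt D' x"] n nn by auto
    then have "pnext (?T - ?Q) (snd x) = pnext ?T (pnext ?T (snd x))" by (rule pnext_remove(2)[OF T])
    then show ?thesis using True nn by (simp add: virt.nxt_pnext times_D)
  next
    case False
    then have "frac (pnext ?T (snd x)) \<notin> ?Q" using n by auto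
    then have "pnext (?T - ?Q) (snd x) = pnext ?T (snd x)" by (rule pnext_remove(1)[OF T])
    then show ?thesis using False n by (simp only: virt.nxt_pnext times_D if_False)
  qed
qed

lemma ccw2_In: "x \<in> passages D' \<Longrightarrow> ccw D' (ccw D' (In x)) = Out x"
  "x \<in> passages D' \<Longrightarrow> ccw D' (ccw D' (Out x)) = In x"
proof -
  assume x: "x \<in> passages D'"
  then have "Out x \<in> crossing_darts" using passage_site by (simp add: crossing_darts_def)
  then have "ccw D' (ccw D' (In x)) = Out x \<and> ccw D' (ccw D' (Out x)) = In x"
    by (rule crossing_dart_cases) auto
  then show "ccw D' (ccw D' (In x)) = Out x" "ccw D' (ccw D' (Out x)) = In x" by blast+
qed

lemma through_Out:
  assumes "x \<in> sites D"
  shows "alt.through_edge p (Out x) = In (nxt D x)"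
proof -
  have x: "x \<in> sites D'" using assms sites_D by simp
  have "In (nxt D' x) \<in> alt.removed p \<longleftrightarrow> nxt D' x \<in> passages D' \<and> pt D' (nxt D' x) = p"
    using nxt_site[OF x] by (auto simp: removed_iff)
  then show ?thesis using nxt_D[OF assms] by (simp add: alt.through_edge_def ccw2_In)
qed

lemma through_through:
  assumes "h \<in> half_edges D"
  shows "alt.through_edge p (alt.through_edge p h) = h"
proof -
  have h: "h \<in> half_edges D'" "h \<notin> alt.removed p" using assms half_edges_D by auto
  have ee: "other_end D' (other_end D' h) = h" by (rule alt.e_e[OF h(1)])
  show ?thesis
  proof (cases "other_end D' h \<in> alt.removed p")
    case True
    let ?g = "ccw D' (ccw D' (other_end D' h))"
    note r = alt.removed_step[OF True]
    have "other_end D' (other_end D' ?g) = ?g" using alt.e_e r(2) alt.removed_V by blast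
    then show ?thesis using True r(2,4) ee by (simp add: alt.through_edge_def)
  qed (use h ee in \<open>simp add: alt.through_edge_def\<close>)
qed

lemma other_end_D:
  assumes "h \<in> half_edges D"
  shows "other_end D h = alt.through_edge p h"
proof (cases h)
  case (Out x)
  then show ?thesis using assms through_Out by simp
next
  case (In x)
  then have "x \<in> sites D" using assms by simp
  then obtain y where y: "y \<in> sites D" "x = nxt D y" by (rule virt.In_nxt_cases)
  then have "other_end D h = Out y" using In virt.other_end_In by simp
  \<comment> \<open>The inverse of \<open>nxt D\<close> need not be computed, since
    \<open>through_edge\<close> is an involution.\<close>
  moreover have "alt.through_edge p h = Out y"
    using through_through[of "Out y"] through_Out[OF y(1)] y In by simp
  ultimately show ?thesis by simp
qed

lemma crossing_darts_D: "virt.crossing_darts = crossing_darts - alt.removed p"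
proof (rule set_eqI)
  fix h show "h \<in> virt.crossing_darts \<longleftrightarrow> h \<in> crossing_darts - alt.removed p"
    using removed_iff[of h] half_edges_D
    unfolding virt.crossing_darts_def crossing_darts_def passages_virtualize by blast
qed

lemma ccw_D:
  assumes "h \<in> half_edges D"
  shows "ccw D h = ccw D' h"
proof (cases "h \<in> virt.crossing_darts")
  case True
  then have s: "site h \<in> passages D'" "pt D' (site h) \<noteq> p" by (auto simp: virt.crossing_darts_def)
  obtain x y where xy: "x \<in> passages D'" "y \<in> passages D'" "pt D' x = pt D' (site h)" "pt D' y = pt D' (site h)"
    "0 < det2 (tangent D' x) (tangent D' y)" "{z \<in> passages D'. pt D' z = pt D' (site h)} = {x, y}"
    by (rule crossing_passages[OF passage_reals[OF s(1)]]) blast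
  have "site h \<in> {x, y}" using s xy(6) by blast
  then have "h \<in> {Out x, Out y, In x, In y}" by (cases h) auto
  moreover have "pt D' x = pt D' y" using xy(3,4) by simp
  note ccw_crossing[OF xy(1,2) this xy(5)]
  moreover have "x \<in> passages D" "y \<in> passages D" "pt D x = pt D y" "0 < det2 (tangent D x) (tangent D y)"
    using xy(1-5) s(2) by simp_all
  note virt.ccw_crossing[OF this]
  ultimately show ?thesis by (elim insertE emptyE) (simp_all only:)
next
  case False
  then have "site h \<notin> passages D" using assms by (simp add: virt.crossing_darts_def)
  moreover have "site h \<in> sites D" using assms virt.half_edge_site by blast
  ultimately have "site h \<notin> passages D'" "site h \<notin> passages D" using sites_D by auto
  then show ?thesis unfolding ccw_def by simp
qed

lemma under_darts_D: "h \<in> virt.crossing_darts \<Longrightarrow> h \<in> under_darts \<longleftrightarrow> site h \<notin> over D"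
  by (auto simp: virt.crossing_darts_def under_darts_def)

lemma loops_D:
  assumes S: "S \<subseteq> reals D"
  shows "loops D S = num_classes (half_edges D' - alt.removed p)
      (graph_of (alt.through_edge p) (half_edges D' - alt.removed p) \<union>
       {(h, ccw D' h) | h. h \<in> half_edges D' - alt.removed p \<and>
         (h \<in> crossing_darts \<longrightarrow> (h \<in> under_darts \<longleftrightarrow> pt D' (site h) \<in> S))})"
proof -
  have "graph_of (other_end D) (half_edges D) = graph_of (alt.through_edge p) (half_edges D)"
    by (rule graph_of_cong) (rule other_end_D)
  moreover have "splice_arcs D S = {(h, ccw D' h) | h. h \<in> half_edges D \<and>
         (h \<in> crossing_darts \<longrightarrow> (h \<in> under_darts \<longleftrightarrow> pt D' (site h) \<in> S))}"
  proof -
    have "(site h \<in> passages D \<longrightarrow> (site h \<notin> over D \<longleftrightarrow> pt D (site h) \<in> S)) \<longleftrightarrow>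
        (h \<in> crossing_darts \<longrightarrow> (h \<in> under_darts \<longleftrightarrow> pt D' (site h) \<in> S))" if "h \<in> half_edges D" for h
      using that under_darts_D[of h] crossing_darts_D half_edges_D
      by (auto simp: virt.crossing_darts_def)
    then show ?thesis unfolding splice_arcs_def using ccw_D by (metis (no_types, lifting))
  qed
  ultimately show ?thesis by (simp add: loops_def half_edges_D)
qed

abbreviation state :: "complex set \<Rightarrow> complex \<Rightarrow> smoothing" where
  "state T q \<equiv> if q = p then Crossed else if q \<in> T then B_arc else A_arc"

text \<open>\<open>T\<close> collects the B-splices, whereas \<open>loops\<close> takes the set of
  A-splices; hence the complement.\<close>

lemma loops_A_state:
  assumes T: "T \<subseteq> reals D"
  shows "loops D (reals D - T) = alt.num_loops (state T)"
proof -
  have "pt D' (site h) \<in> reals D - T \<longleftrightarrow> pt D' (site h) \<notin> T" if "h \<in> half_edges D' - alt.removed p" "h \<in> crossing_darts" for h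
  proof -
    have "site h \<in> passages D'" "pt D' (site h) \<noteq> p"
      using that removed_iff[of h] by (simp_all add: crossing_darts_def)
    then show ?thesis using passage_reals by simp
  qed
  then have "{(h, ccw D' h) | h. h \<in> half_edges D' - alt.removed p \<and>
      (h \<in> crossing_darts \<longrightarrow> (h \<in> under_darts \<longleftrightarrow> pt D' (site h) \<in> reals D - T))} =
    {(h, ccw D' h) | h. h \<in> half_edges D' - alt.removed p \<and>
      (h \<in> crossing_darts \<longrightarrow> (h \<in> under_darts \<longleftrightarrow> pt D' (site h) \<notin> T))}" by blast
  then show ?thesis
    using loops_D[of "reals D - T"] alt.num_loops_removed[of "state T" p T] by simp
qed

text \<open>In \<open>alt'\<close> the splices are exchanged, so here \<open>T\<close> collects the
  A-splices and no complement is taken.\<close>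

lemma loops_B_state:
  assumes T: "T \<subseteq> reals D"
  shows "loops D T = alt'.num_loops (state T)"
proof -
  have r: "alt'.removed p = alt.removed p" "alt'.through_edge p = alt.through_edge p"
    by (auto simp: alt.removed_def alt'.removed_def fun_eq_iff alt.through_edge_def alt'.through_edge_def)
  have eq: "(h \<in> under_darts \<longleftrightarrow> pt D' (site h) \<in> T) \<longleftrightarrow> (h \<in> - under_darts \<longleftrightarrow> pt D' (site h) \<notin> T)" for h
    by auto
  show ?thesis
    unfolding loops_D[OF T] eq by (rule alt'.num_loops_removed[unfolded r]) simp_all
qed

lemma state_empty: "state {} = (\<lambda>_. A_arc)(p := Crossed)"
  by auto

lemma loops_A_bound:
  assumes "S \<subset> reals D"
  shows "loops D S + 1 \<le> loops D (reals D) + card (reals D - S)"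
proof -
  let ?T = "reals D - S"
  have "?T \<noteq> {}" "?T \<subseteq> reals D" "finite ?T" using assms virt.finite_reals by auto
  then have "alt.num_loops (state ?T) + 1 \<le> alt.num_loops (state {}) + card ?T"
    unfolding state_empty by (intro alt.num_loops_bound) (use p_reals crossings_image in auto)
  moreover have "reals D - ?T = S" using assms by blast
  ultimately show ?thesis
    using loops_A_state[of ?T] loops_A_state[of "{}"] by simp
qed

lemma loops_B_bound:
  assumes "S \<subseteq> reals D" "S \<noteq> {}"
  shows "loops D S + 1 \<le> loops D {} + card S"
proof -
  have "finite S" using assms virt.finite_reals finite_subset by blast
  then have "alt'.num_loops (state S) + 1 \<le> alt'.num_loops (state {}) + card S"
    unfolding state_empty by (intro alt'.num_loops_bound) (use assms p_reals crossings_image in auto)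
  then show ?thesis
    using loops_B_state[OF assms(1)] loops_B_state[of "{}"] by simp
qed

lemma loops_pos: "loops D S \<ge> 1"
proof -
  obtain t where "t \<in> virt.times 0" using virt.times_nonempty[of 0] virt.ncomp_pos by auto
  then have "Out (0, t) \<in> half_edges D" by (simp add: virt.times_def)
  then have "half_edges D \<noteq> {}" by blast
  then show ?thesis
    using num_classes_pos[OF virt.finite_half_edges] unfolding loops_def by (simp add: Suc_le_eq)
qed

text \<open>With F and F' the numbers of faces of \<open>D\<close> and \<open>D'\<close>, this
  combines F' = (L_A + 1) + (L_B + 1) and F' = F + 3.\<close>

lemma faces_D: "loops D (reals D) + loops D {} = cycles (other_end D \<circ> ccw D) (half_edges D) + 1"
proof -
  have p: "p \<in> (\<lambda>h. pt D' (site h)) ` crossing_darts" using p_reals crossings_image by simp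
  have "loops D (reals D) + 1 = cycles (other_end D' \<circ> ccw D') (half_edges D' \<inter> under_darts)"
    using alt.num_loops_cross[OF p] loops_A_state[of "{}"] by (simp add: state_empty)
  moreover have "loops D {} + 1 = cycles (other_end D' \<circ> ccw D') (half_edges D' - under_darts)"
    using alt'.num_loops_cross[OF p] loops_B_state[of "{}"] by (simp add: state_empty Diff_eq)
  moreover have "graph_of (other_end D \<circ> ccw D) (half_edges D) = graph_of (alt.through_edge p \<circ> ccw D') (half_edges D)"
    by (rule graph_of_cong) (use ccw_D virt.ccw_half_edge other_end_D in \<open>simp add: comp_def; metis\<close>)
  then have "cycles (other_end D \<circ> ccw D) (half_edges D) + 3 = cycles (other_end D' \<circ> ccw D') (half_edges D')"
    using alt.cycles_crossing_rot[OF p] alt.cycles_removed[of p] by (simp add: half_edges_D)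
  ultimately show ?thesis using alt.cycles_face_split by simp
qed

end

section \<open>Supporting genus and span\<close>

text \<open>The edge involution has no fixed points, so the number of darts is twice the number of
  edges, and the defect becomes twice the genus.\<close>

lemma ribbon_euler_char:
  assumes "ribbon_graph M"
  shows "euler_char M = 2 * int (surface_components M) - defect (darts M) (edge M) (rot M)"
proof -
  have "card (darts M) = 2 * cycles (edge M) (darts M)"
    by (rule cycles_involution) (use assms in \<open>auto simp: ribbon_graph_def\<close>)
  then show ?thesis
    by (simp add: euler_char_def surface_components_def defect_def Un_commute)
qed

lemma ribbon_bij_edge: "ribbon_graph M \<Longrightarrow> bij_betw (edge M) (darts M) (darts M)"
  by (rule bij_betwI[of _ _ _ "edge M"]) (auto simp: ribbon_graph_def)

context link_diagram
begin

lemma bij_other_end: "bij_betw (other_end D) (half_edges D) (half_edges D)"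
  by (rule bij_betwI[of _ _ _ "other_end D"]) (auto simp: other_end_closed)

lemma inj_ccw: "inj_on (ccw D) (half_edges D)"
proof (rule inj_onI)
  fix g h assume gh: "g \<in> half_edges D" "h \<in> half_edges D" "ccw D g = ccw D h"
  have mem: "ccw D k \<in> crossing_darts \<longleftrightarrow> k \<in> crossing_darts" if "k \<in> half_edges D" for k
    using crossing_dart_ccw[of k] no_crossing_dart(1)[of k] that by blast
  show "g = h"
  proof (cases "g \<in> crossing_darts")
    case True
    then have "h \<in> crossing_darts" using mem gh by metis
    then show ?thesis using crossing_dart_ccw True gh(3) by metis
  next
    case False
    then have "h \<notin> crossing_darts" using mem gh by metis
    then show ?thesis using no_crossing_dart(2) False gh by (metis DiffI)
  qed
qed

lemma bij_ccw: "bij_betw (ccw D) (half_edges D) (half_edges D)"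
  using inj_ccw ccw_half_edge finite_half_edges by (simp add: bij_betw_def endo_inj_surj image_subsetI)

text \<open>By \<open>realized_by\<close> the rotation of the diagram is the first return of the
  rotation of \<open>M\<close> to the image of the half-edges, so the monotonicity
  \<open>defect_first_return\<close> applies.\<close>

lemma realized_defect:
  assumes M: "ribbon_graph M" and e: "realized_by D M e"
  shows "defect (half_edges D) (other_end D) (ccw D) \<le> defect (darts M) (edge M) (rot M)"
proof -
  let ?W = "e ` half_edges D"
  let ?i = "inv_into (half_edges D) e"
  have inj: "inj_on e (half_edges D)" and sub: "?W \<subseteq> darts M"
    and ed: "\<And>h. h \<in> half_edges D \<Longrightarrow> edge M (e h) = e (other_end D h)"
    and ro: "\<And>h. h \<in> half_edges D \<Longrightarrow> \<exists>k>0. (rot M ^^ k) (e h) = e (ccw D h) \<and>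
        (\<forall>j. 0 < j \<and> j < k \<longrightarrow> (rot M ^^ j) (e h) \<notin> ?W)"
    using e by (auto simp: realized_by_def)
  have "defect ?W (edge M) (e \<circ> ccw D \<circ> ?i) \<le> defect (darts M) (edge M) (rot M) \<and>
    even (defect (darts M) (edge M) (rot M) - defect ?W (edge M) (e \<circ> ccw D \<circ> ?i))"
  proof (rule defect_first_return[OF _ sub ribbon_bij_edge[OF M]])
    show "finite (darts M)" "bij_betw (rot M) (darts M) (darts M)" using M by (auto simp: ribbon_graph_def)
    fix x assume "x \<in> ?W"
    then obtain h where h: "h \<in> half_edges D" "x = e h" by blast
    show "first_return ?W (edge M) x (edge M x)"
      by (rule first_return.now) (use h ed other_end_closed(1) in auto)
    have "(e \<circ> ccw D \<circ> ?i) x = e (ccw D h)" using h inj by simp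
    moreover obtain k where "k > 0" "(rot M ^^ k) (e h) = e (ccw D h)"
      "\<And>j. 0 < j \<Longrightarrow> j < k \<Longrightarrow> (rot M ^^ j) (e h) \<notin> ?W"
      using ro[OF h(1)] by blast
    ultimately show "first_return ?W (rot M) x ((e \<circ> ccw D \<circ> ?i) x)"
      using first_return_funpow[of k "rot M" x "e (ccw D h)" ?W] h ccw_half_edge by auto
  qed
  moreover have "defect ?W (edge M) (e \<circ> ccw D \<circ> ?i) = defect (half_edges D) (other_end D) (ccw D)"
    by (rule defect_image[OF inj]) (use ed other_end_closed(1) ccw_half_edge inj in auto)
  ultimately show ?thesis by simp
qed

text \<open>The minimum in \<open>supporting_genus\<close> ranges over ribbon graphs on natural
  numbers, so the surface of the diagram is relabelled.\<close>

lemma realized_nat: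
  obtains M :: "nat ribbon" and e where "ribbon_graph M" "realized_by D M e"
    "defect (darts M) (edge M) (rot M) = defect (half_edges D) (other_end D) (ccw D)"
proof -
  obtain e :: "half_edge \<Rightarrow> nat" where inj: "inj_on e (half_edges D)"
    using finite_imp_inj_to_nat_seg[OF finite_half_edges] by blast
  let ?i = "inv_into (half_edges D) e"
  define M where "M = \<lparr>darts = e ` half_edges D, edge = e \<circ> other_end D \<circ> ?i, rot = e \<circ> ccw D \<circ> ?i\<rparr>"
  have i: "edge M (e h) = e (other_end D h)" "rot M (e h) = e (ccw D h)" if "h \<in> half_edges D" for h
    using that inj by (simp_all add: M_def)
  have dM: "darts M = e ` half_edges D" by (simp add: M_def)
  have ne: "e (other_end D h) \<noteq> e h" if "h \<in> half_edges D" for h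
    using inj_onD[OF inj] other_end_closed(1,3)[OF that] that by blast
  have "inj_on (rot M) (darts M)"
  proof (rule inj_onI)
    fix x y assume "x \<in> darts M" "y \<in> darts M" "rot M x = rot M y"
    then obtain g h where gh: "g \<in> half_edges D" "h \<in> half_edges D" "x = e g" "y = e h" "e (ccw D g) = e (ccw D h)"
      using i dM by auto
    then have "ccw D g = ccw D h" using inj_onD[OF inj] ccw_half_edge by blast
    then have "g = h" using inj_onD[OF inj_ccw] gh by blast
    then show "x = y" using gh by simp
  qed
  moreover have "rot M ` darts M \<subseteq> darts M" using i ccw_half_edge by (auto simp: dM)
  moreover have "finite (darts M)" using finite_half_edges by (simp add: dM)
  ultimately have "bij_betw (rot M) (darts M) (darts M)" by (simp add: bij_betw_def endo_inj_surj)
  then have "ribbon_graph M"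
    using \<open>finite (darts M)\<close> i ne other_end_closed(1,2) by (auto simp: ribbon_graph_def dM)
  moreover have "realized_by D M e"
  proof -
    have "\<exists>k>0. (rot M ^^ k) (e h) = e (ccw D h) \<and> (\<forall>j. 0 < j \<and> j < k \<longrightarrow> (rot M ^^ j) (e h) \<notin> e ` half_edges D)"
      if "h \<in> half_edges D" for h
      by (rule exI[of _ 1]) (use i that in auto)
    then show ?thesis using inj i by (auto simp: realized_by_def dM)
  qed
  moreover have "defect (darts M) (edge M) (rot M) = defect (half_edges D) (other_end D) (ccw D)"
    unfolding dM by (rule defect_image[OF inj]) (use i other_end_closed(1) ccw_half_edge in auto)
  ultimately show ?thesis by (rule that)
qed

text \<open>The surface of the diagram attains the minimum; \<open>defect_nonneg_even\<close> makes
  half of its defect a natural number.\<close>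

lemma supporting_genus_defect:
  "2 * int (supporting_genus D) = defect (half_edges D) (other_end D) (ccw D)"
proof -
  let ?d = "defect (half_edges D) (other_end D) (ccw D)"
  have "?d \<ge> 0 \<and> even ?d"
    by (rule defect_nonneg_even[OF finite_half_edges bij_other_end bij_ccw])
  then have d: "2 * int (nat (?d div 2)) = ?d" by auto
  have hg: "has_genus M g \<longleftrightarrow> defect (darts M) (edge M) (rot M) = 2 * int g" if "ribbon_graph M" for M :: "nat ribbon" and g
    unfolding has_genus_def ribbon_euler_char[OF that] by auto
  have "supporting_genus D = nat (?d div 2)"
    unfolding supporting_genus_def
  proof (rule Least_equality)
    obtain M :: "nat ribbon" and e where "ribbon_graph M" "realized_by D M e" "defect (darts M) (edge M) (rot M) = ?d"
      by (rule realized_nat)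
    then show "\<exists>(M :: nat ribbon) e. ribbon_graph M \<and> realized_by D M e \<and> has_genus M (nat (?d div 2))"
      using hg d by auto
  next
    fix g assume "\<exists>(M :: nat ribbon) e. ribbon_graph M \<and> realized_by D M e \<and> has_genus M g"
    then obtain M :: "nat ribbon" and e where "ribbon_graph M" "realized_by D M e" "has_genus M g" by blast
    then have "?d \<le> 2 * int g" using realized_defect hg by metis
    then show "nat (?d div 2) \<le> g" by linarith
  qed
  then show ?thesis using d by simp
qed

text \<open>With n base points there are 4c + 2n half-edges, 2c + n edges and c + n vertices, so n
  cancels.\<close>

lemma num_faces:
  "int (cycles (other_end D \<circ> ccw D) (half_edges D)) =
     int (crossing_number D) + 2 * int (num_components D) - 2 * int (supporting_genus D)"
proof -
  have "card (half_edges D) = 2 * cycles (other_end D) (half_edges D)"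
    by (rule cycles_involution[OF finite_half_edges]) (use other_end_closed in blast)
  then have "cycles (other_end D) (half_edges D) = 2 * crossing_number D + card noncrossing_sites"
    using card_half_edges card_sites by simp
  moreover have "num_components D = num_classes (half_edges D) (graph_of (other_end D) (half_edges D) \<union> graph_of (ccw D) (half_edges D))"
    by (simp add: num_components_eq surface_components_def ald_def Un_commute)
  ultimately show ?thesis
    using supporting_genus_defect card_half_edges card_sites cycles_ccw by (simp add: defect_def)
qed

end

section \<open>The span of a v-alternating diagram\<close>

context v_alternating_diagram
begin

lemma span_D: "diagram_span D = 4 * (int (crossing_number D) - int (supporting_genus D) + int (num_components D) - 1) + 2"
proof -
  let ?M = "int (card (reals D)) + 2 * (int (loops D (reals D)) - 1)"
  let ?N = "- int (card (reals D)) - 2 * (int (loops D {}) - 1)"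
  have L: "finite (reals D)" "\<And>S. S \<subseteq> reals D \<Longrightarrow> loops D S \<ge> 1"
    "\<And>S. S \<subset> reals D \<Longrightarrow> loops D S + 1 \<le> loops D (reals D) + card (reals D - S)"
    "\<And>S. S \<subseteq> reals D \<Longrightarrow> S \<noteq> {} \<Longrightarrow> loops D S + 1 \<le> loops D {} + card S"
    using virt.finite_reals loops_pos loops_A_bound loops_B_bound by blast+
  note ext = bracket_extreme_exponents[OF L, folded bracket_def]
  obtain m s where ms: "s \<noteq> 0" "minus_A_cubed_power (- writhe D) = Poly_Mapping.single m s"
    using minus_A_cubed_power_single by blast
  have "diagram_span D = ?M - ?N"
    unfolding diagram_span_def f_poly_def ms(2) by (rule span_single_times[OF ms(1) ext])
  then show ?thesis
    using faces_D virt.num_faces by (simp add: crossing_number_def)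
qed

end

theorem theorem1p3:
  fixes D :: vdiagram
  assumes "v_alternating D"
  shows "diagram_span D = 4 * (int (crossing_number D) - int (supporting_genus D)
                               + int (num_components D) - 1) + 2 \<and>
         (connected_diagram D \<longrightarrow>
           diagram_span D = 4 * (int (crossing_number D) - int (supporting_genus D)) + 2)"
proof -
  obtain D' p where D': "virtual_link_diagram D'" "proper D'" "alternating D'" "p \<in> reals D'" "D = virtualize D' p"
    using assms by (auto simp: v_alternating_def)
  interpret v_alternating_diagram D' p
    by unfold_locales (use D' in auto)
  show ?thesis using span_D D'(5) by (simp add: connected_diagram_def)
qed

end
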